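(* As formal power series in $q$ (equivalently, for $|q|<1$), $$\sum_{n=0}^\infty f(150n+25)q^n=5\left(\frac{E_{2}^{5}E_5^4}{E_1^{6}E_{10}^2}+160q\,\frac{E_2^{11}E_5^4}{E_1^{14}}+2000q^2\,\frac{E_2^{11}E_5^{10}}{E_1^{20}}\right).$$ Furthermore, for every nonnegative integer $n$, $$f(18750n+15625)\equiv 0\pmod{125}.$$
   Context: For a positive integer $j$, $E_j:=(q^j;q^j)_\infty=\prod_{k\ge1}(1-q^{jk})$. Here $f(n)$ denotes the number of 1-shell totally symmetric plane partitions of $n$. A plane partition of $n$, viewed as a finite set of $n$ points of $\mathbb{Z}_{\ge1}^3$ that is closed downward under the coordinatewise order, is totally symmetric if it is invariant under all permutations of the three coordinates. It is a 1-shell totally symmetric plane partition if moreover it contains no point with all three coordinates at least $2$; equivalently, written as an array, its first row and first column are the same self-conjugate ordinary partition and all other nonzero entries (those outside the first row and first column) equal $1$. The generating function is $\sum_{n\ge0} f(n)q^n=1+\sum_{n\ge1}q^{3n-2}\prod_{i=0}^{n-2}(1+q^{6i+3})$; for example $f(25)=5$. *)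

theory Defs
  imports
    "HOL-Analysis.Analysis"
    "HOL-Computational_Algebra.Formal_Power_Series"
    "HOL-Number_Theory.Cong"
begin

(* Orders on tuples are not used below, since the product order and the lexicographic
   order compete for them in the library; closure is spelled out coordinatewise. *)
definition plane_partition :: "nat \<Rightarrow> (nat \<times> nat \<times> nat) set \<Rightarrow> bool" where
  "plane_partition n P \<longleftrightarrow>
     finite P \<and> card P = n \<and>
     (\<forall>x y z. (x, y, z) \<in> P \<longrightarrow> 1 \<le> x \<and> 1 \<le> y \<and> 1 \<le> z) \<and>
     (\<forall>x y z x' y' z'.
        (x, y, z) \<in> P \<and> 1 \<le> x' \<and> x' \<le> x \<and> 1 \<le> y' \<and> y' \<le> y \<and> 1 \<le> z' \<and> z' \<le> z
        \<longrightarrow> (x', y', z') \<in> P)"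

definition totally_symmetric :: "(nat \<times> nat \<times> nat) set \<Rightarrow> bool" where
  "totally_symmetric P \<longleftrightarrow>
     (\<forall>x y z. (x, y, z) \<in> P \<longrightarrow>
        {(x, y, z), (x, z, y), (y, x, z), (y, z, x), (z, x, y), (z, y, x)} \<subseteq> P)"

definition one_shell :: "(nat \<times> nat \<times> nat) set \<Rightarrow> bool" where
  "one_shell P \<longleftrightarrow> (\<forall>x y z. (x, y, z) \<in> P \<longrightarrow> \<not> (2 \<le> x \<and> 2 \<le> y \<and> 2 \<le> z))"

definition one_shell_tspp_count :: "nat \<Rightarrow> nat" where
  "one_shell_tspp_count n =
     card {P. plane_partition n P \<and> totally_symmetric P \<and> one_shell P}"

(* The infinite product is taken in the X-adic topology of formal power series. *)
definition euler_E :: "nat \<Rightarrow> complex fps" where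
  "euler_E j = (\<Prod>k. 1 - fps_X ^ (j * Suc k))"

end

theory Submission
  imports Defs
begin

text \<open>
Write (x; q)_n for the product of the 1 - x q^i over i < n and [n, j] for a Gaussian binomial.

Counting. A nonempty 1-shell totally symmetric plane partition is determined by its bottom layer,
a self-conjugate Ferrers diagram. If the first row of that diagram has n + 1 cells, then removing
the principal hook leaves a self-conjugate diagram D inside an n by n square, and inclusion and
exclusion gives 3 (n + |D|) + 1 points. Removing hooks repeatedly shows that the diagrams D have
generating polynomial (-q; q^2)_n, so f(3m + 1) is the coefficient of q^m in
S(q) = sum_n q^n (-q; q^2)_n (\<open>one_shell_count\<close>).

The even part of S. Expanding (-q; q^2)_n by the q-binomial theorem, only the terms with n = j + 2l
contribute to even exponents. After replacing q^2 by q they group into the column sums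
A_r = sum_j q^(j(j+1)/2) [j + r, j] with r = 2l. These telescope, (1 - q^r) A_r = A_(r-2), and A_0 is the
triangular theta series psi = E_2^2 / E_1. Hence the even part is
psi * sum_l q^l / (q^2; q^2)_l = psi * E_2 / E_1 = E_2^3 / E_1^2, whose coefficients are the f(6k + 1)
(\<open>one_shell_even\<close>). Because 150 n + 25 = 6 (5 (5 n) + 4) + 1, the theorem asks for the coefficients of this
quotient in residue class 4 modulo 5 and then in residue class 0 modulo 5.

The two sections. By the Jacobi triple product the theta series have explicit 5-dissections. The
dissection of E_1 depends on one series u (the reciprocal of the Rogers--Ramanujan continued fraction
without its fractional power of q), that of E_2 on U(q) = u(q^2), and comparing the dissections of the two
sides of E_2^2 = psi E_1 expresses the dissection of psi by u and U and yields Rogers' identity between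
them (\<open>rogers\<close>). With k = q / (u U^2) everything becomes rational in u and k. The norm of E_1 over the fifth
roots of unity evaluates E_1^6 / E_5^6 in these terms (\<open>E1_norm\<close>). Extracting cube roots, and adding one relation that
comes from the product formula for the dissection of psi, gives for x = q E_2 E_10^3 / (E_1^3 E_5) the identities
1 + 4x = E_2^2 E_5^4 / (E_1^4 E_10^2) and 1 + 5x = E_2^5 E_5 / (E_1^5 E_10) (\<open>level_10_relations\<close>). The first section
is then a single eta quotient, 5 E_2^2 E_5^2 E_10 / E_1^4 (\<open>first_section\<close>). Up to a series in q^5 it is 5 / phi(-q)^2
with phi(-q) = E_1^2 / E_2, and the remaining section of 1 / phi(-q)^2 is a symmetric function of the two
nontrivial parts of the dissection of phi(-q), hence an eta quotient times a polynomial in x (\<open>second_section\<close>).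

The congruence. Since 18750 n + 15625 = 150 (125 n + 104) + 25, three further sections 4, 0, 4 are needed, and
the factor 5 leaves a congruence modulo 25. Modulo 25 the polynomial in x collapses to its two lowest terms,
E_5^3 / (E_10 E_1) + 15 q E_1 E_2 E_10^2 E_5. Ramanujan's identity for p(5n + 4) makes the section of the first summand
divisible by 5, so from then on congruences modulo 5 suffice, where E_1^5 and E_5 agree. The next two sections
turn the series into 20 E_5^3 / (E_10 E_1), and the last one contributes another factor 5 (\<open>fifth_section\<close>).
\<close>

unbundle no vec_syntax
unbundle fps_syntax

section \<open>Limits of formal power series and infinite q-products\<close>

lemma fps_tendsto_mult:
  fixes f g :: "'b \<Rightarrow> 'a::comm_ring_1 fps"
  assumes "(f \<longlongrightarrow> a) F" "(g \<longlongrightarrow> b) F"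
  shows "((\<lambda>x. f x * g x) \<longlongrightarrow> a * b) F"
proof (rule tendsto_fpsI)
  fix n
  have "\<forall>\<^sub>F x in F. \<forall>i\<in>{..n}. f x $ i = a $ i"
    using assms(1) by (subst eventually_ball_finite_distrib) (auto simp: tendsto_fps_iff)
  moreover have "\<forall>\<^sub>F x in F. \<forall>i\<in>{..n}. g x $ i = b $ i"
    using assms(2) by (subst eventually_ball_finite_distrib) (auto simp: tendsto_fps_iff)
  ultimately show "\<forall>\<^sub>F x in F. (f x * g x) $ n = (a * b) $ n"
    by eventually_elim (auto simp: fps_mult_nth intro!: sum.cong)
qed

lemma fps_tendsto_prod:
  fixes f :: "'i \<Rightarrow> 'b \<Rightarrow> 'a::comm_ring_1 fps"
  assumes "\<And>i. i \<in> I \<Longrightarrow> (f i \<longlongrightarrow> a i) F"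
  shows "((\<lambda>x. \<Prod>i\<in>I. f i x) \<longlongrightarrow> (\<Prod>i\<in>I. a i)) F"
  using assms by (induction I rule: infinite_finite_induct) (auto intro!: fps_tendsto_mult)

lemma fps_const_minus_1 [simp]: "fps_const (- 1) = (- 1 :: 'a::ring_1 fps)"
  by (metis fps_const_1_eq_1 fps_const_neg)

text \<open>The infinite q-shifted factorial (-c q^a; q^m). For positive m the factors with k > n are 1 up to order n,
so the coefficient of q^n can be read off from a finite product.\<close>

definition qpoch :: "complex \<Rightarrow> nat \<Rightarrow> nat \<Rightarrow> complex fps" where
  "qpoch c a m = Abs_fps (\<lambda>n. (\<Prod>k<Suc n. 1 + fps_const c * fps_X ^ (m * k + a)) $ n)"

lemma qpoch_nth:
  assumes "m > 0" "N > n"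
  shows "qpoch c a m $ n = (\<Prod>k<N. 1 + fps_const c * fps_X ^ (m * k + a)) $ n"
  using assms(2)
proof (induction N)
  case (Suc N)
  show ?case
  proof (cases "N = n")
    case False
    have "1 * N \<le> m * N" using assms(1) by (intro mult_le_mono1) simp
    then have "n < m * N + a" using Suc.prems False by linarith
    then have "(P * (1 + fps_const c * fps_X ^ (m * N + a))) $ n = P $ n" for P
    proof -
      have "P * (1 + fps_const c * fps_X ^ (m * N + a)) = P + (fps_const c * P) * fps_X ^ (m * N + a)"
        by (simp add: algebra_simps)
      with \<open>n < m * N + a\<close> show ?thesis by (simp add: fps_X_power_mult_right_nth)
    qed
    with False Suc show ?thesis by (simp add: qpoch_def)
  qed (simp add: qpoch_def)
qed simp

lemma qpoch_tendsto:
  assumes "m > 0"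
  shows "(\<lambda>N. \<Prod>k<N. 1 + fps_const c * fps_X ^ (m * k + a)) \<longlonglongrightarrow> qpoch c a m"
proof (rule tendsto_fpsI)
  fix n
  show "\<forall>\<^sub>F N in sequentially. (\<Prod>k<N. 1 + fps_const c * fps_X ^ (m * k + a)) $ n = qpoch c a m $ n"
    using eventually_gt_at_top[of n]
    by eventually_elim (simp add: qpoch_nth[OF assms])
qed

lemma qpoch_unique:
  assumes "m > 0" "(\<lambda>N. \<Prod>k<N. 1 + fps_const c * fps_X ^ (m * k + a)) \<longlonglongrightarrow> L"
  shows "qpoch c a m = L"
  using LIMSEQ_unique[OF qpoch_tendsto[OF assms(1)] assms(2)] .

lemma qpoch_nth_0: "a > 0 \<Longrightarrow> m > 0 \<Longrightarrow> qpoch c a m $ 0 = 1"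
  by (simp add: qpoch_def)

lemma euler_E_eq: 
  assumes "j > 0" shows "euler_E j = qpoch (-1) j j"
proof -
  let ?f = "\<lambda>k. 1 - fps_X ^ (j * Suc k) :: complex fps"
  have "(\<lambda>N. \<Prod>k<N. ?f k) \<longlonglongrightarrow> qpoch (-1) j j"
    using qpoch_tendsto[OF assms, of "-1" j] by (simp add: algebra_simps)
  then have "(\<lambda>N. \<Prod>k\<le>N. ?f k) \<longlonglongrightarrow> qpoch (-1) j j"
    unfolding LIMSEQ_lessThan_iff_atMost .
  moreover have "qpoch (-1) j j \<noteq> 0" using qpoch_nth_0[OF assms assms, of "-1"] by force
  ultimately have "?f has_prod qpoch (-1) j j"
    by (simp add: has_prod_def raw_has_prod_def)
  then show ?thesis unfolding euler_E_def by (rule has_prod_unique[symmetric])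
qed

lemma euler_E_tendsto:
  assumes "j > 0" shows "(\<lambda>N. \<Prod>k<N. 1 - fps_X ^ (j * k + j)) \<longlonglongrightarrow> euler_E j"
  using qpoch_tendsto[OF assms, of "-1" j] by (simp add: euler_E_eq assms)

lemma euler_E_nth_0: "j > 0 \<Longrightarrow> euler_E j $ 0 = 1"
  by (simp add: euler_E_eq qpoch_nth_0)

text \<open>The exponents are sorted by their residue class modulo m d.\<close>

lemma qpoch_split:
  assumes "m > 0" "d > 0"
  shows "qpoch c a m = (\<Prod>r<d. qpoch c (a + m * r) (m * d))"
proof (rule qpoch_unique[OF assms(1)])
  define f :: "nat \<Rightarrow> complex fps" where "f = (\<lambda>k. 1 + fps_const c * fps_X ^ (m * k + a))"
  have "(\<lambda>N. \<Prod>r<d. \<Prod>k<N. 1 + fps_const c * fps_X ^ (m * d * k + (a + m * r)))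
          \<longlonglongrightarrow> (\<Prod>r<d. qpoch c (a + m * r) (m * d))"
    by (intro fps_tendsto_prod qpoch_tendsto) (use assms in auto)
  moreover have "(\<Prod>r<d. \<Prod>k<N. 1 + fps_const c * fps_X ^ (m * d * k + (a + m * r))) = (\<Prod>k<N*d. f k)" for N
  proof -
    have "(\<Prod>k<N*d. f k) = (\<Prod>k<N. prod f {k * d..<k * d + d})"
      by (rule prod.nat_group[symmetric])
    also have "\<dots> = (\<Prod>k<N. \<Prod>r<d. f (k * d + r))"
    proof (rule prod.cong[OF refl])
      fix k show "prod f {k * d..<k * d + d} = (\<Prod>r<d. f (k * d + r))"
        by (rule prod.reindex_bij_witness[of _ "\<lambda>r. k * d + r" "\<lambda>i. i - k * d"]) auto
    qed
    also have "\<dots> = (\<Prod>r<d. \<Prod>k<N. f (k * d + r))" by (rule prod.swap)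
    finally show ?thesis by (simp add: f_def algebra_simps)
  qed
  ultimately have lim: "(\<lambda>N. \<Prod>k<N*d. f k) \<longlonglongrightarrow> (\<Prod>r<d. qpoch c (a + m * r) (m * d))" by simp
  have "(\<lambda>N. \<Prod>k<N*d. f k) \<longlonglongrightarrow> qpoch c a m"
    using qpoch_tendsto[OF assms(1), of c a, folded f_def] 
    by (rule filterlim_compose)
      (use assms(2) in \<open>auto intro!: filterlim_subseq strict_monoI\<close>)
  with lim have "qpoch c a m = (\<Prod>r<d. qpoch c (a + m * r) (m * d))" using LIMSEQ_unique by blast
  then show "(\<lambda>N. \<Prod>k<N. 1 + fps_const c * fps_X ^ (m * k + a)) \<longlonglongrightarrow> (\<Prod>r<d. qpoch c (a + m * r) (m * d))"
    using qpoch_tendsto[OF assms(1), of c a] by simp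
qed

lemma qpoch_plus_minus:
  assumes "m > 0"
  shows "qpoch 1 a m * qpoch (-1) a m = qpoch (-1) (2 * a) (2 * m)"
proof (rule qpoch_unique[symmetric])
  have "(\<lambda>N. (\<Prod>k<N. 1 + fps_const 1 * fps_X ^ (m * k + a)) * (\<Prod>k<N. 1 + fps_const (-1) * fps_X ^ (m * k + a)))
     \<longlonglongrightarrow> qpoch 1 a m * qpoch (-1) a m"
    by (intro fps_tendsto_mult qpoch_tendsto assms)
  moreover have "(\<Prod>k<N. 1 + fps_const 1 * fps_X ^ (m * k + a)) * (\<Prod>k<N. 1 + fps_const (-1) * fps_X ^ (m * k + a))
     = (\<Prod>k<N. 1 + fps_const (-1) * (fps_X :: complex fps) ^ (2 * m * k + 2 * a))" for N
  proof -
    have *: "(1 + fps_const 1 * x) * (1 + fps_const (-1) * x) = 1 + fps_const (-1) * x ^ 2" for x :: "complex fps"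
      by (simp add: algebra_simps power2_eq_square)
    show ?thesis
      unfolding prod.distrib[symmetric] * power_mult[symmetric] by (simp add: algebra_simps)
  qed
  ultimately show "(\<lambda>N. \<Prod>k<N. 1 + fps_const (-1) * fps_X ^ (2 * m * k + 2 * a)) \<longlonglongrightarrow> qpoch 1 a m * qpoch (-1) a m"
    by simp
qed (use assms in simp)

lemma qpoch_step:
  assumes "m > 0"
  shows "qpoch c a m = (1 + fps_const c * fps_X ^ a) * qpoch c (a + m) m"
proof (rule qpoch_unique[OF assms])
  have "(\<lambda>N. (1 + fps_const c * fps_X ^ a) * (\<Prod>k<N. 1 + fps_const c * fps_X ^ (m * k + (a + m))))
     \<longlonglongrightarrow> (1 + fps_const c * fps_X ^ a) * qpoch c (a + m) m"
    by (intro fps_tendsto_mult qpoch_tendsto assms tendsto_const)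
  then have "(\<lambda>N. \<Prod>k<Suc N. 1 + fps_const c * fps_X ^ (m * k + a))
     \<longlonglongrightarrow> (1 + fps_const c * fps_X ^ a) * qpoch c (a + m) m"
    by (subst prod.lessThan_Suc_shift) (simp add: algebra_simps)
  then show "(\<lambda>N. \<Prod>k<N. 1 + fps_const c * fps_X ^ (m * k + a))
     \<longlonglongrightarrow> (1 + fps_const c * fps_X ^ a) * qpoch c (a + m) m"
    by (subst (asm) filterlim_sequentially_Suc)
qed

section \<open>Dilation of the variable\<close>

definition dilate :: "nat \<Rightarrow> complex fps \<Rightarrow> complex fps" where
  "dilate m f = f oo fps_X ^ m"

lemma dilate_nth: "m > 0 \<Longrightarrow> dilate m f $ n = (if m dvd n then f $ (n div m) else 0)"
proof -
  assume m: "m > 0"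
  have "dilate m f $ n = (\<Sum>i = 0..n. if n = m * i then f $ i else 0)"
    unfolding dilate_def fps_compose_nth
    by (intro sum.cong refl) (simp add: power_mult[symmetric] fps_X_power_nth)
  also have "\<dots> = (if m dvd n then f $ (n div m) else 0)"
  proof (cases "m dvd n")
    case True
    then have "(\<Sum>i = 0..n. if n = m * i then f $ i else 0) = (\<Sum>i = 0..n. if i = n div m then f $ i else 0)"
      using m by (intro sum.cong refl if_cong) auto
    with True show ?thesis by simp
  qed (auto intro!: sum.neutral)
  finally show "dilate m f $ n = (if m dvd n then f $ (n div m) else 0)" .
qed

lemma dilate_mult: "m > 0 \<Longrightarrow> dilate m (f * g) = dilate m f * dilate m g"
  by (simp add: dilate_def fps_compose_mult_distrib)
lemma dilate_power: "m > 0 \<Longrightarrow> dilate m (f ^ k) = dilate m f ^ k"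
  by (simp add: dilate_def fps_compose_power)
lemma dilate_add: "dilate m (f + g) = dilate m f + dilate m g"
  by (simp add: dilate_def fps_compose_add_distrib)
lemma dilate_diff: "dilate m (f - g) = dilate m f - dilate m g"
  by (simp add: dilate_def fps_compose_sub_distrib)
lemma dilate_uminus: "dilate m (- f) = - dilate m f"
  by (simp add: dilate_def fps_compose_uminus)
lemma dilate_1: "dilate m 1 = 1" by (simp add: dilate_def)
lemma dilate_0: "dilate m 0 = 0" by (simp add: dilate_def)
lemma dilate_const: "dilate m (fps_const c) = fps_const c" by (simp add: dilate_def)
lemma dilate_numeral: "dilate m (numeral k) = numeral k" by (simp add: dilate_def)
lemma dilate_X: "m > 0 \<Longrightarrow> dilate m fps_X = fps_X ^ m"
  by (simp add: dilate_def)
lemma dilate_inverse: "m > 0 \<Longrightarrow> f $ 0 \<noteq> 0 \<Longrightarrow> dilate m (inverse f) = inverse (dilate m f)"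
  by (simp add: dilate_def fps_inverse_compose)
lemma dilate_divide: "m > 0 \<Longrightarrow> g $ 0 \<noteq> 0 \<Longrightarrow> dilate m (f / g) = dilate m f / dilate m g"
  by (simp add: dilate_def fps_divide_compose)

lemmas dilate_simps = dilate_mult dilate_power dilate_add dilate_diff dilate_uminus dilate_1 dilate_0
  dilate_const dilate_numeral dilate_X dilate_inverse dilate_divide

lemma dilate_inj: "m > 0 \<Longrightarrow> dilate m f = dilate m g \<longleftrightarrow> f = g"
proof
  assume m: "m > 0" and eq: "dilate m f = dilate m g"
  show "f = g"
  proof (rule fps_ext)
    fix n show "f $ n = g $ n" using arg_cong[OF eq, of "\<lambda>h. h $ (m * n)"] m by (simp add: dilate_nth)
  qed
qed simp

lemma dilate_nth_0 [simp]: "dilate m f $ 0 = f $ 0" by (simp add: dilate_def)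

lemma dilate_dilate: "m > 0 \<Longrightarrow> n > 0 \<Longrightarrow> dilate m (dilate n f) = dilate (m * n) f"
  by (rule fps_ext) (auto simp: dilate_nth div_mult2_eq elim!: dvdE)

lemma dilate_tendsto:
  assumes "m > 0" "f \<longlonglongrightarrow> g" shows "(\<lambda>N. dilate m (f N)) \<longlonglongrightarrow> dilate m g"
  using assms by (auto simp: tendsto_fps_iff dilate_nth)

lemma dilate_prod: "d > 0 \<Longrightarrow> dilate d (\<Prod>i\<in>I. f i) = (\<Prod>i\<in>I. dilate d (f i))"
  by (induction I rule: infinite_finite_induct) (simp_all add: dilate_simps)

lemma dilate_qpoch:
  assumes "d > 0" "m > 0"
  shows "dilate d (qpoch c a m) = qpoch c (d * a) (d * m)"
proof (rule qpoch_unique[symmetric])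
  show "(\<lambda>N. \<Prod>k<N. 1 + fps_const c * fps_X ^ (d * m * k + d * a)) \<longlonglongrightarrow> dilate d (qpoch c a m)"
    using dilate_tendsto[OF assms(1) qpoch_tendsto[OF assms(2), of c a]]
    by (simp add: dilate_prod dilate_simps assms power_mult[symmetric] distrib_left mult.assoc)
qed (use assms in simp)

lemma dilate_euler_E: "d > 0 \<Longrightarrow> j > 0 \<Longrightarrow> dilate d (euler_E j) = euler_E (d * j)"
  by (simp add: euler_E_eq dilate_qpoch)

section \<open>Gaussian binomial coefficients\<close>

fun qbin :: "'a::comm_ring_1 \<Rightarrow> nat \<Rightarrow> nat \<Rightarrow> 'a" where
  "qbin q n 0 = 1"
| "qbin q 0 (Suc k) = 0"
| "qbin q (Suc n) (Suc k) = qbin q n k + q ^ Suc k * qbin q n (Suc k)"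

lemma qbin_eq_0: "n < k \<Longrightarrow> qbin q n k = 0"
  by (induction q n k rule: qbin.induct) auto

lemma qbin_diag: "qbin q n n = 1" by (induction n) (simp_all add: qbin_eq_0)

text \<open>The homogeneous form of the q-binomial theorem. It lets the triple product be centred by the choice
of w as a power of q, where the usual proof substitutes a negative power.\<close>

theorem qbin_theorem:
  fixes q z w :: "'a::comm_ring_1"
  shows "(\<Prod>i<n. w + z * q ^ i) = (\<Sum>k\<le>n. q ^ (k choose 2) * qbin q n k * z ^ k * w ^ (n - k))"
proof (induction n arbitrary: z)
  case (Suc n)
  let ?t = "\<lambda>n k. q ^ (k choose 2) * qbin q n k * z ^ k * w ^ (n - k)"
  have "(\<Prod>i<Suc n. w + z * q ^ i) = (w + z) * (\<Prod>i<n. w + (z * q) * q ^ i)"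
    by (subst prod.lessThan_Suc_shift) (simp add: mult.assoc)
  also have "\<dots> = (w + z) * (\<Sum>k\<le>n. q ^ k * ?t n k)"
    unfolding Suc.IH by (simp add: power_mult_distrib mult_ac)
  also have "\<dots> = (\<Sum>k\<le>n. w * (q ^ k * ?t n k)) + (\<Sum>k\<le>n. z * (q ^ k * ?t n k))"
    by (simp only: distrib_right sum_distrib_left sum.distrib)
  also have "(\<Sum>k\<le>n. w * (q ^ k * ?t n k)) = (\<Sum>k\<le>Suc n. w * (q ^ k * ?t n k))"
    by (simp add: qbin_eq_0)
  also have "\<dots> = w ^ Suc n + (\<Sum>k\<le>n. w * (q ^ Suc k * ?t n (Suc k)))"
    by (subst sum.atMost_Suc_shift) (simp add: numeral_2_eq_2)
  also have "w ^ Suc n + (\<Sum>k\<le>n. w * (q ^ Suc k * ?t n (Suc k))) + (\<Sum>k\<le>n. z * (q ^ k * ?t n k))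
     = w ^ Suc n + ((\<Sum>k\<le>n. w * (q ^ Suc k * ?t n (Suc k))) + (\<Sum>k\<le>n. z * (q ^ k * ?t n k)))"
    by (rule add.assoc)
  also have "(\<Sum>k\<le>n. w * (q ^ Suc k * ?t n (Suc k))) + (\<Sum>k\<le>n. z * (q ^ k * ?t n k))
     = (\<Sum>k\<le>n. ?t (Suc n) (Suc k))"
  proof (subst sum.distrib[symmetric], intro sum.cong refl)
    fix k assume k: "k \<in> {..n}"
    have c: "Suc k choose 2 = k + (k choose 2)" by (simp add: numeral_2_eq_2)
    have e: "w * (q ^ Suc k * ?t n (Suc k)) = 
       q ^ (Suc k choose 2) * (q ^ Suc k * qbin q n (Suc k)) * z ^ Suc k * w ^ (Suc n - Suc k)"
    proof (cases "k = n")
      case False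
      then have "Suc n - Suc k = Suc (n - Suc k)" using k by auto
      then show ?thesis by (simp add: mult_ac)
    qed (simp add: qbin_eq_0)
    show "w * (q ^ Suc k * ?t n (Suc k)) + z * (q ^ k * ?t n k) = ?t (Suc n) (Suc k)"
      unfolding e by (simp add: c power_add algebra_simps)
  qed
  also have "w ^ Suc n + (\<Sum>k\<le>n. ?t (Suc n) (Suc k)) = (\<Sum>k\<le>Suc n. ?t (Suc n) k)"
    by (subst sum.atMost_Suc_shift) (simp add: numeral_2_eq_2 del: qbin.simps(3))
  finally show ?case .
qed (simp add: numeral_2_eq_2)

definition qfac :: "'a::comm_ring_1 \<Rightarrow> nat \<Rightarrow> 'a" where
  "qfac q n = (\<Prod>i<n. 1 - q ^ Suc i)"

lemma qfac_0 [simp]: "qfac q 0 = 1" by (simp add: qfac_def)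
lemma qfac_Suc: "qfac q (Suc n) = qfac q n * (1 - q ^ Suc n)"
  by (simp add: qfac_def)

lemma qbin_qfac:
  "k \<le> n \<Longrightarrow> qbin q n k * qfac q k * qfac q (n - k) = qfac (q::'a::comm_ring_1) n"
proof (induction q n k rule: qbin.induct)
  case (3 q n k)
  show ?case
  proof (cases "k = n")
    case True
    with 3(1) show ?thesis by (simp add: qbin_eq_0 qfac_Suc mult.assoc[symmetric])
  next
    case False
    then have k: "Suc k \<le> n" using 3(3) by auto
    then have n: "n - k = Suc (n - Suc k)" by auto
    have IH1: "qbin q n k * qfac q k * qfac q (n - k) = qfac q n" using 3(1) k by auto
    have IH2: "qbin q n (Suc k) * qfac q (Suc k) * qfac q (n - Suc k) = qfac q n" using 3(2) k by auto
    have "qbin q (Suc n) (Suc k) * qfac q (Suc k) * qfac q (Suc n - Suc k) = 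
      (qbin q n k * qfac q k * qfac q (n - k)) * (1 - q ^ Suc k) + 
      q ^ Suc k * (1 - q ^ Suc (n - Suc k)) * (qbin q n (Suc k) * qfac q (Suc k) * qfac q (n - Suc k))"
      using n by (simp add: qfac_Suc algebra_simps)
    also have "\<dots> = qfac q n * (1 - q ^ Suc k * q ^ Suc (n - Suc k))"
      unfolding IH1 IH2 by (simp add: algebra_simps)
    also have "q ^ Suc k * q ^ Suc (n - Suc k) = q ^ Suc n"
      unfolding power_add[symmetric] using k by (intro arg_cong[of _ _ "power q"]) auto
    finally show ?thesis by (simp add: qfac_Suc)
  qed
qed auto

section \<open>The Jacobi triple product\<close>

text \<open>Congruence modulo the power q^D.\<close>

definition agree :: "nat \<Rightarrow> 'a::comm_ring_1 fps \<Rightarrow> 'a fps \<Rightarrow> bool" where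
  "agree D f g \<longleftrightarrow> (\<forall>i<D. f $ i = g $ i)"

lemma agree_mult: "agree D f g \<Longrightarrow> agree D f' g' \<Longrightarrow> agree D (f * f') (g * g')"
  by (auto simp: agree_def fps_mult_nth intro!: sum.cong)

lemma agree_sym: "agree D f g \<Longrightarrow> agree D g f" by (auto simp: agree_def)
lemma agree_trans: "agree D f g \<Longrightarrow> agree D g h \<Longrightarrow> agree D f h" by (auto simp: agree_def)
lemma agree_refl: "agree D f f" by (auto simp: agree_def)
lemma agree_mono: "agree D f g \<Longrightarrow> D' \<le> D \<Longrightarrow> agree D' f g" by (auto simp: agree_def)

lemma agree_sum: "(\<And>i. i \<in> A \<Longrightarrow> agree M (f i) (g i)) \<Longrightarrow> agree M (sum f A) (sum g A)"
  by (auto simp: agree_def fps_sum_nth)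

lemma agree_diff: "agree M f g \<Longrightarrow> agree M f' g' \<Longrightarrow> agree M (f - f') (g - g')"
  by (auto simp: agree_def)

lemma agree_X_power: "M \<le> j \<Longrightarrow> agree M (fps_X ^ j * f) 0"
  by (auto simp: agree_def fps_X_power_mult_nth)

lemma qfac_agree_qpoch:
  assumes "m > 0"
  shows "agree (m * Suc M) (qfac (fps_X ^ m) M) (qpoch (-1) m m)"
  unfolding agree_def
proof (intro allI impI)
  fix i assume i: "i < m * Suc M"
  let ?P = "\<lambda>N. \<Prod>k<N. 1 + fps_const (-1) * fps_X ^ (m * k + m) :: complex fps"
  have "?P (M + d) $ i = ?P M $ i" for d
  proof (induction d)
    case (Suc d)
    have "m * Suc M \<le> m * (M + d) + m" by simp
    then have less: "i < m * (M + d) + m" using i by linarith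
    have "P * (1 + fps_const (-1) * fps_X ^ j) = P - P * fps_X ^ j" for P :: "complex fps" and j
      by (simp add: algebra_simps)
    with less Suc show ?case by (simp add: fps_X_power_mult_right_nth del: fps_const_minus_1)
  qed simp
  from this[of "Suc i"] have "qpoch (-1) m m $ i = ?P M $ i"
    using qpoch_nth[OF assms, of i "M + Suc i" "-1" m] by simp
  also have "?P M = qfac (fps_X ^ m) M"
    unfolding qfac_def by (intro prod.cong refl) (simp add: power_mult[symmetric] power_add[symmetric] add.commute)
  finally show "qfac (fps_X ^ m) M $ i = qpoch (-1) m m $ i" ..
qed

text \<open>A Gaussian binomial is a quotient of q-factorials, each of which agrees with the infinite product up
to an order governed by its length. Hence the binomial behaves like the reciprocal of the infinite product.\<close>

lemma qbin_agree:
  assumes "m > 0" "k \<le> N"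
  shows "agree (m * Suc (min k (N - k))) (qpoch (-1) m m * qbin (fps_X ^ m) N k) 1"
proof -
  let ?E = "qpoch (-1) m m" and ?D = "m * Suc (min k (N - k))" and ?b = "qbin (fps_X ^ m :: complex fps) N k"
  have le: "agree ?D (qfac (fps_X ^ m) M) ?E" if "min k (N - k) \<le> M" for M
    by (rule agree_mono[OF qfac_agree_qpoch[OF assms(1)]]) (use that in simp)
  have "agree ?D (?b * qfac (fps_X ^ m) k * qfac (fps_X ^ m) (N - k)) (?b * ?E * ?E)"
    by (intro agree_mult agree_refl le) auto
  moreover have "agree ?D (qfac (fps_X ^ m) N) ?E" using assms(2) by (intro le) auto
  ultimately have "agree ?D (?b * ?E * ?E) ?E"
    unfolding qbin_qfac[OF assms(2)] by (blast intro: agree_sym agree_trans)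
  then have "agree ?D ((?b * ?E * ?E) * inverse ?E) (?E * inverse ?E)"
    by (intro agree_mult agree_refl)
  moreover have "?E * inverse ?E = 1" using qpoch_nth_0[OF assms(1) assms(1)]
    by (intro inverse_mult_eq_1') simp
  ultimately show ?thesis by (simp add: mult.assoc) (simp add: mult.commute)
qed

text \<open>The exponent a j (j + 1) / 2 + b j (j - 1) / 2 of Ramanujan's general theta function. The series f(c q^a, c q^b)
has the signs c^j because c is 1 or -1.\<close>

definition texp :: "nat \<Rightarrow> nat \<Rightarrow> int \<Rightarrow> nat" where
  "texp a b j = nat ((int a * (j * (j + 1)) + int b * (j * (j - 1))) div 2)"

definition theta :: "complex \<Rightarrow> nat \<Rightarrow> nat \<Rightarrow> complex fps" where
  "theta c a b = Abs_fps (\<lambda>n. \<Sum>j | texp a b j = n. c ^ nat \<bar>j\<bar>)"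

lemma texp_double: "2 * int (texp a b j) = int a * (j * (j + 1)) + int b * (j * (j - 1))"
proof -
  have "even (int a * (j * (j + 1)) + int b * (j * (j - 1)))" by auto
  moreover have "j * (j + 1) \<ge> 0" "j * (j - 1) \<ge> 0"
    by (cases "j \<ge> 0"; cases "j \<ge> 1"; auto simp: zero_le_mult_iff)+
  then have "int a * (j * (j + 1)) + int b * (j * (j - 1)) \<ge> 0" by simp
  ultimately show ?thesis unfolding texp_def by auto
qed

lemma texp_eq_iff: "texp a b j = n \<longleftrightarrow> int a * (j * (j + 1)) + int b * (j * (j - 1)) = 2 * int n"
  using texp_double[of a b j] by linarith

text \<open>The exponents grow at least linearly. This makes the theta series well defined and controls the error
terms in the limit of the finite triple product.\<close>

lemma texp_ge:
  assumes "a + b > 0" shows "\<bar>j\<bar> \<le> int (texp a b j) + 1"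
proof -
  have 1: "j * (j + 1) \<ge> 2 * \<bar>j\<bar> - 2" "j * (j - 1) \<ge> 2 * \<bar>j\<bar> - 2"
  proof -
    have "0 \<le> (\<bar>j\<bar> - 1) * (\<bar>j\<bar> - 2)"
      by (cases "\<bar>j\<bar> \<ge> 2") (auto simp: zero_le_mult_iff)
    then have "\<bar>j\<bar> * \<bar>j\<bar> - \<bar>j\<bar> \<ge> 2 * \<bar>j\<bar> - 2" by (simp add: algebra_simps)
    moreover have "\<bar>j\<bar> * \<bar>j\<bar> = j * j" by simp
    ultimately show "j * (j + 1) \<ge> 2 * \<bar>j\<bar> - 2" "j * (j - 1) \<ge> 2 * \<bar>j\<bar> - 2"
      by (auto simp: algebra_simps)
  qed
  have 0: "j * (j + 1) \<ge> 0" "j * (j - 1) \<ge> 0"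
    by (cases "j \<ge> 0"; cases "j \<ge> 1"; auto simp: zero_le_mult_iff)+
  have "2 * \<bar>j\<bar> - 2 \<le> 2 * int (texp a b j)"
  proof (cases "a > 0")
    case True
    then have "1 * (j * (j + 1)) \<le> int a * (j * (j + 1))" using 0 by (intro mult_right_mono) auto
    moreover have "0 \<le> int b * (j * (j - 1))" using 0 by simp
    ultimately show ?thesis using 1 unfolding texp_double by linarith
  next
    case False
    then have "1 * (j * (j - 1)) \<le> int b * (j * (j - 1))" using 0 assms by (intro mult_right_mono) auto
    moreover have "0 \<le> int a * (j * (j + 1))" using 0 by simp
    ultimately show ?thesis using 1 unfolding texp_double by linarith
  qed
  then show ?thesis by simp
qed

lemma texp_finite: "a + b > 0 \<Longrightarrow> finite {j. texp a b j = n}"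
proof (rule finite_subset)
  assume "a + b > 0"
  show "{j. texp a b j = n} \<subseteq> {- int n - 1..int n + 1}"
  proof
    fix j assume "j \<in> {j. texp a b j = n}"
    with texp_ge[OF \<open>a + b > 0\<close>, of j] show "j \<in> {- int n - 1..int n + 1}" by auto
  qed
qed simp

lemma sign_power:
  assumes "c * c = (1::complex)"
  shows "c ^ k = c ^ n * c ^ nat \<bar>int k - int n\<bar>"
proof -
  have sq: "c ^ (2 * d) = 1" for d using assms by (simp add: power_mult power2_eq_square)
  show ?thesis
  proof (cases "n \<le> k")
    case True
    then show ?thesis by (simp add: power_add[symmetric] nat_diff_distrib')
  next
    case False
    then have "n + nat \<bar>int k - int n\<bar> = k + 2 * (n - k)" by auto
    then have "c ^ n * c ^ nat \<bar>int k - int n\<bar> = c ^ k * c ^ (2 * (n - k))"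
      by (simp add: power_add[symmetric])
    then show ?thesis by (simp add: sq)
  qed
qed

lemma prod_lessThan_add:
  fixes f :: "nat \<Rightarrow> 'a::comm_monoid_mult"
  shows "(\<Prod>i<n + m. f i) = (\<Prod>i<n. f i) * (\<Prod>i<m. f (n + i))"
  by (induction m) (simp_all add: mult.assoc)

text \<open>In the q-binomial theorem with 2 n factors, base Q = q^(a + b), w = Q^n and z = c q^a, half of the factors carry
powers of Q that can be pulled out: Q^n + z Q^i = z Q^i (1 + c q^b Q^(n - 1 - i)). What is pulled out cancels against
the same monomial on the right.\<close>

lemma finite_jacobi_triple:
  fixes c :: complex
  assumes c: "c * c = 1" and m: "m = a + b" "m > 0"
  shows "(\<Prod>i<n. 1 + fps_const c * fps_X ^ (m * i + a)) * (\<Prod>i<n. 1 + fps_const c * fps_X ^ (m * i + b))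
    = (\<Sum>k\<le>2 * n. qbin (fps_X ^ m) (2 * n) k * 
        (fps_const (c ^ nat \<bar>int k - int n\<bar>) * fps_X ^ texp a b (int k - int n)))"
proof -
  define Q x y :: "complex fps" where "Q = (fps_X :: complex fps) ^ m" and "x = fps_const c * fps_X ^ a" and "y = fps_const c * fps_X ^ b"
  have xy: "x * y = Q" 
  proof -
    have "x * y = fps_const (c * c) * (fps_X ^ a * fps_X ^ b)"
      unfolding x_def y_def fps_const_mult[symmetric] by (simp only: mult_ac)
    then show ?thesis by (simp add: c m Q_def power_add)
  qed
  have fx: "1 + fps_const c * fps_X ^ (m * i + a) = 1 + x * Q ^ i" for i
    unfolding x_def Q_def power_add power_mult by (simp only: mult_ac)
  have fy: "1 + fps_const c * fps_X ^ (m * i + b) = 1 + y * Q ^ i" for i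
    unfolding y_def Q_def power_add power_mult by (simp only: mult_ac)
  define W where "W = x ^ n * Q ^ (n choose 2) * Q ^ (n * n)"
  have "(\<Prod>i<2 * n. Q ^ n + x * Q ^ i) = (\<Prod>i<n. Q ^ n + x * Q ^ i) * (\<Prod>i<n. Q ^ n + x * Q ^ (n + i))"
    by (simp only: mult_2 prod_lessThan_add)
  also have "(\<Prod>i<n. Q ^ n + x * Q ^ (n + i)) = (\<Prod>i<n. Q ^ n * (1 + x * Q ^ i))"
    by (simp add: power_add algebra_simps)
  also have "\<dots> = Q ^ (n * n) * (\<Prod>i<n. 1 + x * Q ^ i)"
    by (simp add: prod.distrib power_mult)
  also have "(\<Prod>i<n. Q ^ n + x * Q ^ i) = (\<Prod>i<n. x * Q ^ i * (1 + y * Q ^ (n - Suc i)))"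
  proof (rule prod.cong[OF refl])
    fix i assume "i \<in> {..<n}"
    then have "n = i + Suc (n - Suc i)" by auto
    then have "Q ^ n = Q ^ i * (Q * Q ^ (n - Suc i))" by (metis power_Suc power_add)
    then show "Q ^ n + x * Q ^ i = x * Q ^ i * (1 + y * Q ^ (n - Suc i))"
      by (simp add: algebra_simps xy[symmetric])
  qed
  also have "\<dots> = x ^ n * (\<Prod>i<n. Q ^ i) * (\<Prod>i<n. 1 + y * Q ^ (n - Suc i))"
    by (simp add: prod.distrib)
  also have "(\<Prod>i<n. Q ^ i) = Q ^ (n choose 2)"
    by (induction n) (simp_all add: numeral_2_eq_2 power_add mult.commute)
  also have "(\<Prod>i<n. 1 + y * Q ^ (n - Suc i)) = (\<Prod>i<n. 1 + y * Q ^ i)"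
    by (rule prod.nat_diff_reindex)
  finally have lhs: "(\<Prod>i<2 * n. Q ^ n + x * Q ^ i) = 
     W * ((\<Prod>i<n. 1 + x * Q ^ i) * (\<Prod>i<n. 1 + y * Q ^ i))"
    by (simp add: W_def mult_ac)
  have W: "W = fps_const (c ^ n) * fps_X ^ (a * n + m * (n choose 2) + m * (n * n))"
    by (simp add: W_def x_def Q_def power_mult_distrib power_mult power_add fps_const_power)
  have "(\<Prod>i<2 * n. Q ^ n + x * Q ^ i) =
     (\<Sum>k\<le>2 * n. Q ^ (k choose 2) * qbin Q (2 * n) k * x ^ k * (Q ^ n) ^ (2 * n - k))"
    by (rule qbin_theorem)
  also have "\<dots> = (\<Sum>k\<le>2 * n. W * (qbin Q (2 * n) k * 
        (fps_const (c ^ nat \<bar>int k - int n\<bar>) * fps_X ^ texp a b (int k - int n))))"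
  proof (rule sum.cong[OF refl])
    fix k assume "k \<in> {..2 * n}"
    then have k: "k \<le> 2 * n" by simp
    have ch: "2 * int (i choose 2) = int i * (int i - 1)" for i
    proof (cases i)
      case (Suc l)
      have "even (Suc l * l)" by simp
      then have "2 * (Suc l choose 2) = Suc l * l" by (simp add: choose_two)
      then have "2 * int (Suc l choose 2) = int (Suc l * l)" by linarith
      then show ?thesis using Suc by (simp add: algebra_simps)
    qed simp
    \<comment> \<open>The exponents of q on both sides, compared after doubling to avoid division by 2.\<close>
    have ex: "m * (k choose 2) + a * k + m * n * (2 * n - k) = 
       (a * n + m * (n choose 2) + m * (n * n)) + texp a b (int k - int n)" (is "?l = ?r")
    proof -
      have kk: "int (2 * n - k) = 2 * int n - int k" using k by simp
      have "2 * int ?l = int m * (2 * int (k choose 2)) + 2 * int a * int k + 2 * int m * int n * int (2 * n - k)"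
        unfolding of_nat_add of_nat_mult by (simp only: distrib_left mult_ac)
      also have "\<dots> = int m * (int k * (int k - 1)) + 2 * int a * int k + 2 * int m * int n * (2 * int n - int k)"
        unfolding kk ch ..
      also have "\<dots> = 2 * int a * int n + int m * (int n * (int n - 1)) + 2 * int m * int n * int n
          + (int a * ((int k - int n) * (int k - int n + 1)) + int b * ((int k - int n) * (int k - int n - 1)))"
        unfolding m by (simp add: algebra_simps)
      also have "\<dots> = 2 * int a * int n + int m * (2 * int (n choose 2)) + 2 * int m * int n * int n
          + 2 * int (texp a b (int k - int n))"
        unfolding ch texp_double ..
      also have "\<dots> = 2 * int ?r" by (simp add: algebra_simps)
      finally show ?thesis unfolding mult_cancel_left of_nat_eq_iff by simp
    qed
    have "Q ^ (k choose 2) * x ^ k * (Q ^ n) ^ (2 * n - k)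
      = fps_const (c ^ k) * fps_X ^ (m * (k choose 2) + a * k + m * n * (2 * n - k))"
      by (simp add: x_def Q_def power_mult_distrib power_mult power_add fps_const_power mult_ac)
    also have "\<dots> = W * (fps_const (c ^ nat \<bar>int k - int n\<bar>) * fps_X ^ texp a b (int k - int n))"
      unfolding ex W sign_power[OF c, of k n] fps_const_mult[symmetric] power_add by (simp only: mult_ac)
    finally have eqk: "Q ^ (k choose 2) * x ^ k * (Q ^ n) ^ (2 * n - k) = 
      W * (fps_const (c ^ nat \<bar>int k - int n\<bar>) * fps_X ^ texp a b (int k - int n))" .
    have "Q ^ (k choose 2) * qbin Q (2 * n) k * x ^ k * (Q ^ n) ^ (2 * n - k) =
      qbin Q (2 * n) k * (Q ^ (k choose 2) * x ^ k * (Q ^ n) ^ (2 * n - k))" by (simp only: mult_ac)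
    also have "\<dots> = W * (qbin Q (2 * n) k * (fps_const (c ^ nat \<bar>int k - int n\<bar>) * fps_X ^ texp a b (int k - int n)))"
      unfolding eqk by (simp only: mult_ac)
    finally show "Q ^ (k choose 2) * qbin Q (2 * n) k * x ^ k * (Q ^ n) ^ (2 * n - k) =
      W * (qbin Q (2 * n) k * (fps_const (c ^ nat \<bar>int k - int n\<bar>) * fps_X ^ texp a b (int k - int n)))" .
  qed
  also have "\<dots> = W * (\<Sum>k\<le>2 * n. qbin Q (2 * n) k * 
        (fps_const (c ^ nat \<bar>int k - int n\<bar>) * fps_X ^ texp a b (int k - int n)))"
    by (simp add: sum_distrib_left)
  finally have eq: "W * ((\<Prod>i<n. 1 + x * Q ^ i) * (\<Prod>i<n. 1 + y * Q ^ i)) = W * (\<Sum>k\<le>2 * n. qbin Q (2 * n) k * 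
        (fps_const (c ^ nat \<bar>int k - int n\<bar>) * fps_X ^ texp a b (int k - int n)))"
    unfolding lhs .
  have "c \<noteq> 0" using c by auto
  then have "W \<noteq> 0" unfolding W by simp
  with eq show ?thesis unfolding fx fy by (simp add: Q_def)
qed

text \<open>The limit of the finite form. In each fixed degree only the indices with small exponent matter, and for these
the Gaussian binomial times the infinite product is 1 to sufficiently high order.\<close>

theorem jacobi_triple_product:
  assumes c: "c * c = 1" and m: "a + b > 0"
  shows "theta c a b = qpoch c a (a + b) * qpoch c b (a + b) * qpoch (-1) (a + b) (a + b)"
proof -
  define m where "m = a + b"
  have m0: "m > 0" using m m_def by simp
  let ?E = "qpoch (-1) m m"
  let ?F = "\<lambda>n. (\<Prod>i<n. 1 + fps_const c * fps_X ^ (m * i + a)) * (\<Prod>i<n. 1 + fps_const c * fps_X ^ (m * i + b)) * ?E"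
  have "?F \<longlonglongrightarrow> qpoch c a m * qpoch c b m * ?E"
    by (intro fps_tendsto_mult qpoch_tendsto m0 tendsto_const)
  moreover have "?F \<longlonglongrightarrow> theta c a b"
  proof (rule tendsto_fpsI)
    fix N
    show "\<forall>\<^sub>F n in sequentially. ?F n $ N = theta c a b $ N"
      using eventually_gt_at_top[of N]
    proof eventually_elim
      case (elim n)
      let ?t = "\<lambda>j. fps_const (c ^ nat \<bar>j\<bar>) * fps_X ^ texp a b j"
      have "?F n $ N = (\<Sum>k\<le>2 * n. (?E * qbin (fps_X ^ m) (2 * n) k * ?t (int k - int n)) $ N)"
        unfolding finite_jacobi_triple[OF c m_def m0]
        by (simp add: sum_distrib_left fps_sum_nth mult_ac mult.commute[of _ ?E])
      also have "\<dots> = (\<Sum>k\<le>2 * n. if texp a b (int k - int n) = N then c ^ nat \<bar>int k - int n\<bar> else 0)"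
      proof (rule sum.cong[OF refl])
        fix k assume "k \<in> {..2 * n}"
        then have k: "k \<le> 2 * n" by simp
        define j where "j = int k - int n"
        have ge: "\<bar>j\<bar> \<le> int (texp a b j) + 1" by (rule texp_ge[OF m])
        have coef: "(B * ?t j) $ N = (if N < texp a b j then 0 else c ^ nat \<bar>j\<bar> * B $ (N - texp a b j))" for B
        proof -
          have *: "B * ?t j = (fps_const (c ^ nat \<bar>j\<bar>) * B) * fps_X ^ texp a b j" by (simp only: mult_ac)
          show ?thesis unfolding * fps_X_power_mult_right_nth by simp
        qed
        show "(?E * qbin (fps_X ^ m) (2 * n) k * ?t (int k - int n)) $ N = 
          (if texp a b (int k - int n) = N then c ^ nat \<bar>int k - int n\<bar> else 0)"
        proof (cases "N < texp a b j")
          case False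
          have "int (min k (2 * n - k)) = int n - \<bar>j\<bar>" using k unfolding j_def by (simp add: min_def of_nat_diff)
          then have "N - texp a b j < Suc (min k (2 * n - k))" using ge elim False by linarith
          also have "\<dots> \<le> m * Suc (min k (2 * n - k))" using mult_le_mono1[of 1 m "Suc (min k (2 * n - k))"] m0 by simp
          finally have "(?E * qbin (fps_X ^ m) (2 * n) k) $ (N - texp a b j) = 1 $ (N - texp a b j)"
            using qbin_agree[OF m0 k] unfolding agree_def by blast
          then show ?thesis using False unfolding j_def[symmetric] coef by auto
        qed (auto simp: coef j_def[symmetric])
      qed
      also have "\<dots> = (\<Sum>k | k \<le> 2 * n \<and> texp a b (int k - int n) = N. c ^ nat \<bar>int k - int n\<bar>)"
        by (subst sum.inter_filter[symmetric]) (auto intro!: sum.cong)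
      also have "\<dots> = (\<Sum>j | texp a b j = N. c ^ nat \<bar>j\<bar>)"
      proof (rule sum.reindex_bij_witness[of _ "\<lambda>j. nat (j + int n)" "\<lambda>k. int k - int n"])
        fix j assume "j \<in> {j. texp a b j = N}"
        then have "\<bar>j\<bar> \<le> int n" using texp_ge[OF m, of j] elim by auto
        then show "int (nat (j + int n)) - int n = j" "nat (j + int n) \<in> {k. k \<le> 2 * n \<and> texp a b (int k - int n) = N}"
          using \<open>j \<in> _\<close> by auto
      qed auto
      finally show ?case by (simp add: theta_def)
    qed
  qed
  ultimately show ?thesis using LIMSEQ_unique unfolding m_def by blast
qed

section \<open>Theta series and their product forms\<close>

abbreviation E :: "nat \<Rightarrow> complex fps" where "E \<equiv> euler_E"

lemma E_dist: "qpoch 1 1 1 * E 1 = E 2" "qpoch 1 5 5 * E 5 = E 10"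
  using qpoch_plus_minus[of 1 1] qpoch_plus_minus[of 5 5] by (simp_all add: euler_E_eq)

theorem pentagonal: "theta (-1) 1 2 = E 1"
  using qpoch_split[of 1 3 "-1" 1]
  by (simp add: jacobi_triple_product euler_E_eq eval_nat_numeral mult_ac)

text \<open>The bilateral sum runs over the triangular numbers twice; on the product side this is the factor 1 + q^0.\<close>

theorem gauss_triangular: "theta 1 1 0 * E 1 = 2 * E 2 ^ 2"
proof -
  have "qpoch 1 0 1 = 2 * qpoch 1 1 1" using qpoch_step[of 1 1 0] by simp
  then have "theta 1 1 0 * E 1 = 2 * (qpoch 1 1 1 * E 1) ^ 2"
    by (simp add: jacobi_triple_product euler_E_eq power2_eq_square mult_ac)
  then show ?thesis by (simp only: E_dist)
qed

theorem gauss_square: "theta (-1) 1 1 * E 2 = E 1 ^ 2"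
proof -
  have "qpoch (-1) 1 2 * E 2 = E 1"
    using qpoch_split[of 1 2 "-1" 1] by (simp add: euler_E_eq eval_nat_numeral)
  moreover have "theta (-1) 1 1 * E 2 = (qpoch (-1) 1 2 * E 2) ^ 2"
    by (simp add: jacobi_triple_product euler_E_eq power2_eq_square mult_ac del: One_nat_def)
  ultimately show ?thesis by simp
qed

text \<open>The two series on the left are, up to dilation and a factor 2, the nontrivial components of the 5-dissection of the triangular theta
series. Their product runs over all exponents that are not divisible by 5.\<close>

theorem theta_mod_five_product: "theta 1 1 4 * theta 1 2 3 * E 1 * E 10 = E 2 * E 5 ^ 3"
proof -
  have split: "qpoch 1 1 1 = qpoch 1 1 5 * qpoch 1 2 5 * qpoch 1 3 5 * qpoch 1 4 5 * qpoch 1 5 5"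
    using qpoch_split[of 1 5 1 1] by (simp add: eval_nat_numeral)
  have "theta 1 1 4 * theta 1 2 3 * E 1 * E 10 
    = (qpoch 1 1 5 * qpoch 1 2 5 * qpoch 1 3 5 * qpoch 1 4 5 * qpoch 1 5 5) * E 1 * E 5 ^ 3"
    unfolding E_dist(2)[symmetric]
    by (simp add: jacobi_triple_product euler_E_eq[of 5] power3_eq_cube mult_ac)
  then show ?thesis unfolding split[symmetric] E_dist .
qed

section \<open>Sections modulo five of theta series\<close>

text \<open>The operator usually called U_m, applied after a shift by r.\<close>

definition sect :: "nat \<Rightarrow> nat \<Rightarrow> 'a fps \<Rightarrow> 'a fps" where
  "sect m r f = Abs_fps (\<lambda>n. f $ (m * n + r))"

lemma sect_nth [simp]: "sect m r f $ n = f $ (m * n + r)" by (simp add: sect_def)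

lemma texp_mod5:
  assumes "texp a b (5 * i + s) = 5 * n + r"
  shows "(int a * (s * (s + 1)) + int b * (s * (s - 1))) mod 5 = 2 * int r mod 5"
proof -
  have "2 * int (5 * n + r) = int a * ((5 * i + s) * (5 * i + s + 1)) + int b * ((5 * i + s) * (5 * i + s - 1))"
    using texp_double[of a b "5 * i + s"] unfolding assms .
  then have "int a * (s * (s + 1)) + int b * (s * (s - 1)) = 
     2 * int r + 5 * (2 * int n - int a * (5 * i * i + 2 * i * s + i) - int b * (5 * i * i + 2 * i * s - i))"
    by (simp add: algebra_simps)
  then show ?thesis by (simp only: mod_mult_self2)
qed

text \<open>The index j is written as 5 i + s. Modulo 5 the exponent depends only on s, so most residues s drop out.\<close>

lemma sect_theta:
  assumes "a + b > 0"
  shows "sect 5 r (theta c a b) $ n = 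
    (\<Sum>s\<in>{0,1,2,3,4}. if (int a * (s * (s + 1)) + int b * (s * (s - 1))) mod 5 = 2 * int r mod 5
      then \<Sum>i | texp a b (5 * i + s) = 5 * n + r. c ^ nat \<bar>5 * i + s\<bar> else 0)"
proof -
  let ?A = "{j. texp a b j = 5 * n + r}"
  have "sect 5 r (theta c a b) $ n = (\<Sum>j\<in>?A. c ^ nat \<bar>j\<bar>)" by (simp add: theta_def)
  also have "\<dots> = (\<Sum>s\<in>{0,1,2,3,4}. \<Sum>j | j \<in> ?A \<and> j mod 5 = s. c ^ nat \<bar>j\<bar>)"
  proof (rule sum.group[symmetric])
    show "(\<lambda>j. j mod 5) ` ?A \<subseteq> {0, 1, 2, 3, 4 :: int}"
    proof
      fix s :: int assume "s \<in> (\<lambda>j. j mod 5) ` ?A"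
      then have "0 \<le> s" "s < 5" by auto
      then show "s \<in> {0, 1, 2, 3, 4 :: int}" by auto
    qed
  qed (use texp_finite[OF assms] in auto)
  also have "\<dots> = (\<Sum>s\<in>{0,1,2,3,4}. \<Sum>i | texp a b (5 * i + s) = 5 * n + r. c ^ nat \<bar>5 * i + s\<bar>)"
  proof (rule sum.cong[OF refl])
    fix s :: int assume s: "s \<in> {0,1,2,3,4}"
    show "(\<Sum>j | j \<in> ?A \<and> j mod 5 = s. c ^ nat \<bar>j\<bar>) = (\<Sum>i | texp a b (5 * i + s) = 5 * n + r. c ^ nat \<bar>5 * i + s\<bar>)"
    proof (rule sum.reindex_bij_witness[of _ "\<lambda>i. 5 * i + s" "\<lambda>j. j div 5"])
      fix j assume "j \<in> {j \<in> ?A. j mod 5 = s}"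
      then show 1: "5 * (j div 5) + s = j" using mult_div_mod_eq[of 5 j] by simp
      then show "j div 5 \<in> {i. texp a b (5 * i + s) = 5 * n + r}" using \<open>j \<in> _\<close> by simp
      show "c ^ nat \<bar>5 * (j div 5) + s\<bar> = c ^ nat \<bar>j\<bar>" unfolding 1 ..
    next
      fix i assume "i \<in> {i. texp a b (5 * i + s) = 5 * n + r}"
      then show "5 * i + s \<in> {j \<in> ?A. j mod 5 = s}" "(5 * i + s) div 5 = i" using s by auto
    qed
  qed
  also have "\<dots> = (\<Sum>s\<in>{0,1,2,3,4}. if (int a * (s * (s + 1)) + int b * (s * (s - 1))) mod 5 = 2 * int r mod 5
      then \<Sum>i | texp a b (5 * i + s) = 5 * n + r. c ^ nat \<bar>5 * i + s\<bar> else 0)"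
  proof (rule sum.cong[OF refl])
    fix s :: int
    have "{i. texp a b (5 * i + s) = 5 * n + r} = {}" 
      if "(int a * (s * (s + 1)) + int b * (s * (s - 1))) mod 5 \<noteq> 2 * int r mod 5"
      using texp_mod5[of a b _ s n r] that by blast
    then show "(\<Sum>i | texp a b (5 * i + s) = 5 * n + r. c ^ nat \<bar>5 * i + s\<bar>) = 
       (if (int a * (s * (s + 1)) + int b * (s * (s - 1))) mod 5 = 2 * int r mod 5
      then \<Sum>i | texp a b (5 * i + s) = 5 * n + r. c ^ nat \<bar>5 * i + s\<bar> else 0)" by simp
  qed
  finally show ?thesis .
qed

lemma sum_uminus_int: "(\<Sum>i | P (- i). f (- i)) = (\<Sum>i :: int | P i. f i)"
  by (rule sum.reindex_bij_witness[of _ uminus uminus]) auto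

lemma minus_one_power_nat_abs: "(-1 :: complex) ^ nat \<bar>j\<bar> = (if even j then 1 else -1)"
proof -
  have "even (nat \<bar>j\<bar>) = even j" by (simp add: even_nat_iff)
  then show ?thesis by simp
qed

lemma theta_nth: "theta c a b $ n = (\<Sum>i | texp a b i = n. c ^ nat \<bar>i\<bar>)" by (simp add: theta_def)

text \<open>Expanding the quadratic exponents shows which theta series the surviving residue classes form. A negative sign of i and
a shift by 1 align the linear terms; both are absorbed by reindexing.\<close>

lemma exponents:
  "texp 1 2 (5 * i + 1) = 5 * n + 1 \<longleftrightarrow> 5 * texp 1 2 (- i) = n" (is ?E)
  "texp 1 0 (5 * i) = 5 * n \<longleftrightarrow> texp 2 3 (- i) = n" (is ?A)
  "texp 1 0 (5 * i + 4) = 5 * n \<longleftrightarrow> texp 2 3 (i + 1) = n" (is ?A')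
  "texp 1 0 (5 * i + 1) = 5 * n + 1 \<longleftrightarrow> texp 1 4 (- i) = n" (is ?B)
  "texp 1 0 (5 * i + 3) = 5 * n + 1 \<longleftrightarrow> texp 1 4 (i + 1) = n" (is ?B')
  "texp 1 0 (5 * i + 2) = 5 * n + 3 \<longleftrightarrow> 5 * texp 1 0 i = n" (is ?C)
  "texp 1 1 (5 * i) = 5 * n \<longleftrightarrow> 5 * texp 1 1 i = n" (is ?P)
proof -
  have int_eq: "5 * k = n \<longleftrightarrow> 10 * int k = 2 * int n" for k by linarith
  show ?E unfolding int_eq using texp_double[of 1 2 "- i"]
    unfolding texp_eq_iff by (intro iffI; simp add: algebra_simps)
  show ?C unfolding int_eq using texp_double[of 1 0 i]
    unfolding texp_eq_iff by (intro iffI; simp add: algebra_simps)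
  show ?P unfolding int_eq using texp_double[of 1 1 i]
    unfolding texp_eq_iff by (intro iffI; simp add: algebra_simps)
  show ?A ?A' ?B ?B' unfolding texp_eq_iff by (rule iffI; simp add: algebra_simps)+
qed

lemma sum_shift_int: "(\<Sum>i | P (i + 1). f (i + 1)) = (\<Sum>i :: int | P i. f i)"
  by (rule sum.reindex_bij_witness[of _ "\<lambda>i. i - 1" "\<lambda>i. i + 1"]) auto

lemma dilate_theta_nth:
  "dilate 5 (theta c a b) $ n = (\<Sum>i | 5 * texp a b i = n. c ^ nat \<bar>i\<bar>)"
proof (cases "5 dvd n")
  case True
  then have "5 * k = n \<longleftrightarrow> k = n div 5" for k by auto
  with True show ?thesis by (simp add: dilate_nth theta_nth)
next
  case False
  then have "{i. 5 * texp a b i = n} = {}" by auto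
  with False show ?thesis by (simp add: dilate_nth)
qed

text \<open>Twice a pentagonal number is 3 j^2 - j, which avoids two residue classes modulo 5 and hits the class of 1 only for
j = 1 modulo 5, where the pentagonal numbers reproduce themselves.\<close>

lemma sect_E1:
  "sect 5 1 (E 1) = - dilate 5 (E 1)" "sect 5 3 (E 1) = 0" "sect 5 4 (E 1) = 0"
proof -
  show "sect 5 1 (E 1) = - dilate 5 (E 1)"
  proof (rule fps_ext)
    fix n
    have "sect 5 1 (theta (-1) 1 2) $ n = (\<Sum>i | texp 1 2 (5 * i + 1) = 5 * n + 1. (- 1) ^ nat \<bar>5 * i + 1\<bar>)"
      by (subst sect_theta) simp_all
    also have "\<dots> = (\<Sum>i | 5 * texp 1 2 (- i) = n. - ((- 1) ^ nat \<bar>- i\<bar>))"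
      unfolding exponents minus_one_power_nat_abs by (intro sum.cong) auto
    also have "\<dots> = - dilate 5 (theta (-1) 1 2) $ n"
      unfolding dilate_theta_nth fps_neg_nth sum_negf 
        sum_uminus_int[of "\<lambda>i. (- 1 :: complex) ^ nat \<bar>i\<bar>" "\<lambda>i. 5 * texp 1 2 i = n"] ..
    finally show "sect 5 1 (E 1) $ n = (- dilate 5 (E 1)) $ n" unfolding pentagonal by simp
  qed
  show "sect 5 3 (E 1) = 0" "sect 5 4 (E 1) = 0"
    unfolding pentagonal[symmetric] by (rule fps_ext, subst sect_theta, simp_all)+
qed

text \<open>Here each of the classes 0 and 1 comes from two residues of j that are exchanged by the symmetry of j (j + 1) / 2.\<close>

lemma sect_triangular:
  "sect 5 0 (theta 1 1 0) = 2 * theta 1 2 3" "sect 5 1 (theta 1 1 0) = 2 * theta 1 1 4"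
  "sect 5 2 (theta 1 1 0) = 0" "sect 5 3 (theta 1 1 0) = dilate 5 (theta 1 1 0)" "sect 5 4 (theta 1 1 0) = 0"
proof -
  show "sect 5 0 (theta 1 1 0) = 2 * theta 1 2 3"
  proof (rule fps_ext)
    fix n
    have "sect 5 0 (theta 1 1 0) $ n = of_nat (card {i. texp 1 0 (5 * i) = 5 * n}) + of_nat (card {i. texp 1 0 (5 * i + 4) = 5 * n})"
      by (subst sect_theta) simp_all
    also have "\<dots> = of_nat (card {i. texp 2 3 i = n}) + of_nat (card {i. texp 2 3 i = n})"
      using sum_uminus_int[of "\<lambda>_. 1 :: complex" "\<lambda>i. texp 2 3 i = n"] sum_shift_int[of "\<lambda>_. 1 :: complex" "\<lambda>i. texp 2 3 i = n"]
      unfolding exponents by simp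
    finally show "sect 5 0 (theta 1 1 0) $ n = (2 * theta 1 2 3) $ n" by (simp add: theta_nth numeral_fps_const)
  qed
  show "sect 5 1 (theta 1 1 0) = 2 * theta 1 1 4"
  proof (rule fps_ext)
    fix n
    have "sect 5 1 (theta 1 1 0) $ n = of_nat (card {i. texp 1 0 (5 * i + 1) = 5 * n + 1}) + of_nat (card {i. texp 1 0 (5 * i + 3) = 5 * n + 1})"
      by (subst sect_theta) simp_all
    also have "\<dots> = of_nat (card {i. texp 1 4 i = n}) + of_nat (card {i. texp 1 4 i = n})"
      using sum_uminus_int[of "\<lambda>_. 1 :: complex" "\<lambda>i. texp 1 4 i = n"] sum_shift_int[of "\<lambda>_. 1 :: complex" "\<lambda>i. texp 1 4 i = n"]
      unfolding exponents by simp
    finally show "sect 5 1 (theta 1 1 0) $ n = (2 * theta 1 1 4) $ n" by (simp add: theta_nth numeral_fps_const)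
  qed
  show "sect 5 3 (theta 1 1 0) = dilate 5 (theta 1 1 0)"
  proof (rule fps_ext)
    fix n
    have "sect 5 3 (theta 1 1 0) $ n = of_nat (card {i. texp 1 0 (5 * i + 2) = 5 * n + 3})"
      by (subst sect_theta) simp_all
    then show "sect 5 3 (theta 1 1 0) $ n = dilate 5 (theta 1 1 0) $ n" unfolding exponents dilate_theta_nth by simp
  qed
  show "sect 5 2 (theta 1 1 0) = 0" "sect 5 4 (theta 1 1 0) = 0"
    by (rule fps_ext, subst sect_theta, simp_all)+
qed

lemma sect_square:
  "sect 5 0 (theta (-1) 1 1) = dilate 5 (theta (-1) 1 1)"
  "sect 5 2 (theta (-1) 1 1) = 0" "sect 5 3 (theta (-1) 1 1) = 0"
proof -
  show "sect 5 0 (theta (-1) 1 1) = dilate 5 (theta (-1) 1 1)"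
  proof (rule fps_ext)
    fix n
    have "sect 5 0 (theta (-1) 1 1) $ n = (\<Sum>i | texp 1 1 (5 * i) = 5 * n. (- 1) ^ nat \<bar>5 * i\<bar>)"
      by (subst sect_theta) simp_all
    also have "\<dots> = (\<Sum>i | 5 * texp 1 1 i = n. (- 1) ^ nat \<bar>i\<bar>)"
      unfolding exponents minus_one_power_nat_abs by (intro sum.cong) auto
    finally show "sect 5 0 (theta (-1) 1 1) $ n = dilate 5 (theta (-1) 1 1) $ n" unfolding dilate_theta_nth .
  qed
  show "sect 5 2 (theta (-1) 1 1) = 0" "sect 5 3 (theta (-1) 1 1) = 0"
    by (rule fps_ext, subst sect_theta, simp_all)+
qed

section \<open>Five-dissections and the norm over fifth roots of unity\<close>

lemma fps_X_power_dilate_nth: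
  assumes "r < 5" "s < 5"
  shows "(fps_X ^ s * dilate 5 g) $ (5 * n + r) = (if s = r then g $ n else 0)"
proof (cases "5 * n + r < s")
  case True
  then show ?thesis using assms by (auto simp: fps_X_power_mult_nth)
next
  case False
  have "5 dvd (5 * n + r - s) \<longleftrightarrow> s = r"
  proof
    assume "5 dvd (5 * n + r - s)"
    with False assms show "s = r" by presburger
  qed simp
  with False show ?thesis by (auto simp: fps_X_power_mult_nth dilate_nth)
qed

lemma sect_dissection:
  defines "f \<equiv> \<lambda>f0 f1 f2 f3 f4. dilate 5 f0 + fps_X * dilate 5 f1 + fps_X ^ 2 * dilate 5 f2
     + fps_X ^ 3 * dilate 5 f3 + fps_X ^ 4 * dilate 5 f4"
  shows "sect 5 0 (f f0 f1 f2 f3 f4) = f0" "sect 5 1 (f f0 f1 f2 f3 f4) = f1"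
    "sect 5 2 (f f0 f1 f2 f3 f4) = f2" "sect 5 3 (f f0 f1 f2 f3 f4) = f3" "sect 5 4 (f f0 f1 f2 f3 f4) = f4"
proof -
  have f: "f f0 f1 f2 f3 f4 = (\<Sum>s<5. fps_X ^ s * dilate 5 ([f0, f1, f2, f3, f4] ! s))"
    by (simp add: f_def eval_nat_numeral)
  have "sect 5 r (f f0 f1 f2 f3 f4) = [f0, f1, f2, f3, f4] ! r" if "r < 5" for r
  proof (rule fps_ext)
    fix n
    have "sect 5 r (f f0 f1 f2 f3 f4) $ n = (\<Sum>s<5. if s = r then ([f0, f1, f2, f3, f4] ! s) $ n else 0)"
      unfolding f sect_nth fps_sum_nth using that by (intro sum.cong refl fps_X_power_dilate_nth) auto
    then show "sect 5 r (f f0 f1 f2 f3 f4) $ n = ([f0, f1, f2, f3, f4] ! r) $ n" using that by simp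
  qed
  from this[of 0] this[of 1] this[of 2] this[of 3] this[of 4]
  show "sect 5 0 (f f0 f1 f2 f3 f4) = f0" "sect 5 1 (f f0 f1 f2 f3 f4) = f1"
    "sect 5 2 (f f0 f1 f2 f3 f4) = f2" "sect 5 3 (f f0 f1 f2 f3 f4) = f3" "sect 5 4 (f f0 f1 f2 f3 f4) = f4"
    by simp_all
qed

lemma dissection:
  "f = dilate 5 (sect 5 0 f) + fps_X * dilate 5 (sect 5 1 f) + fps_X ^ 2 * dilate 5 (sect 5 2 f)
     + fps_X ^ 3 * dilate 5 (sect 5 3 f) + fps_X ^ 4 * dilate 5 (sect 5 4 f)" (is "f = ?g")
proof (rule fps_ext)
  fix n :: nat
  define m r where "m = n div 5" and "r = n mod 5"
  have "r \<in> {0, 1, 2, 3, 4}" unfolding r_def by auto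
  then have "sect 5 r f = sect 5 r ?g" by (elim insertE) (simp_all add: sect_dissection del: One_nat_def)
  then have "sect 5 r f $ m = sect 5 r ?g $ m" by simp
  then show "f $ n = ?g $ n" by (simp add: m_def r_def)
qed

text \<open>A series in q^m is a scalar for the section operator.\<close>

lemma sect_dilate_mult: "m > 0 \<Longrightarrow> r < m \<Longrightarrow> sect m r (dilate m g * h) = g * sect m r h"
proof (rule fps_ext)
  fix n assume m: "m > 0" and r: "r < m"
  have "(dilate m g * h) $ (m * n + r) = (\<Sum>i | i \<le> m * n + r \<and> m dvd i. g $ (i div m) * h $ (m * n + r - i))"
    unfolding fps_mult_nth by (rule sum.mono_neutral_cong_right) (auto simp: dilate_nth m)
  also have "\<dots> = (\<Sum>i=0..n. g $ i * h $ (m * (n - i) + r))"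
  proof (rule sum.reindex_bij_witness[of _ "\<lambda>i. m * i" "\<lambda>i. i div m"])
    fix i assume "i \<in> {i. i \<le> m * n + r \<and> m dvd i}"
    then obtain j where j: "i = m * j" "m * j \<le> m * n + r" by auto
    have "j \<le> n"
    proof (rule ccontr)
      assume "\<not> j \<le> n"
      then have "m * (n + 1) \<le> m * j" by (intro mult_le_mono2) simp
      with j r show False by simp
    qed
    with j m show "m * (i div m) = i" "i div m \<in> {0..n}" 
      "g $ (i div m) * h $ (m * (n - i div m) + r) = g $ (i div m) * h $ (m * n + r - i)"
      by (auto simp: diff_mult_distrib2)
  next
    fix i assume i: "i \<in> {0..n}"
    then have "m * i \<le> m * n + r" by (simp add: trans_le_add1)
    then show "m * i div m = i" "m * i \<in> {i. i \<le> m * n + r \<and> m dvd i}" using m by auto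
  qed
  finally show "sect m r (dilate m g * h) $ n = (g * sect m r h) $ n"
    by (simp add: fps_mult_nth)
qed

text \<open>The substitution of c q for q.\<close>

definition twist :: "complex \<Rightarrow> complex fps \<Rightarrow> complex fps" where
  "twist c f = Abs_fps (\<lambda>n. c ^ n * f $ n)"

lemma twist_nth: "twist c f $ n = c ^ n * f $ n" by (simp add: twist_def)
lemma twist_mult: "twist c (f * g) = twist c f * twist c g"
proof (rule fps_ext)
  fix n
  have "twist c (f * g) $ n = (\<Sum>i=0..n. c ^ (i + (n - i)) * (f $ i * g $ (n - i)))"
    by (simp add: twist_nth fps_mult_nth sum_distrib_left)
  then show "twist c (f * g) $ n = (twist c f * twist c g) $ n"
    unfolding power_add by (simp add: twist_nth fps_mult_nth mult_ac)
qed
lemma twist_1: "twist c 1 = 1" by (rule fps_ext) (simp add: twist_nth)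
lemma twist_diff: "twist c (f - g) = twist c f - twist c g" by (rule fps_ext) (simp add: twist_nth algebra_simps)
lemma twist_X_power: "twist c (fps_X ^ k) = fps_const (c ^ k) * fps_X ^ k" 
  by (rule fps_ext) (simp add: twist_nth fps_X_power_nth)
lemma twist_tendsto: "f \<longlonglongrightarrow> g \<Longrightarrow> (\<lambda>n. twist c (f n)) \<longlonglongrightarrow> twist c g"
  by (auto simp: tendsto_fps_iff twist_nth elim: eventually_mono)
lemma twist_dilate: "c ^ 5 = 1 \<Longrightarrow> twist c (dilate 5 f) = dilate 5 f"
  by (rule fps_ext) (auto simp: twist_nth dilate_nth power_mult elim!: dvdE)

lemma fifth_root:
  obtains w :: complex where "1 + w + w ^ 2 + w ^ 3 + w ^ 4 = 0" "w ^ 5 = 1"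
proof -
  define w :: complex where "w = cis (2 * pi / 5)"
  have "w ^ 5 = cis (real 5 * (2 * pi / 5))" unfolding w_def by (rule Complex.DeMoivre)
  also have "real 5 * (2 * pi / 5) = 2 * pi" by simp
  finally have w5: "w ^ 5 = 1" by simp
  have "Im w > 0" unfolding w_def by (auto intro!: sin_gt_zero)
  then have "w \<noteq> 1" by auto
  moreover have "(w - 1) * (1 + w + w ^ 2 + w ^ 3 + w ^ 4) = w ^ 5 - 1" by algebra
  ultimately show ?thesis using w5 that[of w] by simp
qed

text \<open>The conjugate factors are paired as (w, w^4) and (w^2, w^3). Each pair only involves the Gaussian periods
w + w^4 and w^2 + w^3, whose sum and product are both -1.\<close>

lemma norm_trinomial:
  fixes a b c w :: "'a::idom"
  assumes "1 + w + w ^ 2 + w ^ 3 + w ^ 4 = 0" 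
  shows "(a - b - c) * (a - w * b - w ^ 2 * c) * (a - w ^ 2 * b - w ^ 4 * c) * (a - w ^ 3 * b - w * c) * (a - w ^ 4 * b - w ^ 3 * c)
    = a ^ 5 - b ^ 5 - c ^ 5 - 5 * a * b ^ 3 * c - 5 * a ^ 2 * b * c ^ 2"
proof -
  define S l1 l2 where "S = a ^ 2 + b ^ 2 + c ^ 2" and "l1 = b * c - a * b" and "l2 = - (a * c)"
  define \<sigma> \<tau> where "\<sigma> = w + w ^ 4" and "\<tau> = w ^ 2 + w ^ 3"
  have "w ^ 5 - 1 = (w - 1) * (1 + w + w ^ 2 + w ^ 3 + w ^ 4)"
    by (simp add: algebra_simps eval_nat_numeral)
  then have w5: "w ^ 5 = 1" using assms by simp
  have "\<sigma> + \<tau> = (1 + w + w ^ 2 + w ^ 3 + w ^ 4) - 1" unfolding \<sigma>_def \<tau>_def by (simp add: algebra_simps)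
  then have sum: "\<sigma> + \<tau> = -1" using assms by simp
  have "\<sigma> * \<tau> = w ^ 3 + w ^ 4 + w ^ 5 * (w + w ^ 2)" unfolding \<sigma>_def \<tau>_def by (simp add: algebra_simps eval_nat_numeral)
  also have "\<dots> = \<sigma> + \<tau>" unfolding w5 \<sigma>_def \<tau>_def by (simp add: algebra_simps)
  finally have prod: "\<sigma> * \<tau> = -1" using sum by simp
  have 1: "(a - w * b - w ^ 2 * c) * (a - w ^ 4 * b - w ^ 3 * c) = S + \<sigma> * l1 + \<tau> * l2"
    using w5 unfolding \<sigma>_def \<tau>_def S_def l1_def l2_def by algebra
  have 2: "(a - w ^ 2 * b - w ^ 4 * c) * (a - w ^ 3 * b - w * c) = S + \<tau> * l1 + \<sigma> * l2"
    using w5 unfolding \<sigma>_def \<tau>_def S_def l1_def l2_def by algebra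
  have 3: "(S + \<sigma> * l1 + \<tau> * l2) * (S + \<tau> * l1 + \<sigma> * l2) = S ^ 2 - S * (l1 + l2) - l1 ^ 2 - l2 ^ 2 + 3 * l1 * l2"
    using sum prod by algebra
  have "(a - b - c) * (a - w * b - w ^ 2 * c) * (a - w ^ 2 * b - w ^ 4 * c) * (a - w ^ 3 * b - w * c) * (a - w ^ 4 * b - w ^ 3 * c)
    = (a - b - c) * (((a - w * b - w ^ 2 * c) * (a - w ^ 4 * b - w ^ 3 * c)) * ((a - w ^ 2 * b - w ^ 4 * c) * (a - w ^ 3 * b - w * c)))"
    by (simp only: mult_ac)
  also have "\<dots> = (a - b - c) * (S ^ 2 - S * (l1 + l2) - l1 ^ 2 - l2 ^ 2 + 3 * l1 * l2)" unfolding 1 2 3 ..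
  also have "\<dots> = a ^ 5 - b ^ 5 - c ^ 5 - 5 * a * b ^ 3 * c - 5 * a ^ 2 * b * c ^ 2"
    unfolding S_def l1_def l2_def by algebra
  finally show ?thesis .
qed

definition norm5 :: "complex \<Rightarrow> complex fps \<Rightarrow> complex fps" where
  "norm5 w f = f * twist w f * twist (w ^ 2) f * twist (w ^ 3) f * twist (w ^ 4) f"

lemma norm5_mult: "norm5 w (f * g) = norm5 w f * norm5 w g"
  by (simp add: norm5_def twist_mult mult_ac)

lemma norm5_tendsto: "f \<longlonglongrightarrow> g \<Longrightarrow> (\<lambda>n. norm5 w (f n)) \<longlonglongrightarrow> norm5 w g"
  unfolding norm5_def by (intro fps_tendsto_mult twist_tendsto)

text \<open>For j prime to 5 the powers of w^j are again all the fifth roots of unity.\<close>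

lemma norm5_binomial:
  assumes w: "1 + w + w ^ 2 + w ^ 3 + w ^ 4 = 0" "w ^ 5 = 1"
  shows "norm5 w (1 - fps_X ^ j) = (if 5 dvd j then (1 - fps_X ^ j) ^ 5 else 1 - fps_X ^ (5 * j))"
proof -
  define v where "v = fps_const (w ^ j)"
  have pow: "fps_const ((w ^ i) ^ j) = v ^ i" for i
    by (simp add: v_def fps_const_power power_mult[symmetric] mult.commute)
  have eq: "norm5 w (1 - fps_X ^ j) = (1 - fps_X ^ j) * (1 - v * fps_X ^ j) * (1 - v ^ 2 * fps_X ^ j)
     * (1 - v ^ 3 * fps_X ^ j) * (1 - v ^ 4 * fps_X ^ j)"
    unfolding norm5_def twist_diff twist_1 twist_X_power pow by (simp add: v_def)
  show ?thesis
  proof (cases "5 dvd j")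
    case True
    then obtain i where "j = 5 * i" by auto
    then have "v = 1" unfolding v_def by (simp add: power_mult w)
    with True show ?thesis unfolding eq by (simp add: eval_nat_numeral)
  next
    case False
    define g where "g = (\<lambda>x :: complex. 1 + x + x ^ 2 + x ^ 3 + x ^ 4)"
    have red: "w ^ j = w ^ (j mod 5)"
      by (metis mod_mult_div_eq mult.right_neutral power_add power_mult power_one w(2))
    have "j mod 5 \<noteq> 0" using False by presburger
    then have "j mod 5 = 1 \<or> j mod 5 = 2 \<or> j mod 5 = 3 \<or> j mod 5 = 4" by presburger
    moreover have "g (w ^ 1) = 0" "g (w ^ 2) = 0" "g (w ^ 3) = 0" "g (w ^ 4) = 0"
      unfolding g_def using w by (simp, algebra+)
    ultimately have "g (w ^ j) = 0" unfolding red by auto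
    then have "fps_const (g (w ^ j)) = 0" by simp
    then have "1 + v + v ^ 2 + v ^ 3 + v ^ 4 = 0"
      unfolding g_def v_def by (simp add: fps_const_power flip: fps_const_add)
    from norm_trinomial[OF this, of 1 "fps_X ^ j" 0]
    have "norm5 w (1 - fps_X ^ j) = 1 - (fps_X ^ j) ^ 5" unfolding eq by simp
    with False show ?thesis by (simp add: power_mult[symmetric] mult.commute)
  qed
qed

text \<open>The factors 1 - q^j with j prime to 5 contribute E_5 / E_25, the others contribute E_5^5.\<close>

theorem norm5_E1:
  assumes w: "1 + w + w ^ 2 + w ^ 3 + w ^ 4 = 0" "w ^ 5 = 1"
  shows "norm5 w (E 1) * E 25 = E 5 ^ 6"
proof -
  let ?P = "\<lambda>j N. \<Prod>k<N. 1 - fps_X ^ (j * k + j) :: complex fps"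
  have sub: "(\<lambda>N. ?P j (5 * N)) \<longlonglongrightarrow> E j" if "j > 0" for j
    using euler_E_tendsto[OF that]
    by (rule filterlim_compose) (auto intro!: filterlim_subseq strict_monoI)
  have eq: "norm5 w (?P 1 (5 * N)) * ?P 25 N = ?P 5 (5 * N) * ?P 5 N ^ 5" for N
  proof (induction N)
    case 0
    then show ?case by (simp add: norm5_def twist_1)
  next
    case (Suc N)
    let ?f = "\<lambda>k. 1 - fps_X ^ (5 * N + k) :: complex fps"
    have *: "?P j (5 * Suc N) = ?P j (5 * N) * ((1 - fps_X ^ (j * (5 * N + 1))) * (1 - fps_X ^ (j * (5 * N + 2))) *
       (1 - fps_X ^ (j * (5 * N + 3))) * (1 - fps_X ^ (j * (5 * N + 4))) * (1 - fps_X ^ (j * (5 * N + 5))))" for j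
      by (simp add: eval_nat_numeral algebra_simps)
    have P1: "?P 1 (5 * Suc N) = ?P 1 (5 * N) * (?f 1 * ?f 2 * ?f 3 * ?f 4 * ?f 5)"
      using *[of 1] unfolding mult_1 .
    have n: "norm5 w (?f 1) = 1 - fps_X ^ (5 * (5 * N + 1))" "norm5 w (?f 2) = 1 - fps_X ^ (5 * (5 * N + 2))"
      "norm5 w (?f 3) = 1 - fps_X ^ (5 * (5 * N + 3))" "norm5 w (?f 4) = 1 - fps_X ^ (5 * (5 * N + 4))"
      "norm5 w (?f 5) = (1 - fps_X ^ (5 * N + 5)) ^ 5"
      by (subst norm5_binomial[OF w], subst if_not_P, presburger, rule refl)+
        (subst norm5_binomial[OF w], subst if_P, presburger, rule refl)
    have "norm5 w (?P 1 (5 * Suc N)) * ?P 25 (Suc N) = 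
      (norm5 w (?P 1 (5 * N)) * ?P 25 N) * (norm5 w (?f 1) * norm5 w (?f 2) * norm5 w (?f 3) * norm5 w (?f 4)
        * norm5 w (?f 5) * (1 - fps_X ^ (25 * N + 25)))"
      unfolding P1 norm5_mult prod.lessThan_Suc by (simp only: mult_ac)
    also have "\<dots> = ?P 5 (5 * Suc N) * ?P 5 (Suc N) ^ 5"
    proof -
      have "5 * (5 * N + 5) = 25 * N + 25" by simp
      then show ?thesis unfolding Suc.IH n * prod.lessThan_Suc power_mult_distrib by (simp only: mult_ac)
    qed
    finally show ?case .
  qed
  have "(\<lambda>N. norm5 w (?P 1 (5 * N)) * ?P 25 N) \<longlonglongrightarrow> norm5 w (E 1) * E 25"
    by (intro fps_tendsto_mult norm5_tendsto sub euler_E_tendsto) simp_all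
  moreover have "(\<lambda>N. ?P 5 (5 * N) * (\<Prod>i<(5::nat). ?P 5 N)) \<longlonglongrightarrow> E 5 * (\<Prod>i<(5::nat). E 5)"
    by (intro fps_tendsto_mult fps_tendsto_prod sub euler_E_tendsto) simp_all
  then have "(\<lambda>N. norm5 w (?P 1 (5 * N)) * ?P 25 N) \<longlonglongrightarrow> E 5 * (\<Prod>i<(5::nat). E 5)"
    unfolding eq by simp
  ultimately have "norm5 w (E 1) * E 25 = E 5 * (\<Prod>i<(5::nat). E 5)"
    by (rule LIMSEQ_unique)
  then show ?thesis by (simp add: eval_nat_numeral)
qed

section \<open>Rogers' parametrisation of level ten\<close>

abbreviation D :: "complex fps \<Rightarrow> complex fps" where "D \<equiv> dilate 5"
abbreviation X :: "complex fps" where "X \<equiv> fps_X"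

lemma E_unit: "j > 0 \<Longrightarrow> E j \<noteq> 0" using euler_E_nth_0[of j] by force
lemma E_unit_nth: "j > 0 \<Longrightarrow> E j $ 0 \<noteq> 0" using euler_E_nth_0[of j] by simp

text \<open>In terms of the Rogers--Ramanujan continued fraction R, u is 1 / R and v is R, stripped of their fractional powers
of q. That they are inverse to each other is proved below from the identity E_2^2 = psi E_1.\<close>

definition u_ser :: "complex fps" where "u_ser = sect 5 0 (E 1) * inverse (E 5)"
definition v_ser :: "complex fps" where "v_ser = - sect 5 2 (E 1) * inverse (E 5)"

lemma inverse_E: "j > 0 \<Longrightarrow> E j * inverse (E j) = 1"
  by (rule inverse_mult_eq_1'[OF E_unit_nth])

theorem E1_dissection: "E 1 = E 25 * (D u_ser - X - X ^ 2 * D v_ser)"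
proof -
  have "sect 5 0 (E 1) = E 5 * u_ser" "sect 5 2 (E 1) = - (E 5 * v_ser)"
    using inverse_E[of 5] by (simp_all add: u_ser_def v_ser_def mult.commute mult.left_commute)
  then show ?thesis
    using dissection[of "E 1"] unfolding sect_E1
    by (simp add: dilate_simps dilate_euler_E algebra_simps)
qed

definition psi :: "complex fps" where "psi = E 2 ^ 2 * inverse (E 1)"

lemma psi_E1: "psi * E 1 = E 2 ^ 2"
  unfolding psi_def by (simp add: mult.assoc inverse_mult_eq_1[OF E_unit_nth])

lemma theta_psi: "theta 1 1 0 = 2 * psi"
proof -
  have "theta 1 1 0 * E 1 = (2 * psi) * E 1" unfolding gauss_triangular by (simp only: mult.assoc psi_E1)
  then show ?thesis using E_unit[of 1] by simp
qed

definition psi5 :: "complex fps" where "psi5 = D psi"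

lemma psi5_E5: "psi5 * E 5 = E 10 ^ 2"
  using arg_cong[OF psi_E1, of D] unfolding psi5_def by (simp add: dilate_simps dilate_euler_E)

lemma psi_nth_0: "psi $ 0 = 1" by (simp add: psi_def euler_E_nth_0 power2_eq_square)
lemma psi5_nth_0: "psi5 $ 0 = 1" by (simp add: psi5_def psi_nth_0)
lemma psi5_inverse: "psi5 * inverse psi5 = 1" by (rule inverse_mult_eq_1') (simp add: psi5_nth_0)

text \<open>The two nontrivial components of the 5-dissection of psi, normalised by the third one.\<close>

definition a_ser :: "complex fps" where "a_ser = theta 1 2 3 * inverse psi5"
definition b_ser :: "complex fps" where "b_ser = theta 1 1 4 * inverse psi5"

theorem psi_dissection: "psi = D psi5 * (D a_ser + X * D b_ser + X ^ 3)"
proof -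
  have a: "psi5 * a_ser = theta 1 2 3" "psi5 * b_ser = theta 1 1 4"
    using psi5_inverse by (simp_all add: a_ser_def b_ser_def mult.left_commute)
  have "2 * psi = 2 * (D psi5 * (D a_ser + X * D b_ser + X ^ 3))"
    using dissection[of "theta 1 1 0", unfolded sect_triangular] unfolding a[symmetric] theta_psi
    by (simp add: dilate_simps psi5_def algebra_simps)
  then show ?thesis by simp
qed

definition U_ser :: "complex fps" where "U_ser = dilate 2 u_ser"
definition V_ser :: "complex fps" where "V_ser = dilate 2 v_ser"

theorem E2_dissection: "E 2 = E 50 * (D U_ser - X ^ 2 - X ^ 4 * D V_ser)"
  using arg_cong[OF E1_dissection, of "dilate 2"]
  by (simp add: dilate_simps dilate_euler_E U_ser_def V_ser_def dilate_dilate power_mult[symmetric])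

text \<open>Both sides of E_2^2 = psi E_1 are dissected and the components in the residue classes 4, 2, 1, 3 are compared.
The class 4 component says that U V = 1. Solving the others shows that a and b depend on u and U alone
and leaves one relation between u and U.\<close>

lemma dissection_relations:
  "U_ser * V_ser = 1"
  "a_ser + b_ser * u_ser = 2 * (U_ser * u_ser) "
  "b_ser * u_ser - a_ser = 2 * X * V_ser"
  "u_ser - b_ser * v_ser = X * V_ser ^ 2"
proof -
  let ?u = "D u_ser" and ?v = "D v_ser" and ?U = "D U_ser" and ?V = "D V_ser" and ?a = "D a_ser" and ?b = "D b_ser"
  \<comment> \<open>The common eta factor of both sides.\<close>
  have c: "D psi5 * E 25 = E 50 ^ 2"
    using arg_cong[OF psi5_E5, of D] by (simp add: dilate_simps dilate_euler_E)
  have "E 50 ^ 2 * (?U - X ^ 2 - X ^ 4 * ?V) ^ 2 = (D psi5 * (?a + X * ?b + X ^ 3)) * (E 25 * (?u - X - X ^ 2 * ?v))"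
    using psi_E1 unfolding E1_dissection[symmetric] psi_dissection[symmetric] power_mult_distrib[symmetric] E2_dissection[symmetric] by simp
  also have "\<dots> = E 50 ^ 2 * ((?a + X * ?b + X ^ 3) * (?u - X - X ^ 2 * ?v))"
    unfolding c[symmetric] by (simp only: mult_ac)
  finally have eq: "(?U - X ^ 2 - X ^ 4 * ?V) ^ 2 = (?a + X * ?b + X ^ 3) * (?u - X - X ^ 2 * ?v)"
    using E_unit[of 50] by simp
  have l: "(?U - X ^ 2 - X ^ 4 * ?V) ^ 2 = D (U_ser ^ 2) + X * D (2 * X * V_ser) + X ^ 2 * D (- 2 * U_ser)
      + X ^ 3 * D (X * V_ser ^ 2) + X ^ 4 * D (1 - 2 * U_ser * V_ser)"
    by (simp add: dilate_simps) algebra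
  have r: "(?a + X * ?b + X ^ 3) * (?u - X - X ^ 2 * ?v) = D (a_ser * u_ser - X * v_ser) + X * D (b_ser * u_ser - a_ser)
      + X ^ 2 * D (- b_ser - a_ser * v_ser) + X ^ 3 * D (u_ser - b_ser * v_ser) + X ^ 4 * D (- 1)"
    by (simp add: dilate_simps) algebra
  note s = arg_cong[OF eq[unfolded l r]]
  have "1 - 2 * U_ser * V_ser = -1" using s[of "sect 5 4"] unfolding sect_dissection .
  then have "2 * (U_ser * V_ser) = 2 * 1" by algebra
  then show UV: "U_ser * V_ser = 1" unfolding mult_cancel_left by simp
  then have "dilate 2 (u_ser * v_ser) = dilate 2 1" by (simp add: U_ser_def V_ser_def dilate_simps)
  then have uv: "u_ser * v_ser = 1" using dilate_inj[of 2] by simp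
  have "- 2 * U_ser = - b_ser - a_ser * v_ser" using s[of "sect 5 2"] unfolding sect_dissection .
  then show "a_ser + b_ser * u_ser = 2 * (U_ser * u_ser)" using uv by algebra
  show "b_ser * u_ser - a_ser = 2 * X * V_ser" using s[of "sect 5 1"] unfolding sect_dissection by simp
  show "u_ser - b_ser * v_ser = X * V_ser ^ 2" using s[of "sect 5 3"] unfolding sect_dissection by simp
qed

lemma UV: "U_ser * V_ser = 1" by (rule dissection_relations)
lemma uv: "u_ser * v_ser = 1"
proof -
  have "dilate 2 (u_ser * v_ser) = dilate 2 1" using UV by (simp add: U_ser_def V_ser_def dilate_simps)
  then show ?thesis using dilate_inj[of 2] by simp
qed

lemma a_ser_eq: "a_ser = u_ser * U_ser - X * V_ser"
proof -
  have "2 * a_ser = 2 * (u_ser * U_ser - X * V_ser)" using dissection_relations(2,3) by algebra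
  then show ?thesis unfolding mult_cancel_left by simp
qed

lemma b_ser_eq: "b_ser = U_ser + X * V_ser * v_ser"
proof -
  have "2 * b_ser = 2 * (U_ser + X * V_ser * v_ser)" using dissection_relations(2,3) uv by algebra
  then show ?thesis unfolding mult_cancel_left by simp
qed

text \<open>Ramanujan's parameter R(q) R(q^2)^2, that is, q / (u U^2).\<close>

definition k_ser :: "complex fps" where "k_ser = X * v_ser * V_ser ^ 2"

lemma X_eq_k: "X = k_ser * u_ser * U_ser ^ 2"
  unfolding k_ser_def using uv UV by algebra

text \<open>Rogers' relation between R(q) and R(q^2), solved for u^2 / U.\<close>

lemma rogers: "u_ser ^ 2 * (1 - k_ser) = U_ser * (1 + k_ser)"
  using dissection_relations(4) uv UV unfolding b_ser_eq k_ser_def by algebra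

text \<open>The norm of E_1 is known as a product, and the dissection of E_1 evaluates it as a polynomial in u and v, because
u is invariant under the twists once it is dilated by 5.\<close>

theorem E1_norm: "E 5 ^ 6 * (u_ser ^ 5 - 11 * X - X ^ 2 * v_ser ^ 5) = E 1 ^ 6"
proof -
  obtain w :: complex where w: "1 + w + w ^ 2 + w ^ 3 + w ^ 4 = 0" "w ^ 5 = 1" by (rule fifth_root)
  define W where "W = fps_const w"
  have W: "1 + W + W ^ 2 + W ^ 3 + W ^ 4 = 0"
    using arg_cong[OF w(1), of fps_const] by (simp add: W_def fps_const_power flip: fps_const_add)
  have W5: "W ^ 5 = 1" by (simp add: W_def fps_const_power w)
  let ?u = "D u_ser" and ?v = "D v_ser"
  have tw: "twist (w ^ i) (E 25 * (?u - X - X ^ 2 * ?v)) = E 25 * (?u - W ^ i * X - W ^ (2 * i) * (X ^ 2 * ?v))" for i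
  proof -
    have r: "(w ^ i) ^ 5 = 1" using w(2) by (metis mult.commute power_mult power_one)
    have "E 25 = D (E 5)" by (simp add: dilate_euler_E)
    then have "twist (w ^ i) (E 25) = E 25" by (simp add: twist_dilate r)
    moreover have "twist (w ^ i) (X ^ 2 * ?v) = W ^ (2 * i) * (X ^ 2 * ?v)"
      unfolding twist_mult twist_X_power twist_dilate[OF r] 
      by (simp add: W_def fps_const_power power_mult[symmetric] mult.commute mult.left_commute)
    moreover have "twist (w ^ i) X = W ^ i * X" using twist_X_power[of "w ^ i" 1] by (simp add: W_def fps_const_power)
    ultimately show ?thesis by (simp add: twist_mult twist_diff twist_dilate r)
  qed
  have uvD: "?u * ?v = 1" using arg_cong[OF uv, of D] by (simp add: dilate_simps)
  have pull: "(e * p) * (e * q) * (e * r) * (e * s) * (e * t) = e ^ 5 * (p * q * r * s * t)" for e p q r s t :: "complex fps"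
    by (simp add: eval_nat_numeral mult_ac)
  have W6: "W ^ 6 = W" "W ^ 8 = W ^ 3" using W5 by algebra+
  have t: "twist w (E 1) = E 25 * (?u - W * X - W ^ 2 * (X ^ 2 * ?v))"
    "twist (w ^ 2) (E 1) = E 25 * (?u - W ^ 2 * X - W ^ 4 * (X ^ 2 * ?v))"
    "twist (w ^ 3) (E 1) = E 25 * (?u - W ^ 3 * X - W * (X ^ 2 * ?v))"
    "twist (w ^ 4) (E 1) = E 25 * (?u - W ^ 4 * X - W ^ 3 * (X ^ 2 * ?v))"
    using tw[of 1] tw[of 2] tw[of 3] tw[of 4] unfolding E1_dissection[symmetric] by (simp_all add: W6)
  have "norm5 w (E 1) = E 25 ^ 5 * ((?u - X - X ^ 2 * ?v) * (?u - W * X - W ^ 2 * (X ^ 2 * ?v)) * (?u - W ^ 2 * X - W ^ 4 * (X ^ 2 * ?v))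
     * (?u - W ^ 3 * X - W * (X ^ 2 * ?v)) * (?u - W ^ 4 * X - W ^ 3 * (X ^ 2 * ?v)))"
    unfolding norm5_def t by (subst E1_dissection) (rule pull)
  also have "\<dots> = E 25 ^ 5 * (?u ^ 5 - X ^ 5 - (X ^ 2 * ?v) ^ 5 - 5 * ?u * X ^ 3 * (X ^ 2 * ?v) - 5 * ?u ^ 2 * X * (X ^ 2 * ?v) ^ 2)"
    unfolding norm_trinomial[OF W] ..
  also have "?u ^ 5 - X ^ 5 - (X ^ 2 * ?v) ^ 5 - 5 * ?u * X ^ 3 * (X ^ 2 * ?v) - 5 * ?u ^ 2 * X * (X ^ 2 * ?v) ^ 2
     = ?u ^ 5 - 11 * X ^ 5 - X ^ 10 * ?v ^ 5" using uvD by algebra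
  finally have "E 25 ^ 6 * (?u ^ 5 - 11 * X ^ 5 - X ^ 10 * ?v ^ 5) = E 5 ^ 6"
    using norm5_E1[OF w] by algebra
  then have "D (E 5 ^ 6 * (u_ser ^ 5 - 11 * X - X ^ 2 * v_ser ^ 5)) = D (E 1 ^ 6)"
    by (simp add: dilate_simps dilate_euler_E power_mult[symmetric])
  then show ?thesis using dilate_inj[of 5] by simp
qed

section \<open>Eta quotients of level ten as rational functions\<close>

lemma fps_cube_root_unique:
  fixes f g :: "complex fps"
  assumes "f ^ 3 = g ^ 3" "f $ 0 = 1" "g $ 0 = 1"
  shows "f = g"
proof -
  have "(f - g) * (f ^ 2 + f * g + g ^ 2) = 0" using assms(1) by algebra
  moreover have "(f ^ 2 + f * g + g ^ 2) $ 0 = 3" using assms(2,3) by (simp add: power2_eq_square)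
  then have "f ^ 2 + f * g + g ^ 2 \<noteq> 0" by force
  ultimately show ?thesis by simp
qed

lemma u_nth_0: "u_ser $ 0 = 1"
  using arg_cong[OF E1_dissection, of "\<lambda>f. f $ 0"] by (simp add: euler_E_nth_0)
lemma v_nth_0: "v_ser $ 0 = 1"
  using arg_cong[OF uv, of "\<lambda>f. f $ 0"] by (simp add: u_nth_0)
lemma U_nth_0: "U_ser $ 0 = 1" "V_ser $ 0 = 1" by (simp_all add: U_ser_def V_ser_def u_nth_0 v_nth_0)
lemma k_nth_0: "k_ser $ 0 = 0" by (simp add: k_ser_def)

lemma fps_nth_0_imp_nonzero: "(f :: complex fps) $ 0 = 1 \<Longrightarrow> f \<noteq> 0" by force

text \<open>The functions x, y, z below turn out to be k / d, (1 - k^2) / d and c / d.\<close>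

definition c_ser :: "complex fps" where "c_ser = 1 + k_ser - k_ser ^ 2"
definition d_ser :: "complex fps" where "d_ser = 1 - 4 * k_ser - k_ser ^ 2"

lemma cd_nth_0: "c_ser $ 0 = 1" "d_ser $ 0 = 1" "(1 + k_ser) $ 0 = 1" "(1 - k_ser) $ 0 = 1" "(1 - k_ser ^ 2) $ 0 = 1"
  by (simp_all add: c_ser_def d_ser_def k_nth_0 power2_eq_square)

lemmas nonzeros = cd_nth_0[THEN fps_nth_0_imp_nonzero] u_nth_0[THEN fps_nth_0_imp_nonzero]
  U_nth_0[THEN fps_nth_0_imp_nonzero] v_nth_0[THEN fps_nth_0_imp_nonzero]

text \<open>The norm of u - q - q^2 / u, with u dilated by 5, is a series in q^5; N1 is this series with q^5 replaced by q, and N2 is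
the dilation of N1 by 2. They equal E_1^6 / E_5^6 and E_2^6 / E_10^6.\<close>

definition N1 :: "complex fps" where "N1 = u_ser ^ 5 - 11 * X - X ^ 2 * v_ser ^ 5"
definition N2 :: "complex fps" where "N2 = U_ser ^ 5 - 11 * X ^ 2 - X ^ 4 * V_ser ^ 5"

lemma N1_E: "E 5 ^ 6 * N1 = E 1 ^ 6" unfolding N1_def by (rule E1_norm)
lemma N2_E: "E 10 ^ 6 * N2 = E 2 ^ 6"
  using arg_cong[OF E1_norm, of "dilate 2"]
  by (simp add: dilate_simps dilate_euler_E N2_def U_ser_def V_ser_def power_mult[symmetric])

text \<open>Inserting q = k u U^2 and eliminating U by Rogers' relation leaves u^5 times a rational function of k, which
factors.\<close>

lemma N1_k: "N1 * (1 + k_ser) ^ 4 = u_ser ^ 5 * d_ser ^ 2 * c_ser"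
proof -
  have s2: "U_ser ^ 2 * (1 + k_ser) ^ 2 = u_ser ^ 4 * (1 - k_ser) ^ 2" using rogers by algebra
  have x1: "X * (1 + k_ser) ^ 4 = u_ser ^ 5 * (k_ser * (1 - k_ser) ^ 2 * (1 + k_ser) ^ 2)"
    unfolding X_eq_k[symmetric] using X_eq_k s2 by algebra
  have s4: "U_ser ^ 4 * (1 + k_ser) ^ 4 = u_ser ^ 8 * (1 - k_ser) ^ 4" using s2 by algebra
  have "X ^ 2 * v_ser ^ 5 * (1 + k_ser) ^ 4 = k_ser ^ 2 * u_ser ^ 2 * v_ser ^ 5 * (U_ser ^ 4 * (1 + k_ser) ^ 4)"
    using X_eq_k by algebra
  also have "\<dots> = (u_ser * v_ser) ^ 5 * u_ser ^ 5 * k_ser ^ 2 * (1 - k_ser) ^ 4" unfolding s4 by algebra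
  finally have x2: "X ^ 2 * v_ser ^ 5 * (1 + k_ser) ^ 4 = u_ser ^ 5 * (k_ser ^ 2 * (1 - k_ser) ^ 4)" 
    by (simp only: uv power_one mult_1 mult_ac)
  have "N1 * (1 + k_ser) ^ 4 = u_ser ^ 5 * (1 + k_ser) ^ 4 - 11 * (X * (1 + k_ser) ^ 4) - X ^ 2 * v_ser ^ 5 * (1 + k_ser) ^ 4"
    unfolding N1_def by algebra
  then show ?thesis unfolding x1 x2 c_ser_def d_ser_def by algebra
qed

lemma N2_k: "N2 * (1 - k_ser) ^ 2 = U_ser ^ 5 * d_ser * c_ser ^ 2"
proof -
  have "X ^ 2 * (1 - k_ser) ^ 2 = k_ser ^ 2 * U_ser ^ 4 * (1 - k_ser) * (u_ser ^ 2 * (1 - k_ser))"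
    using X_eq_k by algebra
  then have x1: "X ^ 2 * (1 - k_ser) ^ 2 = U_ser ^ 5 * (k_ser ^ 2 * (1 - k_ser) * (1 + k_ser))"
    unfolding rogers by algebra
  have "X ^ 4 * V_ser ^ 5 * (1 - k_ser) ^ 2 = V_ser ^ 5 * k_ser ^ 4 * U_ser ^ 8 * (u_ser ^ 2 * (1 - k_ser)) ^ 2"
    using X_eq_k by algebra
  also have "\<dots> = (U_ser * V_ser) ^ 5 * U_ser ^ 5 * (k_ser ^ 4 * (1 + k_ser) ^ 2)"
    unfolding rogers by algebra
  finally have x2: "X ^ 4 * V_ser ^ 5 * (1 - k_ser) ^ 2 = U_ser ^ 5 * (k_ser ^ 4 * (1 + k_ser) ^ 2)"
    by (simp only: UV power_one mult_1 mult_ac)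
  have "N2 * (1 - k_ser) ^ 2 = U_ser ^ 5 * (1 - k_ser) ^ 2 - 11 * (X ^ 2 * (1 - k_ser) ^ 2) - X ^ 4 * V_ser ^ 5 * (1 - k_ser) ^ 2"
    unfolding N2_def by algebra
  then show ?thesis unfolding x1 x2 c_ser_def d_ser_def by algebra
qed

abbreviation (input) I :: "nat \<Rightarrow> complex fps" where "I j \<equiv> inverse (E j)"

definition x_ser :: "complex fps" where "x_ser = X * E 2 * E 10 ^ 3 * I 1 ^ 3 * I 5"
definition y_ser :: "complex fps" where "y_ser = E 2 ^ 2 * E 5 ^ 4 * I 1 ^ 4 * I 10 ^ 2"
definition z_ser :: "complex fps" where "z_ser = E 2 ^ 5 * E 5 * I 1 ^ 5 * I 10"
definition w_ser :: "complex fps" where "w_ser = E 2 ^ 4 * E 5 ^ 2 * I 1 ^ 2 * I 10 ^ 4"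

lemma EI: "E 1 * I 1 = 1" "E 2 * I 2 = 1" "E 5 * I 5 = 1" "E 10 * I 10 = 1"
  by (rule inverse_E, simp)+

lemma yz_nth_0: "y_ser $ 0 = 1" "w_ser $ 0 = 1"
  by (simp_all add: y_ser_def w_ser_def euler_E_nth_0 fps_nth_power_0)

text \<open>Since y and w involve only the ratios E_1 / E_5 and E_2 / E_10, their cubes are determined by the norms.\<close>

lemma eta_ratios:
  obtains p1 q1 p2 where "p1 * q1 = 1" "N1 = p1 ^ 6" "N2 = p2 ^ 6" 
    "y_ser = p2 ^ 2 * q1 ^ 4" "w_ser = p2 ^ 4 * q1 ^ 2"
proof
  show "(E 1 * I 5) * (E 5 * I 1) = 1" using EI by algebra
  have "N1 = (E 5 * I 5) ^ 6 * N1" unfolding EI by simp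
  also have "\<dots> = (E 5 ^ 6 * N1) * I 5 ^ 6" by algebra
  finally show "N1 = (E 1 * I 5) ^ 6" unfolding N1_E by algebra
  have "N2 = (E 10 * I 10) ^ 6 * N2" unfolding EI by simp
  also have "\<dots> = (E 10 ^ 6 * N2) * I 10 ^ 6" by algebra
  finally show "N2 = (E 2 * I 10) ^ 6" unfolding N2_E by algebra
  show "y_ser = (E 2 * I 10) ^ 2 * (E 5 * I 1) ^ 4" unfolding y_ser_def by algebra
  show "w_ser = (E 2 * I 10) ^ 4 * (E 5 * I 1) ^ 2" unfolding w_ser_def by algebra
qed

text \<open>In N2 / N1^2, the cube of y, the factor c cancels, and u and U cancel by Rogers' relation. What remains is the cube of
(1 - k^2) / d.\<close>

lemma y_k: "y_ser * d_ser = 1 - k_ser ^ 2"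
proof (rule fps_cube_root_unique)
  obtain p1 q1 p2 where pq: "p1 * q1 = 1" "N1 = p1 ^ 6" "N2 = p2 ^ 6" "y_ser = p2 ^ 2 * q1 ^ 4"
    by (rule eta_ratios)
  have "y_ser ^ 3 * N1 ^ 2 = N2 * (p1 * q1) ^ 12" unfolding pq(2-4) by algebra
  then have e: "y_ser ^ 3 * N1 ^ 2 = N2" unfolding pq(1) by simp
  have U5: "U_ser ^ 5 * (1 + k_ser) ^ 5 = u_ser ^ 10 * (1 - k_ser) ^ 5"
    unfolding power_mult_distrib[symmetric] rogers[symmetric] by algebra
  let ?c = "u_ser ^ 10 * d_ser * c_ser ^ 2 * (1 - k_ser) ^ 2"
  have "(y_ser * d_ser) ^ 3 * ?c = y_ser ^ 3 * (u_ser ^ 5 * d_ser ^ 2 * c_ser) ^ 2 * (1 - k_ser) ^ 2" by algebra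
  also have "\<dots> = (y_ser ^ 3 * N1 ^ 2) * (1 - k_ser) ^ 2 * (1 + k_ser) ^ 8" unfolding N1_k[symmetric] by algebra
  also have "\<dots> = (N2 * (1 - k_ser) ^ 2) * (1 + k_ser) ^ 8" unfolding e ..
  also have "\<dots> = d_ser * c_ser ^ 2 * (1 + k_ser) ^ 3 * (U_ser ^ 5 * (1 + k_ser) ^ 5)" unfolding N2_k by algebra
  also have "\<dots> = (1 - k_ser ^ 2) ^ 3 * ?c" unfolding U5 by algebra
  finally show "(y_ser * d_ser) ^ 3 = (1 - k_ser ^ 2) ^ 3"
    using nonzeros by (simp only: mult_cancel_right) simp
qed (simp_all add: yz_nth_0 cd_nth_0 k_nth_0 power2_eq_square)

lemma w_k: "w_ser = u_ser * U_ser ^ 2 * c_ser"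
proof (rule fps_cube_root_unique)
  obtain p1 q1 p2 where pq: "p1 * q1 = 1" "N1 = p1 ^ 6" "N2 = p2 ^ 6" "w_ser = p2 ^ 4 * q1 ^ 2"
    by (rule eta_ratios)
  have "w_ser ^ 3 * N1 = N2 ^ 2 * (p1 * q1) ^ 6" unfolding pq(2-4) by algebra
  then have e: "w_ser ^ 3 * N1 = N2 ^ 2" unfolding pq(1) by simp
  have U4: "U_ser ^ 4 * (1 + k_ser) ^ 4 = u_ser ^ 8 * (1 - k_ser) ^ 4"
    unfolding power_mult_distrib[symmetric] rogers[symmetric] by algebra
  let ?c = "u_ser ^ 5 * d_ser ^ 2 * c_ser * (1 - k_ser) ^ 4"
  have "w_ser ^ 3 * ?c = (w_ser ^ 3 * N1) * (1 + k_ser) ^ 4 * (1 - k_ser) ^ 4" unfolding N1_k[symmetric] by algebra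
  also have "\<dots> = (N2 * (1 - k_ser) ^ 2) ^ 2 * (1 + k_ser) ^ 4" unfolding e by algebra
  also have "\<dots> = U_ser ^ 6 * d_ser ^ 2 * c_ser ^ 4 * (U_ser ^ 4 * (1 + k_ser) ^ 4)" unfolding N2_k by algebra
  also have "\<dots> = (u_ser * U_ser ^ 2 * c_ser) ^ 3 * ?c" unfolding U4 by algebra
  finally show "w_ser ^ 3 = (u_ser * U_ser ^ 2 * c_ser) ^ 3"
    using nonzeros by (simp only: mult_cancel_right) simp
qed (simp_all add: yz_nth_0 cd_nth_0 u_nth_0 U_nth_0 power2_eq_square)

text \<open>The norms determine the ratios E_1 / E_5 and E_2 / E_10 but do not link E_5 with E_10. The missing
link is the product formula for a b, which equals u U^2 (1 - k^2).\<close>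

lemma ab_product: "u_ser * U_ser ^ 2 * (1 - k_ser ^ 2) * E 1 * E 10 ^ 5 = E 2 * E 5 ^ 5"
proof -
  have a: "psi5 * a_ser = theta 1 2 3" "psi5 * b_ser = theta 1 1 4"
    using psi5_inverse by (simp_all add: a_ser_def b_ser_def mult.left_commute)
  have a_k: "a_ser = u_ser * U_ser * (1 - k_ser)" "b_ser = U_ser * (1 + k_ser)"
    unfolding a_ser_eq b_ser_eq using X_eq_k uv UV by algebra+
  have "u_ser * U_ser ^ 2 * (1 - k_ser ^ 2) = a_ser * b_ser" unfolding a_k by algebra
  then have "u_ser * U_ser ^ 2 * (1 - k_ser ^ 2) * E 1 * E 10 ^ 5 = a_ser * b_ser * (psi5 * E 5) ^ 2 * E 1 * E 10"
    unfolding psi5_E5 by algebra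
  also have "\<dots> = ((psi5 * b_ser) * (psi5 * a_ser) * E 1 * E 10) * E 5 ^ 2" by algebra
  also have "\<dots> = E 2 * E 5 ^ 5" unfolding a theta_mod_five_product by algebra
  finally show ?thesis .
qed

lemma cleared_denominators:
  "x_ser * E 1 ^ 3 * E 5 = X * E 2 * E 10 ^ 3"
  "y_ser * E 1 ^ 4 * E 10 ^ 2 = E 2 ^ 2 * E 5 ^ 4"
  "z_ser * E 1 ^ 5 * E 10 = E 2 ^ 5 * E 5"
  "w_ser * E 1 ^ 2 * E 10 ^ 4 = E 2 ^ 4 * E 5 ^ 2"
proof -
  have "x_ser * E 1 ^ 3 * E 5 = X * E 2 * E 10 ^ 3 * (E 1 * I 1) ^ 3 * (E 5 * I 5)" unfolding x_ser_def by algebra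
  then show "x_ser * E 1 ^ 3 * E 5 = X * E 2 * E 10 ^ 3" unfolding EI by simp
  have "y_ser * E 1 ^ 4 * E 10 ^ 2 = E 2 ^ 2 * E 5 ^ 4 * (E 1 * I 1) ^ 4 * (E 10 * I 10) ^ 2" unfolding y_ser_def by algebra
  then show "y_ser * E 1 ^ 4 * E 10 ^ 2 = E 2 ^ 2 * E 5 ^ 4" unfolding EI by simp
  have "z_ser * E 1 ^ 5 * E 10 = E 2 ^ 5 * E 5 * (E 1 * I 1) ^ 5 * (E 10 * I 10)" unfolding z_ser_def by algebra
  then show "z_ser * E 1 ^ 5 * E 10 = E 2 ^ 5 * E 5" unfolding EI by simp
  have "w_ser * E 1 ^ 2 * E 10 ^ 4 = E 2 ^ 4 * E 5 ^ 2 * (E 1 * I 1) ^ 2 * (E 10 * I 10) ^ 4" unfolding w_ser_def by algebra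
  then show "w_ser * E 1 ^ 2 * E 10 ^ 4 = E 2 ^ 4 * E 5 ^ 2" unfolding EI by simp
qed

lemma E_nonzero: "E 1 \<noteq> 0" "E 2 \<noteq> 0" "E 5 \<noteq> 0" "E 10 \<noteq> 0" by (rule E_unit, simp)+

lemma x_k: "x_ser * d_ser = k_ser"
proof -
  let ?c = "E 2 * E 5 ^ 5 * E 1 ^ 3"
  have "k_ser * ?c = k_ser * (u_ser * U_ser ^ 2 * (1 - k_ser ^ 2) * E 1 * E 10 ^ 5) * E 1 ^ 3"
    unfolding ab_product by algebra
  also have "\<dots> = (k_ser * u_ser * U_ser ^ 2) * (1 - k_ser ^ 2) * E 1 ^ 4 * E 10 ^ 5" by algebra
  also have "\<dots> = X * (y_ser * d_ser) * E 1 ^ 4 * E 10 ^ 5" unfolding X_eq_k[symmetric] y_k ..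
  also have "\<dots> = X * d_ser * E 10 ^ 3 * (y_ser * E 1 ^ 4 * E 10 ^ 2)" by algebra
  also have "\<dots> = d_ser * E 2 * E 5 ^ 4 * (X * E 2 * E 10 ^ 3)" unfolding cleared_denominators by algebra
  also have "\<dots> = (x_ser * d_ser) * ?c" unfolding cleared_denominators(1)[symmetric] by algebra
  finally show ?thesis using E_nonzero by simp
qed

lemma z_k: "z_ser * d_ser = c_ser"
proof -
  let ?c = "E 2 * E 5 ^ 5 * E 1 ^ 5 * E 10"
  have "c_ser * ?c = c_ser * (u_ser * U_ser ^ 2 * (1 - k_ser ^ 2) * E 1 * E 10 ^ 5) * E 1 ^ 5 * E 10"
    unfolding ab_product by algebra
  also have "\<dots> = (u_ser * U_ser ^ 2 * c_ser) * (1 - k_ser ^ 2) * E 1 ^ 6 * E 10 ^ 6" by algebra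
  also have "\<dots> = w_ser * (y_ser * d_ser) * E 1 ^ 6 * E 10 ^ 6" unfolding w_k[symmetric] y_k ..
  also have "\<dots> = (w_ser * E 1 ^ 2 * E 10 ^ 4) * (y_ser * E 1 ^ 4 * E 10 ^ 2) * d_ser" by algebra
  also have "\<dots> = (E 2 ^ 5 * E 5) * E 2 * E 5 ^ 5 * d_ser" unfolding cleared_denominators by algebra
  also have "\<dots> = (z_ser * d_ser) * ?c" unfolding cleared_denominators(3)[symmetric] by algebra
  finally show ?thesis using E_nonzero by simp
qed

text \<open>All three functions have the denominator d, and the numerators k, 1 - k^2 and 1 + k - k^2 satisfy the corresponding
linear relations.\<close>

theorem level_10_relations: "y_ser = 1 + 4 * x_ser" "z_ser = 1 + 5 * x_ser"
proof -
  have "(1 + 4 * x_ser) * d_ser = d_ser + 4 * (x_ser * d_ser)" by algebra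
  also have "\<dots> = 1 - k_ser ^ 2" unfolding x_k unfolding d_ser_def by algebra
  finally have "y_ser * d_ser = (1 + 4 * x_ser) * d_ser" unfolding y_k ..
  then show "y_ser = 1 + 4 * x_ser" using nonzeros by simp
  have "(1 + 5 * x_ser) * d_ser = d_ser + 5 * (x_ser * d_ser)" by algebra
  also have "\<dots> = c_ser" unfolding x_k unfolding d_ser_def c_ser_def by algebra
  finally have "z_ser * d_ser = (1 + 5 * x_ser) * d_ser" unfolding z_k ..
  then show "z_ser = 1 + 5 * x_ser" using nonzeros by simp
qed

section \<open>The two sections of the generating function\<close>

lemma sect_mult_dissections:
  defines "d \<equiv> \<lambda>f0 f1 f2 f3 f4. D f0 + X * D f1 + X ^ 2 * D f2 + X ^ 3 * D f3 + X ^ 4 * D f4"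
  shows "sect 5 0 (d f0 f1 f2 f3 f4 * d g0 g1 g2 g3 g4) = f0 * g0 + X * (f1 * g4 + f2 * g3 + f3 * g2 + f4 * g1)"
    and "sect 5 3 (d f0 f1 f2 f3 f4 * d g0 g1 g2 g3 g4) = f0 * g3 + f1 * g2 + f2 * g1 + f3 * g0 + X * (f4 * g4)"
    and "sect 5 4 (d f0 f1 f2 f3 f4 * d g0 g1 g2 g3 g4) = f0 * g4 + f1 * g3 + f2 * g2 + f3 * g1 + f4 * g0"
proof -
  have *: "d f0 f1 f2 f3 f4 * d g0 g1 g2 g3 g4 = 
     D (f0 * g0 + X * (f1 * g4 + f2 * g3 + f3 * g2 + f4 * g1)) +
     X * D (f0 * g1 + f1 * g0 + X * (f2 * g4 + f3 * g3 + f4 * g2)) +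
     X ^ 2 * D (f0 * g2 + f1 * g1 + f2 * g0 + X * (f3 * g4 + f4 * g3)) +
     X ^ 3 * D (f0 * g3 + f1 * g2 + f2 * g1 + f3 * g0 + X * (f4 * g4)) +
     X ^ 4 * D (f0 * g4 + f1 * g3 + f2 * g2 + f3 * g1 + f4 * g0)"
    unfolding d_def by (simp add: dilate_simps) algebra
  show "sect 5 0 (d f0 f1 f2 f3 f4 * d g0 g1 g2 g3 g4) = f0 * g0 + X * (f1 * g4 + f2 * g3 + f3 * g2 + f4 * g1)"
    "sect 5 3 (d f0 f1 f2 f3 f4 * d g0 g1 g2 g3 g4) = f0 * g3 + f1 * g2 + f2 * g1 + f3 * g0 + X * (f4 * g4)"
    "sect 5 4 (d f0 f1 f2 f3 f4 * d g0 g1 g2 g3 g4) = f0 * g4 + f1 * g3 + f2 * g2 + f3 * g1 + f4 * g0"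
    unfolding * sect_dissection by (rule refl)+
qed

lemma sect_D_mult: "sect 5 0 (D g * h) = g * sect 5 0 h" "sect 5 3 (D g * h) = g * sect 5 3 h"
  "sect 5 4 (D g * h) = g * sect 5 4 h"
  by (simp_all add: sect_dilate_mult)

lemma uvD: "D u_ser * D v_ser = 1" "D U_ser * D V_ser = 1"
  using arg_cong[OF uv, of D] arg_cong[OF UV, of D] by (simp_all add: dilate_simps)

text \<open>The product of the four other conjugates of the dissection of E_1, that is, of u - q - q^2 / u with u dilated
by 5.\<close>

definition E1_cofactor :: "complex fps" where
  "E1_cofactor = D (u_ser ^ 4 - 3 * X * v_ser) + X * D (u_ser ^ 3 + 2 * X * v_ser ^ 2)
    + X ^ 2 * D (2 * u_ser ^ 2 - X * v_ser ^ 3) + X ^ 3 * D (3 * u_ser + X * v_ser ^ 4) + X ^ 4 * D 5"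

lemma E1_cofactor: "(D u_ser - X - X ^ 2 * D v_ser) * E1_cofactor = D N1"
  unfolding E1_cofactor_def N1_def using uvD(1) by (simp add: dilate_simps) algebra

lemma inverse_E1_dissection: "I 1 * D (E 5 * N1) = E1_cofactor"
proof -
  have "I 1 * D (E 5 * N1) = I 1 * (E 25 * ((D u_ser - X - X ^ 2 * D v_ser) * E1_cofactor))"
    unfolding E1_cofactor by (simp add: dilate_simps dilate_euler_E)
  also have "\<dots> = I 1 * E 1 * E1_cofactor"
    by (subst (2) E1_dissection) (simp only: mult_ac)
  also have "\<dots> = (E 1 * I 1) * E1_cofactor" by (simp only: mult_ac)
  finally show ?thesis unfolding EI by simp
qed

text \<open>Ramanujan's identity for p(5n + 4): the component of the cofactor in class 4 is the constant 5.\<close>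

theorem ramanujan_partition: "sect 5 4 (I 1) * E 1 ^ 6 = 5 * E 5 ^ 5"
proof -
  have "E 5 * N1 * sect 5 4 (I 1) = sect 5 4 (D (E 5 * N1) * I 1)"
    by (simp add: sect_dilate_mult)
  also have "\<dots> = 5" unfolding mult.commute[of _ "I 1"] inverse_E1_dissection E1_cofactor_def sect_dissection ..
  finally have e: "E 5 * N1 * sect 5 4 (I 1) = 5" .
  have "sect 5 4 (I 1) * E 1 ^ 6 = (E 5 * N1 * sect 5 4 (I 1)) * E 5 ^ 5"
    unfolding N1_E[symmetric] by algebra
  then show ?thesis unfolding e .
qed

text \<open>Only the terms -q of E_1 and -q^2 of E_2 have exponents that add up to the class 3.\<close>

lemma sect_E1_E2: "sect 5 3 (E 1 * E 2) = E 5 * E 10"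
proof -
  have "E 1 * E 2 = D (E 5 * E 10) * ((D u_ser + X * D (- 1) + X ^ 2 * D (- v_ser) + X ^ 3 * D 0 + X ^ 4 * D 0) *
     (D U_ser + X * D 0 + X ^ 2 * D (- 1) + X ^ 3 * D 0 + X ^ 4 * D (- V_ser)))"
    by (subst E1_dissection, subst E2_dissection) (simp add: dilate_simps dilate_euler_E mult_ac)
  then show ?thesis by (simp add: sect_dilate_mult sect_mult_dissections)
qed

text \<open>This is sum f(30 n + 25) q^n / 5. It equals E_5^2 E_10 / phi(-q)^2, where E_5 and E_10 are series in q^5.\<close>

definition M1 :: "complex fps" where "M1 = E 2 ^ 2 * E 5 ^ 2 * E 10 * I 1 ^ 4"

text \<open>The component of psi E_2 / E_1 in class 4, up to eta factors. In terms of r = u U^2, m = U / u^2 and n = 1 / m every summand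
is r times a polynomial in k, m, n, and m is (1 - k) / (1 + k) by Rogers' relation.\<close>

lemma quintic_identity:
  fixes u v U V k x m n :: "'a::idom"
  assumes uv: "u * v = 1" and UV: "U * V = 1" and x: "x = k * u * U ^ 2" and rog: "u ^ 2 * (1 - k) = U * (1 + k)"
  defines "a \<equiv> u * U - x * V" and "b \<equiv> U + x * V * v"
  shows "((a * U - x * b * V - x) * 5 + b * U * (3 * u + x * v ^ 4) + (- a - x * V) * (2 * u ^ 2 - x * v ^ 3)
    + (U - b) * (u ^ 3 + 2 * x * v ^ 2) + (- a * V) * (u ^ 4 - 3 * x * v)) * (1 - k ^ 2)
    = 5 * (u * U ^ 2 * (1 + k - k ^ 2) * (1 - 4 * k - k ^ 2))"
proof -
  define m n r where "m = U * v ^ 2" and "n = u ^ 2 * V" and "r = u * U ^ 2"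
  have m: "m * (1 + k) = 1 - k" and n: "n * (1 - k) = 1 + k"
    unfolding m_def n_def using uv UV rog by algebra+
  have a: "a = u * U * (1 - k)" and b: "b = U * (1 + k)"
    unfolding a_def b_def using uv UV x by algebra+
  have t1: "a * U - x * b * V - x = r * (1 - 3 * k - k ^ 2)"
    unfolding a b r_def using UV x by algebra
  have t2: "b * U * (3 * u + x * v ^ 4) = r * ((1 + k) * (3 + k * m ^ 2))"
    unfolding b r_def m_def x by algebra
  have t3: "(- a - x * V) * (2 * u ^ 2 - x * v ^ 3) = r * (k * m - 2 * n)"
    unfolding a r_def m_def n_def x using uv UV by algebra
  have t4: "(U - b) * (u ^ 3 + 2 * x * v ^ 2) = r * (- k * n - 2 * k ^ 2 * m)"
    unfolding b r_def m_def n_def x using uv UV by algebra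
  have t5: "(- a * V) * (u ^ 4 - 3 * x * v) = r * (1 - k) * (3 * k - n ^ 2)"
    unfolding a r_def m_def n_def x using uv UV by algebra
  have "(5 * (1 - 3 * k - k ^ 2) + (1 + k) * (3 + k * m ^ 2) + (k * m - 2 * n) + (- k * n - 2 * k ^ 2 * m) + (1 - k) * (3 * k - n ^ 2)) * (1 - k ^ 2)
     = 5 * ((1 + k - k ^ 2) * (1 - 4 * k - k ^ 2))"
    using m n by algebra
  then have "r * ((5 * (1 - 3 * k - k ^ 2) + (1 + k) * (3 + k * m ^ 2) + (k * m - 2 * n) + (- k * n - 2 * k ^ 2 * m) + (1 - k) * (3 * k - n ^ 2)) * (1 - k ^ 2))
     = r * (5 * ((1 + k - k ^ 2) * (1 - 4 * k - k ^ 2)))" by simp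
  then show ?thesis unfolding t1 t2 t3 t4 t5 r_def by algebra
qed

text \<open>E_2^3 / E_1^2 is psi E_2 / E_1, a product of three dissected series. Its class 4 component is 5 u U^2 c d / (1 - k^2)
up to eta factors, and w and y turn this into an eta quotient.\<close>

theorem first_section: "sect 5 4 (E 2 ^ 3 * I 1 ^ 2) = 5 * M1"
proof -
  let ?H = "E 2 ^ 3 * I 1 ^ 2" and ?u = u_ser and ?v = v_ser and ?U = U_ser and ?V = V_ser and ?a = a_ser and ?b = b_ser
  let ?R = "((?a * ?U - X * ?b * ?V - X) * 5 + ?b * ?U * (3 * ?u + X * ?v ^ 4) + (- ?a - X * ?V) * (2 * ?u ^ 2 - X * ?v ^ 3)
    + (?U - ?b) * (?u ^ 3 + 2 * X * ?v ^ 2) + (- ?a * ?V) * (?u ^ 4 - 3 * X * ?v))"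
  have H: "?H = psi * E 2 * I 1" unfolding psi_def by algebra
  have psiE2: "psi * E 2 = D (psi5 * E 10) * (D (?a * ?U - X * ?b * ?V - X) + X * D (?b * ?U) + X ^ 2 * D (- ?a - X * ?V)
     + X ^ 3 * D (?U - ?b) + X ^ 4 * D (- ?a * ?V))"
  proof -
    have "psi * E 2 = D psi5 * E 50 * ((D ?a + X * D ?b + X ^ 3) * (D ?U - X ^ 2 - X ^ 4 * D ?V))"
      by (subst psi_dissection, subst E2_dissection) (simp only: mult_ac)
    also have "(D ?a + X * D ?b + X ^ 3) * (D ?U - X ^ 2 - X ^ 4 * D ?V) = 
      D (?a * ?U - X * ?b * ?V - X) + X * D (?b * ?U) + X ^ 2 * D (- ?a - X * ?V)
     + X ^ 3 * D (?U - ?b) + X ^ 4 * D (- ?a * ?V)"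
      by (simp add: dilate_simps) algebra
    finally show ?thesis by (simp add: dilate_simps dilate_euler_E)
  qed
  have "E 5 * N1 * sect 5 4 ?H = sect 5 4 (D (E 5 * N1) * ?H)"
    by (simp add: sect_dilate_mult)
  also have "D (E 5 * N1) * ?H = psi * E 2 * (I 1 * D (E 5 * N1))"
    unfolding H by (simp only: mult_ac)
  also have "\<dots> = D (psi5 * E 10) * ((D (?a * ?U - X * ?b * ?V - X) + X * D (?b * ?U) + X ^ 2 * D (- ?a - X * ?V)
     + X ^ 3 * D (?U - ?b) + X ^ 4 * D (- ?a * ?V)) * E1_cofactor)"
    unfolding inverse_E1_dissection psiE2 by (simp only: mult.assoc)
  also have "sect 5 4 \<dots> = psi5 * E 10 * ?R"
    unfolding E1_cofactor_def sect_D_mult sect_mult_dissections ..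
  finally have e1: "E 5 * N1 * sect 5 4 ?H = psi5 * E 10 * ?R" .
  have R: "?R * (1 - k_ser ^ 2) = 5 * (u_ser * U_ser ^ 2 * (1 + k_ser - k_ser ^ 2) * (1 - 4 * k_ser - k_ser ^ 2))"
    unfolding a_ser_eq b_ser_eq by (rule quintic_identity[OF uv UV X_eq_k rogers])
  have "sect 5 4 ?H * E 1 ^ 6 * (1 - k_ser ^ 2) = (E 5 * N1 * sect 5 4 ?H) * E 5 ^ 5 * (1 - k_ser ^ 2)"
    unfolding N1_E[symmetric] by algebra
  also have "\<dots> = (psi5 * E 5) * E 5 ^ 4 * E 10 * (?R * (1 - k_ser ^ 2))" unfolding e1 by algebra
  also have "\<dots> = 5 * E 10 ^ 3 * E 5 ^ 4 * w_ser * d_ser"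
    unfolding R psi5_E5 w_k c_ser_def d_ser_def by algebra
  finally have "(sect 5 4 ?H * E 1 ^ 6 * y_ser) * d_ser = (5 * E 10 ^ 3 * E 5 ^ 4 * w_ser) * d_ser"
    unfolding y_k[symmetric] by (simp only: mult.assoc)
  then have e2: "sect 5 4 ?H * E 1 ^ 6 * y_ser = 5 * E 10 ^ 3 * E 5 ^ 4 * w_ser"
    using nonzeros by simp
  let ?c = "E 1 ^ 4 * E 10 ^ 4 * E 2 ^ 2 * E 5 ^ 4"
  have "sect 5 4 ?H * E 1 ^ 4 * ?c = sect 5 4 ?H * E 1 ^ 8 * E 10 ^ 4 * (E 2 ^ 2 * E 5 ^ 4)" by algebra
  also have "\<dots> = (sect 5 4 ?H * E 1 ^ 6 * y_ser) * E 1 ^ 6 * E 10 ^ 6" unfolding cleared_denominators(2)[symmetric] by algebra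
  also have "\<dots> = 5 * E 10 ^ 5 * E 5 ^ 4 * E 1 ^ 4 * (w_ser * E 1 ^ 2 * E 10 ^ 4)" unfolding e2 by algebra
  also have "\<dots> = 5 * E 2 ^ 2 * E 5 ^ 2 * E 10 * ?c" unfolding cleared_denominators by algebra
  finally have "sect 5 4 ?H * E 1 ^ 4 = 5 * E 2 ^ 2 * E 5 ^ 2 * E 10" using E_nonzero by simp
  then have "sect 5 4 ?H * (E 1 * I 1) ^ 4 = 5 * E 2 ^ 2 * E 5 ^ 2 * E 10 * I 1 ^ 4" by algebra
  then show ?thesis unfolding EI M1_def by (simp add: mult.assoc)
qed

definition phi :: "complex fps" where "phi = theta (-1) 1 1"
definition phi5 :: "complex fps" where "phi5 = D phi"
lemma phi_E2: "phi * E 2 = E 1 ^ 2" unfolding phi_def by (rule gauss_square)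
lemma phi5_E10: "phi5 * E 10 = E 5 ^ 2"
  using arg_cong[OF phi_E2, of D] unfolding phi5_def by (simp add: dilate_simps dilate_euler_E)
lemma phi_nth_0: "phi $ 0 = 1"
  using arg_cong[OF phi_E2, of "\<lambda>f. f $ 0"] by (simp add: euler_E_nth_0 power2_eq_square)

text \<open>The components of phi(-q) are obtained from phi(-q) E_2 = E_1^2 in the same way as those of psi from
E_2^2 = psi E_1.\<close>

lemma phi_relations:
  obtains \<beta> \<gamma> where "phi = D phi5 * (1 + X * D \<beta> + X ^ 4 * D \<gamma>)"
    "U_ser - X * \<beta> * V_ser = u_ser ^ 2" "\<gamma> * U_ser - V_ser = v_ser ^ 2" "- \<beta> - X * \<gamma> * V_ser = 2 * v_ser"
proof -
  have i: "phi5 * inverse phi5 = 1" by (rule inverse_mult_eq_1') (simp add: phi5_def phi_nth_0)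
  define \<beta> \<gamma> where "\<beta> = sect 5 1 phi * inverse phi5" and "\<gamma> = sect 5 4 phi * inverse phi5"
  have "sect 5 1 phi = phi5 * \<beta>" "sect 5 4 phi = phi5 * \<gamma>"
    unfolding \<beta>_def \<gamma>_def using i by algebra+
  then have phi: "phi = D phi5 * (1 + X * D \<beta> + X ^ 4 * D \<gamma>)"
    using dissection[of phi] sect_square unfolding phi_def[symmetric] phi5_def[symmetric]
    by (simp add: dilate_simps algebra_simps)
  have c: "D phi5 * E 50 = E 25 ^ 2"
    using arg_cong[OF phi5_E10, of D] by (simp add: dilate_simps dilate_euler_E)
  let ?u = "D u_ser" and ?v = "D v_ser" and ?U = "D U_ser" and ?V = "D V_ser"
  have "(D phi5 * (1 + X * D \<beta> + X ^ 4 * D \<gamma>)) * (E 50 * (?U - X ^ 2 - X ^ 4 * ?V)) = E 25 ^ 2 * (?u - X - X ^ 2 * ?v) ^ 2"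
    using phi_E2 unfolding phi[symmetric] E2_dissection[symmetric] power_mult_distrib[symmetric] E1_dissection[symmetric] .
  moreover have "(D phi5 * (1 + X * D \<beta> + X ^ 4 * D \<gamma>)) * (E 50 * (?U - X ^ 2 - X ^ 4 * ?V)) =
     E 25 ^ 2 * ((1 + X * D \<beta> + X ^ 4 * D \<gamma>) * (?U - X ^ 2 - X ^ 4 * ?V))"
    unfolding c[symmetric] by (simp only: mult_ac)
  ultimately have eq: "(1 + X * D \<beta> + X ^ 4 * D \<gamma>) * (?U - X ^ 2 - X ^ 4 * ?V) = (?u - X - X ^ 2 * ?v) ^ 2"
    using E_unit[of 25] by simp
  have l: "(1 + X * D \<beta> + X ^ 4 * D \<gamma>) * (?U - X ^ 2 - X ^ 4 * ?V) =
     D (U_ser - X * \<beta> * V_ser) + X * D (\<beta> * U_ser - X * \<gamma>) + X ^ 2 * D (- 1) + X ^ 3 * D (- \<beta> - X * \<gamma> * V_ser) + X ^ 4 * D (\<gamma> * U_ser - V_ser)"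
    by (simp add: dilate_simps) algebra
  have r: "(?u - X - X ^ 2 * ?v) ^ 2 = D (u_ser ^ 2) + X * D (- 2 * u_ser) + X ^ 2 * D (1 - 2 * u_ser * v_ser)
     + X ^ 3 * D (2 * v_ser) + X ^ 4 * D (v_ser ^ 2)"
    by (simp add: dilate_simps) algebra
  note s = arg_cong[OF eq[unfolded l r]]
  show thesis
    using that[OF phi] s[of "sect 5 0"] s[of "sect 5 3"] s[of "sect 5 4"] unfolding sect_dissection by blast
qed

text \<open>Let alpha and alpha' be the two nontrivial parts of phi(-q), normalised. The norm of 1 + alpha + alpha' and the
section of the square of its cofactor are polynomials in p = alpha alpha' and s = alpha^5 + alpha'^5. Both p and s are
functions of k only, with 1 + p = 1 / y and norm (1 + p)^3.\<close>

theorem second_section: "sect 5 0 M1 = E 2 ^ 5 * E 5 ^ 4 * I 1 ^ 6 * I 10 ^ 2 * 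
   (1 + 160 * (x_ser * z_ser) + 2000 * (x_ser * y_ser) ^ 2)"
proof -
  obtain \<beta> \<gamma> where phi: "phi = D phi5 * (1 + X * D \<beta> + X ^ 4 * D \<gamma>)"
    and rel: "U_ser - X * \<beta> * V_ser = u_ser ^ 2" "\<gamma> * U_ser - V_ser = v_ser ^ 2" "- \<beta> - X * \<gamma> * V_ser = 2 * v_ser"
    by (rule phi_relations)
  define p s m n where "p = X * \<beta> * \<gamma>" and "s = X * \<beta> ^ 5 + X ^ 4 * \<gamma> ^ 5"
    and "m = U_ser * v_ser ^ 2" and "n = u_ser ^ 2 * V_ser"
  have mk: "m * (1 + k_ser) = 1 - k_ser" and nk: "n * (1 - k_ser) = 1 + k_ser" and mn: "m * n = 1"
    unfolding m_def n_def using uv UV rogers by algebra+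
  have g: "\<gamma> = V_ser ^ 2 * (1 + m)" unfolding m_def using rel(2) UV by algebra
  have Xb: "X * \<beta> = U_ser ^ 2 * (1 - n)" unfolding n_def using rel(1) UV by algebra
  have p: "p = m - n"
  proof -
    have "p = (U_ser * V_ser) ^ 2 * (1 - n) * (1 + m)" unfolding p_def Xb g by algebra
    then show ?thesis unfolding UV power_one mult_1 using mn by algebra
  qed
  have "(1 + p) * (1 - k_ser ^ 2) = d_ser" unfolding p d_ser_def using mk nk by algebra
  then have "(y_ser * (1 + p)) * (1 - k_ser ^ 2) = 1 * (1 - k_ser ^ 2)"
    unfolding y_k[symmetric] by (simp only: mult.assoc mult_1)
  then have py: "y_ser * (1 + p) = 1" using nonzeros by (simp only: mult_cancel_right) simp
  have XgV: "X * \<gamma> * V_ser = k_ser * v_ser * (1 + n)"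
  proof -
    have "X * \<gamma> * V_ser = k_ser * u_ser * V_ser * (1 + m) * (U_ser * V_ser) ^ 2"
      unfolding g using X_eq_k by algebra
    then show ?thesis unfolding UV power_one mult_1_right m_def n_def using uv UV by algebra
  qed
  have b: "\<beta> = - v_ser * (1 + n)" using rel(3) XgV nk by algebra
  have Xg: "X * \<gamma> = v_ser * U_ser * (n - 1)" using rel(3) b UV by algebra
  have s: "s = 8 * p - 2 * p ^ 2 + p ^ 3"
  proof -
    have "s = (X * \<beta>) * \<beta> ^ 4 + (X * \<gamma>) ^ 4 * \<gamma>" unfolding s_def by algebra
    also have "\<dots> = U_ser ^ 2 * (1 - n) * (- v_ser * (1 + n)) ^ 4 + (v_ser * U_ser * (n - 1)) ^ 4 * (V_ser ^ 2 * (1 + m))"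
      unfolding Xb Xg unfolding b g ..
    also have "\<dots> = m ^ 2 * (1 - n) * (1 + n) ^ 4 + m ^ 2 * (n - 1) ^ 4 * (1 + m) * (U_ser * V_ser) ^ 2"
      unfolding m_def by algebra
    also have "\<dots> = 8 * p - 2 * p ^ 2 + p ^ 3"
      unfolding UV power_one mult_1_right p using mn by algebra
    finally show ?thesis .
  qed
  \<comment> \<open>The quotient of the norm by 1 + alpha + alpha', sorted by residue classes.\<close>
  define P where "P = D (1 - 3 * p + p ^ 2) + X * D (X ^ 3 * \<gamma> ^ 4 - (1 - 2 * p) * \<beta>) + X ^ 2 * D ((1 - p) * \<beta> ^ 2 - X ^ 2 * \<gamma> ^ 3)
    + X ^ 3 * D (X * (1 - p) * \<gamma> ^ 2 - \<beta> ^ 3) + X ^ 4 * D (\<beta> ^ 4 - (1 - 2 * p) * \<gamma>)"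
  have "(1 + X * D \<beta> + X ^ 4 * D \<gamma>) * P = D (1 - 5 * p + 5 * p ^ 2 + s)"
    unfolding P_def p_def s_def by (simp add: dilate_simps) algebra
  also have "1 - 5 * p + 5 * p ^ 2 + s = (1 + p) ^ 3" unfolding s by algebra
  finally have phiP: "phi * P = D (phi5 * (1 + p) ^ 3)"
    by (subst phi) (simp add: dilate_simps mult.assoc)
  define i where "i = E 2 * I 1 ^ 2"
  have "phi * i = (E 1 * I 1) ^ 2" unfolding i_def using phi_E2 by algebra
  then have phii: "phi * i = 1" unfolding EI by simp
  have iP: "D (phi5 * (1 + p) ^ 3) * i = P" unfolding phiP[symmetric] using phii by algebra
  have M1: "M1 = D (E 1 ^ 2 * E 2) * i ^ 2" 
    unfolding M1_def i_def by (simp add: dilate_simps dilate_euler_E) algebra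
  \<comment> \<open>The class 0 component of the square of the cofactor.\<close>
  define T where "T = (1 - 3 * p + p ^ 2) ^ 2 + 2 * ((1 - 2 * p) ^ 2 * p - (2 - 3 * p) * s + p ^ 4 + (1 - p) ^ 2 * p ^ 2 + p ^ 3)"
  have "phi5 ^ 2 * (1 + p) ^ 6 * sect 5 0 M1 = sect 5 0 (D (phi5 ^ 2 * (1 + p) ^ 6) * M1)"
    by (simp add: sect_dilate_mult)
  also have "D (phi5 ^ 2 * (1 + p) ^ 6) = D (phi5 * (1 + p) ^ 3) ^ 2"
    by (simp add: dilate_simps power_mult_distrib power_mult[symmetric])
  also have "D (phi5 * (1 + p) ^ 3) ^ 2 * M1 = D (E 1 ^ 2 * E 2) * (P * P)"
    unfolding M1 iP[symmetric] by algebra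
  also have "sect 5 0 (D (E 1 ^ 2 * E 2) * (P * P)) = E 1 ^ 2 * E 2 * sect 5 0 (P * P)"
    by (simp add: sect_dilate_mult)
  also have "sect 5 0 (P * P) = T"
    unfolding P_def sect_mult_dissections T_def p_def s_def by algebra
  finally have e: "phi5 ^ 2 * (1 + p) ^ 6 * sect 5 0 M1 = E 1 ^ 2 * E 2 * T" .
  let ?S = "1 + 160 * (x_ser * z_ser) + 2000 * (x_ser * y_ser) ^ 2"
  \<comment> \<open>T is a polynomial of degree 4 in p, so y^4 T is a polynomial in y and y p.\<close>
  have yp: "y_ser * p = - 4 * x_ser" using py level_10_relations by algebra
  have "y_ser ^ 4 * T = (y_ser ^ 2 - 3 * y_ser * (y_ser * p) + (y_ser * p) ^ 2) ^ 2 + 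
    2 * ((y_ser - 2 * (y_ser * p)) ^ 2 * y_ser * (y_ser * p) 
      - (2 * y_ser - 3 * (y_ser * p)) * (8 * y_ser ^ 2 * (y_ser * p) - 2 * y_ser * (y_ser * p) ^ 2 + (y_ser * p) ^ 3)
      + (y_ser * p) ^ 4 + (y_ser - y_ser * p) ^ 2 * (y_ser * p) ^ 2 + y_ser * (y_ser * p) ^ 3)"
    unfolding T_def s by algebra
  also have "\<dots> = ?S" unfolding yp unfolding level_10_relations by algebra
  finally have T: "y_ser ^ 4 * T = ?S" .
  have "sect 5 0 M1 * E 5 ^ 4 = (phi5 * E 10) ^ 2 * sect 5 0 M1 * (y_ser * (1 + p)) ^ 6"
    unfolding phi5_E10 py power_one mult_1_right by algebra
  also have "\<dots> = E 10 ^ 2 * y_ser ^ 6 * (phi5 ^ 2 * (1 + p) ^ 6 * sect 5 0 M1)" by algebra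
  also have "\<dots> = E 10 ^ 2 * y_ser ^ 2 * E 1 ^ 2 * E 2 * (y_ser ^ 4 * T)" unfolding e by algebra
  also have "\<dots> = (E 1 * I 1) ^ 2 * (E 10 * I 10) ^ 2 * (E 2 ^ 5 * E 5 ^ 4 * I 1 ^ 6 * I 10 ^ 2 * ?S) * E 5 ^ 4"
    unfolding T unfolding y_ser_def by algebra
  finally show ?thesis using E_nonzero unfolding EI by simp
qed

section \<open>Congruences modulo 25\<close>

definition int_fps :: "complex fps \<Rightarrow> bool" where "int_fps f \<longleftrightarrow> (\<forall>n. f $ n \<in> \<int>)"

lemma int_fps_add: "int_fps f \<Longrightarrow> int_fps g \<Longrightarrow> int_fps (f + g)" by (simp add: int_fps_def)
lemma int_fps_diff: "int_fps f \<Longrightarrow> int_fps g \<Longrightarrow> int_fps (f - g)" by (simp add: int_fps_def)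
lemma int_fps_uminus: "int_fps f \<Longrightarrow> int_fps (- f)" by (simp add: int_fps_def)
lemma int_fps_mult: "int_fps f \<Longrightarrow> int_fps g \<Longrightarrow> int_fps (f * g)"
  by (auto simp: int_fps_def fps_mult_nth intro!: Ints_sum Ints_mult)
lemma int_fps_1: "int_fps 1" by (simp add: int_fps_def)
lemma int_fps_0: "int_fps 0" by (simp add: int_fps_def)
lemma int_fps_numeral: "int_fps (numeral k)" by (simp add: int_fps_def numeral_fps_const)
lemma int_fps_of_int: "int_fps (of_int k)" by (simp add: int_fps_def fps_of_int[symmetric])
lemma int_fps_X: "int_fps X" by (simp add: int_fps_def fps_X_def)
lemma int_fps_power: "int_fps f \<Longrightarrow> int_fps (f ^ n)" by (induction n) (simp_all add: int_fps_1 int_fps_mult)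
lemma int_fps_prod: "(\<And>i. i \<in> A \<Longrightarrow> int_fps (f i)) \<Longrightarrow> int_fps (prod f A)"
  by (induction A rule: infinite_finite_induct) (simp_all add: int_fps_1 int_fps_mult)

lemma int_fps_inverse:
  assumes "int_fps f" "f $ 0 = 1"
  shows "int_fps (inverse f)"
  unfolding int_fps_def
proof
  fix n show "inverse f $ n \<in> \<int>"
  proof (induction n rule: less_induct)
    case (less n)
    have "(f * inverse f) $ n = (1 :: complex fps) $ n" using assms(2) by (simp add: inverse_mult_eq_1')
    then have "inverse f $ n = (1 :: complex fps) $ n - (\<Sum>i=Suc 0..n. f $ i * inverse f $ (n - i))"
    proof -
      have "(f * inverse f) $ n = f $ 0 * inverse f $ (n - 0) + (\<Sum>i=Suc 0..n. f $ i * inverse f $ (n - i))"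
        unfolding fps_mult_nth by (rule sum.atLeast_Suc_atMost) simp
      with \<open>(f * inverse f) $ n = 1 $ n\<close> assms(2) show ?thesis unfolding eq_diff_eq by simp
    qed
    also have "\<dots> \<in> \<int>"
      using assms(1) less by (intro Ints_diff Ints_sum Ints_mult) (auto simp: int_fps_def)
    finally show ?case .
  qed
qed

lemma int_fps_limit:
  assumes "F \<longlonglongrightarrow> f" "\<And>N. int_fps (F N)"
  shows "int_fps f"
  unfolding int_fps_def
proof
  fix n
  have "\<forall>\<^sub>F N in sequentially. F N $ n = f $ n" using assms(1) by (simp add: tendsto_fps_iff)
  then obtain N where "F N $ n = f $ n" by (auto simp: eventually_sequentially)
  with assms(2)[of N] show "f $ n \<in> \<int>" by (metis int_fps_def)
qed

lemma int_fps_E: "j > 0 \<Longrightarrow> int_fps (E j)"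
  by (rule int_fps_limit[OF euler_E_tendsto])
    (auto intro!: int_fps_prod int_fps_diff int_fps_1 int_fps_power int_fps_X)

lemma int_fps_I: "j > 0 \<Longrightarrow> int_fps (inverse (E j))"
  by (simp add: int_fps_inverse int_fps_E euler_E_nth_0)

lemmas int_fps_intros = int_fps_add int_fps_diff int_fps_uminus int_fps_mult int_fps_1 int_fps_0 int_fps_numeral int_fps_of_int
  int_fps_X int_fps_power int_fps_E int_fps_I

definition fcong :: "int \<Rightarrow> complex fps \<Rightarrow> complex fps \<Rightarrow> bool" where
  "fcong m f g \<longleftrightarrow> (\<exists>h. int_fps h \<and> f = g + of_int m * h)"

lemma fcongI: "int_fps h \<Longrightarrow> f = g + of_int m * h \<Longrightarrow> fcong m f g" by (auto simp: fcong_def)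

lemma fcong_refl: "fcong m f f" by (rule fcongI[of 0]) (simp_all add: int_fps_0)

lemma fcong_trans: "fcong m f g \<Longrightarrow> fcong m g h \<Longrightarrow> fcong m f h"
  unfolding fcong_def by (metis add.assoc distrib_left int_fps_add)

lemma fcong_sym: "fcong m f g \<Longrightarrow> fcong m g f"
proof -
  assume "fcong m f g"
  then obtain h where "int_fps h" "f = g + of_int m * h" by (auto simp: fcong_def)
  then show ?thesis by (intro fcongI[of "- h"] int_fps_uminus) simp_all
qed

lemma fcong_add:
  assumes "fcong m f g" "fcong m f' g'" shows "fcong m (f + f') (g + g')"
proof -
  from assms obtain h h' where h: "int_fps h" "int_fps h'" "f = g + of_int m * h" "f' = g' + of_int m * h'"
    by (auto simp: fcong_def)
  then show ?thesis by (intro fcongI[of "h + h'"] int_fps_add) (simp_all add: algebra_simps)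
qed

lemma fcong_mult_left:
  assumes "int_fps k" "fcong m f g" shows "fcong m (k * f) (k * g)"
proof -
  from assms obtain h where h: "int_fps h" "f = g + of_int m * h" by (auto simp: fcong_def)
  with assms(1) show ?thesis by (intro fcongI[of "k * h"] int_fps_mult) (simp_all add: algebra_simps)
qed

lemma fcong_mult:
  assumes "fcong m f g" "fcong m f' g'" "int_fps g" "int_fps f'"
  shows "fcong m (f * f') (g * g')"
  using fcong_trans[OF fcong_mult_left[OF assms(4,1)] fcong_mult_left[OF assms(3,2), unfolded mult.commute[of _ f']]]
  by (simp add: mult.commute)

lemma fcong_scale:
  assumes "fcong m f g" shows "fcong (k * m) (of_int k * f) (of_int k * g)"
proof -
  from assms obtain h where "int_fps h" "f = g + of_int m * h" by (auto simp: fcong_def)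
  then show ?thesis by (intro fcongI[of h]) (simp_all add: algebra_simps)
qed

lemma fcong_weaken:
  assumes "fcong (m * k) f g" shows "fcong m f g"
proof -
  from assms obtain h where "int_fps h" "f = g + of_int (m * k) * h" by (auto simp: fcong_def)
  then show ?thesis by (intro fcongI[of "of_int k * h"]) (simp_all add: int_fps_intros algebra_simps)
qed

lemma sect_add: "sect m r (f + g) = sect m r f + sect m r (g :: complex fps)" by (rule fps_ext) simp
lemma sect_int_mult: "sect m r (of_int k * f) = of_int k * sect m r (f :: complex fps)"
  by (rule fps_ext) (simp add: fps_of_int[symmetric])

lemma sect_numeral_mult: "sect m r (numeral k * f) = numeral k * sect m r (f :: complex fps)"
  using sect_int_mult[of m r "numeral k" f] by simp

lemma fcong_sect:
  assumes "fcong m f g" shows "fcong m (sect d r f) (sect d r g)"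
proof -
  from assms obtain h where "int_fps h" "f = g + of_int m * h" by (auto simp: fcong_def)
  then show ?thesis by (intro fcongI[of "sect d r h"]) (simp_all add: sect_add sect_int_mult int_fps_def)
qed

lemma fcong_nth:
  assumes "fcong m f 0" shows "\<exists>c. f $ n = of_int (m * c)"
proof -
  from assms obtain h where h: "int_fps h" "f = of_int m * h" by (auto simp: fcong_def)
  then obtain c where "h $ n = of_int c" by (auto simp: int_fps_def Ints_def)
  with h show ?thesis by (intro exI[of _ c]) (simp add: fps_of_int[symmetric])
qed

lemma fcong_limit:
  assumes F: "F \<longlonglongrightarrow> f" and G: "G \<longlonglongrightarrow> g" and c: "\<And>N. fcong m (F N) (G N)"
  shows "fcong m f g"
proof -
  have "\<exists>c. f $ n - g $ n = of_int m * of_int c" for n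
  proof -
    have "\<forall>\<^sub>F N in sequentially. F N $ n = f $ n \<and> G N $ n = g $ n"
      using F G unfolding tendsto_fps_iff by (auto intro: eventually_conj)
    then obtain N where N: "F N $ n = f $ n" "G N $ n = g $ n" by (auto simp: eventually_sequentially)
    from c[of N] obtain h where h: "int_fps h" "F N = G N + of_int m * h" by (auto simp: fcong_def)
    then obtain c where "h $ n = of_int c" by (auto simp: int_fps_def Ints_def)
    then have "F N $ n = G N $ n + of_int m * of_int c" using h(2) by (simp add: fps_of_int[symmetric])
    then have "F N $ n - G N $ n = of_int m * of_int c" by simp
    with N show ?thesis by auto
  qed
  then obtain c where c: "\<And>n. f $ n - g $ n = of_int m * of_int (c n)" by metis
  show ?thesis
  proof (rule fcongI[of "Abs_fps (\<lambda>n. of_int (c n))"])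
    show "f = g + of_int m * Abs_fps (\<lambda>n. of_int (c n))"
      using c by (intro fps_ext) (simp add: fps_of_int[symmetric] algebra_simps)
  qed (simp add: int_fps_def)
qed

lemma fcong_prod:
  assumes "\<And>i. i \<in> A \<Longrightarrow> fcong m (f i) (g i)" "\<And>i. i \<in> A \<Longrightarrow> int_fps (f i)" "\<And>i. i \<in> A \<Longrightarrow> int_fps (g i)"
  shows "fcong m (prod f A) (prod g A)"
  using assms by (induction A rule: infinite_finite_induct) (auto intro!: fcong_refl fcong_mult int_fps_prod)

text \<open>The congruence (1 - t)^5 = 1 - t^5 modulo 5 is applied to each factor.\<close>

theorem E1_frobenius: "fcong 5 (E 1 ^ 5) (E 5)"
proof (rule fcong_limit)
  have "(\<lambda>N. \<Prod>i<(5::nat). \<Prod>k<N. 1 - X ^ (1 * k + 1)) \<longlonglongrightarrow> (\<Prod>i<(5::nat). E 1)"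
    by (intro fps_tendsto_prod euler_E_tendsto) simp
  then show "(\<lambda>N. (\<Prod>k<N. 1 - X ^ (1 * k + 1)) ^ 5) \<longlonglongrightarrow> E 1 ^ 5" by simp
  show "(\<lambda>N. \<Prod>k<N. 1 - X ^ (5 * k + 5)) \<longlonglongrightarrow> E 5" by (rule euler_E_tendsto) simp
  have binomial: "fcong 5 ((1 - X ^ j) ^ 5) (1 - X ^ (5 * j))" for j
  proof (rule fcongI)
    show "(1 - X ^ j) ^ 5 = 1 - X ^ (5 * j) + of_int 5 * (- (X ^ j) + 2 * (X ^ j) ^ 2 - 2 * (X ^ j) ^ 3 + (X ^ j) ^ 4)"
      unfolding mult.commute[of 5 j] power_mult of_int_numeral by algebra
  qed (intro int_fps_intros)
  show "fcong 5 ((\<Prod>k<N. 1 - X ^ (1 * k + 1)) ^ 5) (\<Prod>k<N. 1 - X ^ (5 * k + 5))" for N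
    unfolding prod_power_distrib
  proof (rule fcong_prod)
    fix i
    show "fcong 5 ((1 - X ^ (1 * i + 1)) ^ 5) (1 - X ^ (5 * i + 5))"
      using binomial[of "i + 1"] by (simp add: algebra_simps)
  qed (intro int_fps_intros)+
qed

lemma frobenius_quotient: "fcong 5 (E 5 * I 1 ^ 5) 1"
proof -
  from E1_frobenius obtain h where h: "int_fps h" "E 1 ^ 5 = E 5 + 5 * h" by (auto simp: fcong_def)
  have "E 5 * I 1 ^ 5 = (E 1 * I 1) ^ 5 + 5 * (- h * I 1 ^ 5)" using h(2) by algebra
  then show ?thesis unfolding EI using h(1)
    by (intro fcongI[of "- h * I 1 ^ 5"]) (auto intro!: int_fps_intros)
qed

text \<open>The leading part of the second section: modulo 5 nothing else remains.\<close>

definition residual :: "complex fps" where "residual = E 5 ^ 3 * I 10 * I 1"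

lemma sect_residual: "sect 5 4 residual = 5 * (E 5 ^ 5 * I 1 ^ 3 * I 2)"
proof -
  have b: "residual = D (E 1 ^ 3 * I 2) * I 1"
    unfolding residual_def by (simp add: dilate_simps dilate_euler_E euler_E_nth_0)
  have "sect 5 4 residual = E 1 ^ 3 * I 2 * sect 5 4 (I 1)" unfolding b sect_D_mult ..
  also have "\<dots> = E 1 ^ 3 * I 2 * sect 5 4 (I 1) * (E 1 * I 1) ^ 6" unfolding EI by simp
  also have "\<dots> = E 1 ^ 3 * I 2 * (sect 5 4 (I 1) * E 1 ^ 6) * I 1 ^ 6" by algebra
  also have "\<dots> = 5 * (E 5 ^ 5 * I 1 ^ 3 * I 2) * (E 1 * I 1) ^ 3" unfolding ramanujan_partition by algebra
  finally show ?thesis unfolding EI by simp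
qed

lemma int_fps_xyz: "int_fps x_ser" "int_fps y_ser" "int_fps z_ser" "int_fps residual" "int_fps M1"
  unfolding x_ser_def y_ser_def z_ser_def residual_def M1_def by (auto intro!: int_fps_intros)

text \<open>The prefactor of the polynomial in x is this leading part times z, and z = 1 + 5 x.\<close>

lemma second_section_exact:
  "sect 5 0 M1 = residual * (1 + 5 * x_ser) * (1 + 160 * (x_ser * (1 + 5 * x_ser)) + 2000 * (x_ser * y_ser) ^ 2)"
proof -
  have "E 2 ^ 5 * E 5 ^ 4 * I 1 ^ 6 * I 10 ^ 2 = residual * z_ser" unfolding residual_def z_ser_def by algebra
  then show ?thesis unfolding second_section level_10_relations(2) by simp
qed

text \<open>The coefficient of x is 5 + 160 = 15 modulo 25 and all higher coefficients vanish. Because of the factor 15,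
the eta quotient x times the leading part matters only modulo 5.\<close>

lemma second_section_mod_25: "fcong 25 (sect 5 0 M1) (residual + 15 * (X * (E 1 * E 2) * E 10 ^ 2 * E 5))"
proof (rule fcong_trans)
  let ?h = "residual * (6 * x_ser + 32 * x_ser ^ 2 + 32 * x_ser ^ 2 * (1 + 5 * x_ser) + 80 * (x_ser * y_ser) ^ 2 * (1 + 5 * x_ser))"
  show "fcong 25 (sect 5 0 M1) (residual + 15 * (x_ser * residual))"
  proof (rule fcongI)
    show "sect 5 0 M1 = residual + 15 * (x_ser * residual) + of_int 25 * ?h"
      unfolding second_section_exact of_int_numeral by algebra
  qed (intro int_fps_intros int_fps_xyz)
  have xb: "x_ser * residual = X * (E 1 * E 2) * E 10 ^ 2 * E 5 * (E 5 * I 1 ^ 5)"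
  proof -
    have "x_ser * residual = (X * E 2 * E 10 ^ 2 * E 5 ^ 2 * I 1 ^ 4) * ((E 10 * I 10) * (E 5 * I 5))"
      unfolding x_ser_def residual_def by algebra
    also have "\<dots> = (X * E 2 * E 10 ^ 2 * E 5 ^ 2 * I 1 ^ 4) * (E 1 * I 1)" unfolding EI by simp
    finally show ?thesis by algebra
  qed
  have "fcong 5 (x_ser * residual) (X * (E 1 * E 2) * E 10 ^ 2 * E 5 * 1)"
    unfolding xb by (intro fcong_mult_left frobenius_quotient int_fps_intros) simp_all
  then have "fcong (25 * 3) (of_int 15 * (x_ser * residual)) (of_int 15 * (X * (E 1 * E 2) * E 10 ^ 2 * E 5 * 1))"
    using fcong_scale[of 5 _ _ 15] by simp
  then show "fcong 25 (residual + 15 * (x_ser * residual)) (residual + 15 * (X * (E 1 * E 2) * E 10 ^ 2 * E 5))"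
    by (intro fcong_add fcong_refl) (drule fcong_weaken, simp)
qed

lemma second_section_mod_5: "fcong 5 (sect 5 0 M1) residual"
proof (rule fcongI)
  show "sect 5 0 M1 = residual + of_int 5 * (residual * (33 * x_ser + 160 * x_ser ^ 2 + 160 * x_ser ^ 2 * (1 + 5 * x_ser) + 400 * (x_ser * y_ser) ^ 2 * (1 + 5 * x_ser)))"
    unfolding second_section_exact of_int_numeral by algebra
qed (intro int_fps_intros int_fps_xyz)

lemma sect_X_mult: "sect 5 4 (X * f) = sect 5 3 (f :: complex fps)"
  by (rule fps_ext) (simp add: add.commute)

text \<open>The section of the leading part carries a factor 5 by Ramanujan's identity, so both summands may be simplified
modulo 5. The aim is to reach phi(-q) and the first section, whose next sections are known.\<close>

lemma third_section: "fcong 25 (sect 5 4 (sect 5 0 M1)) (5 * (E 5 ^ 4 * phi + 3 * M1))"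
proof (rule fcong_trans)
  let ?G = "residual + 15 * (X * (E 1 * E 2) * E 10 ^ 2 * E 5)"
  have b: "X * (E 1 * E 2) * E 10 ^ 2 * E 5 = D (E 2 ^ 2 * E 1) * (X * (E 1 * E 2))"
    by (simp add: dilate_simps dilate_euler_E mult_ac)
  have "sect 5 4 (X * (E 1 * E 2) * E 10 ^ 2 * E 5) = E 2 ^ 2 * E 1 * (E 5 * E 10)"
    unfolding b sect_D_mult sect_X_mult sect_E1_E2 ..
  then have "sect 5 4 ?G = 5 * (E 5 ^ 5 * I 1 ^ 3 * I 2 + 3 * (E 1 * E 2 ^ 2 * E 5 * E 10))"
    unfolding sect_add sect_residual sect_numeral_mult by algebra
  with fcong_sect[OF second_section_mod_25]
  show "fcong 25 (sect 5 4 (sect 5 0 M1)) (5 * (E 5 ^ 5 * I 1 ^ 3 * I 2 + 3 * (E 1 * E 2 ^ 2 * E 5 * E 10)))"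
    by metis
  have phi: "phi = E 1 ^ 2 * I 2" using phi_E2 EI(2) by algebra
  have 1: "fcong 5 (E 5 ^ 5 * I 1 ^ 3 * I 2) (E 5 ^ 4 * phi)"
  proof -
    have "E 5 ^ 5 * I 1 ^ 3 * I 2 = E 5 ^ 5 * I 1 ^ 3 * I 2 * (E 1 * I 1) ^ 2" unfolding EI by simp
    also have "\<dots> = E 5 ^ 4 * phi * (E 5 * I 1 ^ 5)" unfolding phi by algebra
    also have "fcong 5 \<dots> (E 5 ^ 4 * phi * 1)" unfolding phi
      by (intro fcong_mult_left frobenius_quotient int_fps_intros) simp_all
    finally show ?thesis by simp
  qed
  have 2: "fcong 5 (E 1 * E 2 ^ 2 * E 5 * E 10) M1"
  proof -
    from frobenius_quotient obtain h where h: "int_fps h" "E 5 * I 1 ^ 5 = 1 + 5 * h" by (auto simp: fcong_def)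
    have "M1 = M1 * (E 1 * I 1)" unfolding EI by simp
    also have "\<dots> = E 1 * E 2 ^ 2 * E 5 * E 10 * (E 5 * I 1 ^ 5)" unfolding M1_def by algebra
    also have "\<dots> = E 1 * E 2 ^ 2 * E 5 * E 10 + 5 * (E 1 * E 2 ^ 2 * E 5 * E 10 * h)" unfolding h by algebra
    finally have "M1 = E 1 * E 2 ^ 2 * E 5 * E 10 + of_int 5 * (E 1 * E 2 ^ 2 * E 5 * E 10 * h)" by simp
    then have "fcong 5 M1 (E 1 * E 2 ^ 2 * E 5 * E 10)"
      by (rule fcongI[rotated]) (use h in \<open>auto intro!: int_fps_intros\<close>)
    then show ?thesis by (rule fcong_sym)
  qed
  have "fcong 5 (E 5 ^ 5 * I 1 ^ 3 * I 2 + 3 * (E 1 * E 2 ^ 2 * E 5 * E 10)) (E 5 ^ 4 * phi + 3 * M1)"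
    by (intro fcong_add 1 fcong_mult_left 2 int_fps_intros)
  from fcong_scale[OF this, of 5]
  show "fcong 25 (5 * (E 5 ^ 5 * I 1 ^ 3 * I 2 + 3 * (E 1 * E 2 ^ 2 * E 5 * E 10))) (5 * (E 5 ^ 4 * phi + 3 * M1))"
    by simp
qed

text \<open>Modulo 5 both summands have become multiples of the leading part, with coefficients 1 and 3.\<close>

lemma fourth_section: "fcong 25 (sect 5 0 (sect 5 4 (sect 5 0 M1))) (20 * residual)"
proof (rule fcong_trans)
  have "sect 5 0 (E 5 ^ 4 * phi) = E 1 ^ 4 * phi5"
  proof -
    have b: "E 5 ^ 4 = D (E 1 ^ 4)" by (simp add: dilate_simps dilate_euler_E)
    show ?thesis unfolding b sect_D_mult sect_square(1)[folded phi_def] phi5_def ..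
  qed
  then have "sect 5 0 (5 * (E 5 ^ 4 * phi + 3 * M1)) = 5 * (E 1 ^ 4 * phi5 + 3 * sect 5 0 M1)"
    unfolding sect_numeral_mult sect_add by simp
  with fcong_sect[OF third_section, of 5 0]
  show "fcong 25 (sect 5 0 (sect 5 4 (sect 5 0 M1))) (5 * (E 1 ^ 4 * phi5 + 3 * sect 5 0 M1))" by simp
  have phi5: "phi5 = E 5 ^ 2 * I 10" using phi5_E10 EI(4) by algebra
  have 1: "fcong 5 (E 1 ^ 4 * phi5) residual"
  proof -
    from frobenius_quotient obtain h where h: "int_fps h" "E 5 * I 1 ^ 5 = 1 + 5 * h" by (auto simp: fcong_def)
    have "residual = residual * (E 1 * I 1) ^ 4" unfolding EI by simp
    also have "\<dots> = E 1 ^ 4 * phi5 * (E 5 * I 1 ^ 5)" unfolding residual_def phi5 by algebra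
    also have "\<dots> = E 1 ^ 4 * phi5 + 5 * (E 1 ^ 4 * phi5 * h)" unfolding h by algebra
    finally have "residual = E 1 ^ 4 * phi5 + of_int 5 * (E 1 ^ 4 * phi5 * h)" by simp
    then have "fcong 5 residual (E 1 ^ 4 * phi5)"
      unfolding phi5 by (rule fcongI[rotated]) (use h in \<open>auto intro!: int_fps_intros\<close>)
    then show ?thesis by (rule fcong_sym)
  qed
  have "fcong 5 (E 1 ^ 4 * phi5 + 3 * sect 5 0 M1) (residual + 3 * residual)"
    by (intro fcong_add 1 fcong_mult_left second_section_mod_5 int_fps_intros)
  from fcong_scale[OF this, of 5]
  show "fcong 25 (5 * (E 1 ^ 4 * phi5 + 3 * sect 5 0 M1)) (20 * residual)" by (simp add: algebra_simps)
qed

text \<open>Here 20 and the factor 5 from Ramanujan's identity combine to a multiple of 25.\<close>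

theorem fifth_section: "fcong 25 (sect 5 4 (sect 5 0 (sect 5 4 (sect 5 0 M1)))) 0"
proof (rule fcong_trans)
  have "sect 5 4 (20 * residual) = 0 + of_int 25 * (4 * (E 5 ^ 5 * I 1 ^ 3 * I 2))"
    using sect_int_mult[of 5 4 20] by (simp add: sect_residual)
  then show "fcong 25 (sect 5 4 (20 * residual)) 0"
    by (rule fcongI[rotated]) (auto intro!: int_fps_intros)
  show "fcong 25 (sect 5 4 (sect 5 0 (sect 5 4 (sect 5 0 M1)))) (sect 5 4 (20 * residual))"
    by (rule fcong_sect[OF fourth_section])
qed

section \<open>The even part of the one-shell series\<close>

lemma qfac_unit: "qfac (X ^ Suc m) n \<noteq> 0" "qfac (X ^ Suc m) n $ 0 = 1"
proof -
  show "qfac (X ^ Suc m) n $ 0 = 1" by (induction n) (simp_all add: qfac_Suc)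
  then show "qfac (X ^ Suc m) n \<noteq> 0" by force
qed

lemma qbin_pascal':
  assumes "k \<le> n"
  shows "qbin X (Suc n) (Suc k) = X ^ (n - k) * qbin X n k + qbin X n (Suc k)"
proof (cases "k = n")
  case True
  then show ?thesis by (simp add: qbin_eq_0)
next
  case False
  then have k: "Suc k \<le> n" using assms by auto
  then have n: "n - k = Suc (n - Suc k)" by auto
  let ?f = "qfac X :: nat \<Rightarrow> complex fps"
  have 1: "qbin X n k * ?f k * ?f (n - k) = ?f n" using k by (intro qbin_qfac) simp
  have 2: "qbin X n (Suc k) * ?f (Suc k) * ?f (n - Suc k) = ?f n" by (rule qbin_qfac[OF k])
  have 3: "qbin X (Suc n) (Suc k) * ?f (Suc k) * ?f (n - k) = ?f n * (1 - X ^ Suc n)"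
    using qbin_qfac[of "Suc k" "Suc n" X] assms by (simp add: qfac_Suc)
  have p: "X ^ (n - k) * X ^ Suc k = X ^ Suc n" unfolding power_add[symmetric] using assms by simp
  have "(X ^ (n - k) * qbin X n k + qbin X n (Suc k)) * ?f (Suc k) * ?f (n - k) = 
    X ^ (n - k) * (1 - X ^ Suc k) * (qbin X n k * ?f k * ?f (n - k)) +
    (qbin X n (Suc k) * ?f (Suc k) * ?f (n - Suc k)) * (1 - X ^ (n - k))"
    unfolding qfac_Suc[of _ k] n qfac_Suc[of _ "n - Suc k"] by algebra
  also have "\<dots> = ?f n * (1 - X ^ (n - k) * X ^ Suc k)" unfolding 1 2 by algebra
  also have "\<dots> = qbin X (Suc n) (Suc k) * ?f (Suc k) * ?f (n - k)" unfolding p 3 ..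
  finally show ?thesis using qfac_unit(1)[of 0] by simp
qed

lemma qbin_absorb:
  assumes "k \<le> n"
  shows "(1 - X ^ (Suc n - k)) * qbin X (Suc n) k = (1 - X ^ Suc n) * (qbin X n k :: complex fps)"
proof -
  let ?f = "qfac X :: nat \<Rightarrow> complex fps"
  have n: "Suc n - k = Suc (n - k)" using assms by auto
  have 1: "qbin X n k * ?f k * ?f (n - k) = ?f n" by (rule qbin_qfac[OF assms])
  have 2: "qbin X (Suc n) k * ?f k * (?f (n - k) * (1 - X ^ Suc (n - k))) = ?f n * (1 - X ^ Suc n)"
    using qbin_qfac[of k "Suc n" X] assms unfolding n by (simp add: qfac_Suc)
  have "((1 - X ^ (Suc n - k)) * qbin X (Suc n) k) * (?f k * ?f (n - k)) = 
    qbin X (Suc n) k * ?f k * (?f (n - k) * (1 - X ^ Suc (n - k)))" unfolding n by (simp only: mult_ac)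
  also have "\<dots> = (qbin X n k * ?f k * ?f (n - k)) * (1 - X ^ Suc n)" unfolding 2 1 ..
  also have "\<dots> = ((1 - X ^ Suc n) * qbin X n k) * (?f k * ?f (n - k))" by (simp only: mult_ac)
  finally have "((1 - X ^ (Suc n - k)) * qbin X (Suc n) k) * (?f k * ?f (n - k)) = ((1 - X ^ Suc n) * qbin X n k) * (?f k * ?f (n - k))" .
  then show ?thesis using qfac_unit(1)[of 0] by simp
qed

text \<open>The truncated column sum A_r = sum_j q^(j(j+1)/2) [j + r, j], and the boundary term left by its telescoping.\<close>

definition column_sum :: "nat \<Rightarrow> nat \<Rightarrow> complex fps" where
  "column_sum N r = (\<Sum>j<N. X ^ (Suc j choose 2) * qbin X (j + r) j)"

definition column_rest :: "nat \<Rightarrow> nat \<Rightarrow> complex fps" where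
  "column_rest N s = (if N = 0 then 0 else X ^ ((Suc N choose 2) + s + 1) * qbin X (N + s) (N - 1))"

lemma choose_2_Suc: "Suc j choose 2 = j + (j choose 2)" by (simp add: numeral_2_eq_2)

text \<open>By [n+1, k] (1 - q^(n+1-k)) = (1 - q^(n+1)) [n, k] the left side is a difference of terms with [j + s + 1, j]; Pascal's rule
splits one of them into the term for s and a boundary term.\<close>

lemma column_term:
  "(1 - X ^ (s + 2)) * (X ^ (Suc j choose 2) * qbin X (j + (s + 2)) j) = 
    X ^ (Suc j choose 2) * qbin X (j + s) j + column_rest j s - column_rest (Suc j) s"
proof -
  have e: "Suc (j + s + 1) - j = s + 2" by simp
  have 1: "(1 - X ^ (s + 2)) * qbin X (j + (s + 2)) j = (1 - X ^ (j + s + 2)) * (qbin X (j + s + 1) j :: complex fps)"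
    using qbin_absorb[of j "j + s + 1"] unfolding e by (simp add: numeral_2_eq_2)
  have 2: "X ^ (Suc j choose 2) * (qbin X (j + s + 1) j :: complex fps) = X ^ (Suc j choose 2) * qbin X (j + s) j + column_rest j s"
  proof (cases j)
    case (Suc i)
    have "qbin X (j + s + 1) j = X ^ (s + 1) * qbin X (j + s) i + (qbin X (j + s) j :: complex fps)"
      using qbin_pascal'[of i "i + s + 1"] Suc by (simp add: add.commute)
    then show ?thesis using Suc by (simp add: column_rest_def power_add algebra_simps)
  qed (simp add: column_rest_def)
  have 3: "X ^ (Suc j choose 2) * X ^ (j + s + 2) * qbin X (j + s + 1) j = column_rest (Suc j) s"
    by (simp add: column_rest_def choose_2_Suc[of "Suc j"] power_add[symmetric] add.commute add.left_commute)
  have "(1 - X ^ (s + 2)) * (X ^ (Suc j choose 2) * qbin X (j + (s + 2)) j) = 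
    X ^ (Suc j choose 2) * ((1 - X ^ (s + 2)) * qbin X (j + (s + 2)) j)" by (simp only: mult_ac)
  also have "\<dots> = X ^ (Suc j choose 2) * qbin X (j + s + 1) j - X ^ (Suc j choose 2) * X ^ (j + s + 2) * qbin X (j + s + 1) j"
    unfolding 1 by algebra
  finally show ?thesis unfolding 2 3 .
qed

lemma column_sum_step: "(1 - X ^ (s + 2)) * column_sum N (s + 2) = column_sum N s - column_rest N s"
proof (induction N)
  case 0
  then show ?case by (simp add: column_sum_def column_rest_def)
next
  case (Suc N)
  have "(1 - X ^ (s + 2)) * column_sum (Suc N) (s + 2) = (1 - X ^ (s + 2)) * column_sum N (s + 2)
     + (1 - X ^ (s + 2)) * (X ^ (Suc N choose 2) * qbin X (N + (s + 2)) N)"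
    by (simp only: column_sum_def sum.lessThan_Suc distrib_left)
  also have "\<dots> = column_sum (Suc N) s - column_rest (Suc N) s"
    unfolding Suc.IH column_term by (simp add: column_sum_def)
  finally show ?case .
qed

text \<open>The map sending j to -1 - j pairs the indices of the bilateral sum.\<close>

lemma psi_triangular: "n < N \<Longrightarrow> psi $ n = (\<Sum>j<N. X ^ (Suc j choose 2)) $ n"
proof -
  assume n: "n < N"
  have ch: "2 * (Suc j choose 2) = Suc j * j" for j
  proof -
    have "even (Suc j * j)" by simp
    then show ?thesis by (simp add: choose_two)
  qed
  have ge: "j \<le> (Suc j choose 2)" for j by (simp add: choose_2_Suc)
  let ?A = "{j. (Suc j choose 2) = n}"
  have fin: "finite ?A" by (rule finite_subset[of _ "{..n}"]) (use ge in auto)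
  have tex: "texp 1 0 i = n \<longleftrightarrow> (\<exists>j\<in>?A. i = int j \<or> i = - 1 - int j)" for i
  proof
    assume "texp 1 0 i = n"
    then have i: "i * (i + 1) = 2 * int n" unfolding texp_eq_iff by simp
    show "\<exists>j\<in>?A. i = int j \<or> i = - 1 - int j"
    proof (cases "i \<ge> 0")
      case True
      then obtain j where j: "i = int j" using nonneg_int_cases by blast
      have "int (2 * (Suc j choose 2)) = int (2 * n)" using i unfolding ch j by (simp add: algebra_simps)
      then show ?thesis using j by (intro bexI[of _ j]) auto
    next
      case False
      then have "i = - 1 - int (nat (- 1 - i))" by simp
      then obtain j where "i = - 1 - int j" by blast
      have "int (2 * (Suc j choose 2)) = int (2 * n)" using i unfolding ch \<open>i = - 1 - int j\<close> by (simp add: algebra_simps)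
      then show ?thesis using \<open>i = - 1 - int j\<close> by (intro bexI[of _ j]) auto
    qed
  next
    assume "\<exists>j\<in>?A. i = int j \<or> i = - 1 - int j"
    then obtain j where j: "(Suc j choose 2) = n" "i = int j \<or> i = - 1 - int j" by auto
    have "Suc j * j = 2 * n" using ch[of j] unfolding j(1) by (rule sym)
    then have "int (Suc j * j) = int (2 * n)" by (simp only:)
    moreover have "i * (i + 1) = int (Suc j * j)"
      using j(2)
    proof
      assume "i = - 1 - int j"
      then show ?thesis by (simp only:) (simp add: algebra_simps)
    qed (simp add: algebra_simps)
    ultimately show "texp 1 0 i = n" unfolding texp_eq_iff by simp
  qed
  have "(2 * psi) $ n = of_nat (card {i. texp 1 0 i = n})"
    unfolding theta_psi[symmetric] by (simp add: theta_nth)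
  also have "{i. texp 1 0 i = n} = int ` ?A \<union> (\<lambda>j. - 1 - int j) ` ?A" using tex by auto
  also have "card \<dots> = card (int ` ?A) + card ((\<lambda>j. - 1 - int j) ` ?A)"
    using fin by (intro card_Un_disjoint) auto
  also have "\<dots> = 2 * card ?A"
    by (subst (1 2) card_image) (auto simp: inj_on_def)
  finally have "psi $ n = of_nat (card ?A)" by (simp add: numeral_fps_const)
  also have "\<dots> = (\<Sum>j<N. X ^ (Suc j choose 2)) $ n"
  proof -
    have "(\<Sum>j<N. X ^ (Suc j choose 2)) $ n = (\<Sum>j<N. if (Suc j choose 2) = n then 1 else (0 :: complex))"
      unfolding fps_sum_nth by (intro sum.cong) (auto simp: fps_X_power_nth)
    also have "\<dots> = (\<Sum>j | j < N \<and> (Suc j choose 2) = n. 1)"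
      by (subst sum.inter_filter[symmetric]) (auto intro!: sum.cong)
    also have "{j. j < N \<and> (Suc j choose 2) = n} = ?A" using ge n by (auto intro: le_less_trans)
    finally show ?thesis by simp
  qed
  finally show ?thesis .
qed

text \<open>By telescoping, A_(2l) = psi / (q^2; q^2)_l. The boundary terms have order at least the truncation index.\<close>

lemma column_sum_agree: "agree N (column_sum N (2 * l) * qfac (X ^ 2) l) psi"
proof (induction l)
  case 0
  then show ?case by (auto simp: agree_def column_sum_def psi_triangular qbin_diag)
next
  case (Suc l)
  have rest: "agree N (column_rest N (2 * l)) 0"
    unfolding agree_def column_rest_def by (auto simp: choose_2_Suc power_add mult.assoc fps_X_power_mult_nth)
  have e: "2 * Suc l = 2 * l + 2" by simp
  have "column_sum N (2 * Suc l) * qfac (X ^ 2) (Suc l) = ((1 - X ^ (2 * l + 2)) * column_sum N (2 * l + 2)) * qfac (X ^ 2) l"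
    unfolding qfac_Suc power_mult[symmetric] e by (simp only: mult_ac)
  also have "\<dots> = (column_sum N (2 * l) * qfac (X ^ 2) l) - column_rest N (2 * l) * qfac (X ^ 2) l"
    unfolding column_sum_step by algebra
  also have "agree N \<dots> psi"
    using Suc.IH agree_mult[OF rest agree_refl[of N "qfac (X ^ 2) l"]] by (simp add: agree_def)
  finally show ?case .
qed

lemma qbin_dilate: "qbin (X ^ 2) n k = dilate 2 (qbin X n k)"
  by (induction X n k rule: qbin.induct) (simp_all add: dilate_simps power_mult[symmetric] mult.commute)

definition inv_qfac :: "nat \<Rightarrow> complex fps" where "inv_qfac l = inverse (qfac (X ^ 2) l)"

lemma inv_qfac_mult: "inv_qfac l * qfac (X ^ 2) l = 1" 
  unfolding inv_qfac_def using qfac_unit(2)[of 1 l] by (intro inverse_mult_eq_1) (simp add: numeral_2_eq_2)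

lemma inv_qfac_Suc: "inv_qfac l = (1 - X ^ (2 * Suc l)) * inv_qfac (Suc l)"
proof -
  have "inv_qfac l * (inv_qfac (Suc l) * qfac (X ^ 2) (Suc l)) = (inv_qfac l * qfac (X ^ 2) l) * ((1 - X ^ (2 * Suc l)) * inv_qfac (Suc l))"
    unfolding qfac_Suc power_mult by (simp only: mult_ac)
  then show ?thesis unfolding inv_qfac_mult by simp
qed

text \<open>Put F_i = sum_l q^((2i+1) l) / (q^2; q^2)_l. Then F_i - F_(i+1) = q^(2i+1) F_i up to the truncation error.\<close>

lemma euler_sum_step:
  "agree M ((1 - X ^ (2 * i + 1)) * (\<Sum>l<M. X ^ ((2 * i + 1) * l) * inv_qfac l)) (\<Sum>l<M. X ^ ((2 * Suc i + 1) * l) * inv_qfac l)"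
proof -
  let ?F = "\<lambda>N. \<Sum>l<N. X ^ ((2 * i + 1) * l) * inv_qfac l" and ?G = "\<lambda>N. \<Sum>l<N. X ^ ((2 * Suc i + 1) * l) * inv_qfac l"
  have e: "(1 - X ^ (2 * i + 1)) * ?F (Suc N) = ?G (Suc N) - X ^ ((2 * i + 1) * Suc N) * inv_qfac N" for N
  proof (induction N)
    case 0
    then show ?case by (simp add: algebra_simps)
  next
    case (Suc N)
    have p: "X ^ ((2 * Suc i + 1) * Suc N) = X ^ ((2 * i + 1) * Suc N) * X ^ (2 * Suc N)"
      "X ^ ((2 * i + 1) * Suc (Suc N)) = X ^ ((2 * i + 1) * Suc N) * X ^ (2 * i + 1)"
      unfolding power_add[symmetric] by (simp_all add: algebra_simps)
    have "(1 - X ^ (2 * i + 1)) * ?F (Suc (Suc N)) = (1 - X ^ (2 * i + 1)) * ?F (Suc N) 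
       + (1 - X ^ (2 * i + 1)) * (X ^ ((2 * i + 1) * Suc N) * inv_qfac (Suc N))"
      by (simp only: sum.lessThan_Suc distrib_left)
    also have "\<dots> = ?G (Suc N) + X ^ ((2 * i + 1) * Suc N) * X ^ (2 * Suc N) * inv_qfac (Suc N) - X ^ ((2 * i + 1) * Suc N) * X ^ (2 * i + 1) * inv_qfac (Suc N)"
      unfolding Suc.IH inv_qfac_Suc[of N] by algebra
    finally show ?case unfolding p[symmetric] by (simp only: sum.lessThan_Suc)
  qed
  show ?thesis
  proof (cases M)
    case (Suc N)
    have "M \<le> (2 * i + 1) * Suc N" using Suc by simp
    from agree_diff[OF agree_refl agree_X_power[OF this]] show ?thesis unfolding Suc e by simp
  qed (simp add: agree_def)
qed

text \<open>Euler's sum: iterating the step gives (q; q^2) F_0 = 1 for the infinite product, whose reciprocal is E_2 / E_1.\<close>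

lemma euler_sum: "agree M (\<Sum>l<M. X ^ l * inv_qfac l) (E 2 * I 1)"
proof -
  let ?F = "\<lambda>i. \<Sum>l<M. X ^ ((2 * i + 1) * l) * inv_qfac l" and ?P = "\<lambda>n. \<Prod>i<n. 1 - X ^ (2 * i + 1)"
  have P: "agree M (?P n * ?F 0) (?F n)" for n
  proof (induction n)
    case (Suc n)
    have "agree M (?P (Suc n) * ?F 0) ((1 - X ^ (2 * n + 1)) * ?F n)"
      using agree_mult[OF agree_refl[of M "1 - X ^ (2 * n + 1)"] Suc.IH] by (simp add: mult_ac)
    then show ?case using euler_sum_step agree_trans by blast
  qed (simp add: agree_refl)
  have F: "agree M (?F M) 1"
    unfolding agree_def
  proof (intro allI impI)
    fix i assume i: "i < M"
    have "?F M $ i = (\<Sum>l<M. if l = 0 then (1 :: complex fps) $ i else 0)"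
      unfolding fps_sum_nth
    proof (intro sum.cong refl)
      fix l
      show "(X ^ ((2 * M + 1) * l) * inv_qfac l) $ i = (if l = 0 then 1 $ i else 0)"
      proof (cases "l = 0")
        case False
        then have "M \<le> (2 * M + 1) * l" by (cases l) auto
        with False i agree_X_power[OF this, of "inv_qfac l"] show ?thesis by (simp add: agree_def)
      qed (simp add: inv_qfac_def)
    qed
    then show "?F M $ i = 1 $ i" using i by simp
  qed
  have Q: "agree M (?P M) (qpoch (-1) 1 2)"
    unfolding agree_def by (simp add: qpoch_nth[of 2 _ M])
  have "agree M (qpoch (-1) 1 2 * ?F 0) 1"
    using agree_trans[OF agree_sym[OF agree_mult[OF Q agree_refl]] agree_trans[OF P F]] .
  from agree_mult[OF this agree_refl[of M "E 2 * I 1"]]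
  have "agree M ((qpoch (-1) 1 2 * E 2) * I 1 * ?F 0) (E 2 * I 1)" by (simp add: mult_ac)
  moreover have q: "qpoch (-1) 1 2 * E 2 = E 1"
    using qpoch_split[of 1 2 "-1" 1] by (simp add: euler_E_eq eval_nat_numeral)
  ultimately show ?thesis unfolding q EI by simp
qed

text \<open>The double sum over n and j of q^(n + j^2) [n, j] (base q^2) has even exponents only for n = j + 2l.
After halving the exponents, n + j^2 becomes l + j (j + 1) / 2, and the sum over j is the column sum for r = 2l.\<close>

theorem even_part_of_one_shell_series:
  "(\<Sum>n\<le>2 * k. (\<Prod>i<n. 1 + X ^ (2 * i + 1)) $ (2 * k - n)) = (E 2 ^ 3 * I 1 ^ 2) $ k"
proof -
  define g where "g = (\<lambda>n j. (X ^ n * (X ^ (j ^ 2) * dilate 2 (qbin X n j))) $ (2 * k))"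
  define M where "M = Suc (2 * k)"
  have prod_eq: "(\<Prod>i<n. 1 + X ^ (2 * i + 1)) = (\<Sum>j\<le>n. X ^ (j ^ 2) * dilate 2 (qbin X n j))" for n
  proof -
    have "(\<Prod>i<n. 1 + X ^ (2 * i + 1)) = (\<Prod>i<n. 1 + X * (X ^ 2) ^ i)"
      by (simp add: power_mult)
    also have "\<dots> = (\<Sum>j\<le>n. X ^ (j ^ 2) * dilate 2 (qbin X n j))"
      unfolding qbin_theorem
    proof (rule sum.cong[OF refl])
      fix j
      have "2 * (j choose 2) + j = j ^ 2" by (induction j) (simp_all add: choose_2_Suc power2_eq_square)
      then have "(X ^ 2) ^ (j choose 2) * X ^ j = X ^ (j ^ 2)" by (metis power_add power_mult)
      then show "(X ^ 2) ^ (j choose 2) * qbin (X ^ 2) n j * X ^ j * 1 ^ (n - j) = X ^ (j ^ 2) * dilate 2 (qbin X n j)"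
        unfolding qbin_dilate by (simp add: mult.left_commute mult.commute)
    qed
    finally show ?thesis .
  qed
  have g_big: "g n j = 0" if "n + j ^ 2 > 2 * k" for n j
    using that unfolding g_def mult.assoc[symmetric] power_add[symmetric] by (simp add: fps_X_power_mult_nth)
  have g_less: "g n j = 0" if "n < j" for n j
    using that by (simp add: g_def qbin_eq_0 dilate_0)
  have g_odd: "g n j = 0" if "odd (n + j)" for n j
  proof (cases "n + j ^ 2 > 2 * k")
    case False
    have "odd (n + j ^ 2)" using that by simp
    then have "odd (2 * k - (n + j ^ 2))" using False by simp
    then show ?thesis
      unfolding g_def mult.assoc[symmetric] power_add[symmetric] by (simp add: fps_X_power_mult_nth dilate_nth)
  qed (rule g_big)
  have g_even: "g (j + 2 * l) j = (X ^ l * (X ^ (Suc j choose 2) * qbin X (j + 2 * l) j)) $ k" for j l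
  proof -
    have "2 * (j choose 2) + j = j ^ 2" by (induction j) (simp_all add: choose_2_Suc power2_eq_square)
    then have e: "j + 2 * l + j ^ 2 = 2 * (l + (Suc j choose 2))" by (simp add: choose_2_Suc)
    have "g (j + 2 * l) j = dilate 2 (X ^ (l + (Suc j choose 2)) * qbin X (j + 2 * l) j) $ (2 * k)"
      unfolding g_def mult.assoc[symmetric] power_add[symmetric] e power_mult by (simp add: dilate_simps)
    then show ?thesis by (simp add: dilate_nth power_add mult.assoc)
  qed
  have "(\<Sum>n\<le>2 * k. (\<Prod>i<n. 1 + X ^ (2 * i + 1)) $ (2 * k - n)) = 
    (\<Sum>n\<le>2 * k. (X ^ n * (\<Sum>j\<le>n. X ^ (j ^ 2) * dilate 2 (qbin X n j))) $ (2 * k))"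
    unfolding prod_eq by (intro sum.cong refl) (simp add: fps_X_power_mult_nth)
  also have "\<dots> = (\<Sum>n\<le>2 * k. \<Sum>j\<le>n. g n j)"
    by (simp only: g_def sum_distrib_left fps_sum_nth)
  also have "\<dots> = (\<Sum>n<M. \<Sum>j<M. g n j)"
    unfolding M_def lessThan_Suc_atMost
    by (intro sum.cong refl sum.mono_neutral_left) (auto intro!: g_less)
  also have "\<dots> = (\<Sum>j<M. \<Sum>n<M. g n j)" by (rule sum.swap)
  also have "\<dots> = (\<Sum>j<M. \<Sum>l<M. g (j + 2 * l) j)"
  proof (rule sum.cong[OF refl])
    fix j
    show "(\<Sum>n<M. g n j) = (\<Sum>l<M. g (j + 2 * l) j)"
    proof -
      have "(\<Sum>n<M. g n j) = (\<Sum>n | n < M \<and> j \<le> n \<and> even (n + j). g n j)"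
        by (rule sum.mono_neutral_right) (auto intro: g_less g_odd)
      also have "\<dots> = (\<Sum>l | l < M \<and> j + 2 * l < M. g (j + 2 * l) j)"
      proof (rule sum.reindex_bij_witness[of _ "\<lambda>l. j + 2 * l" "\<lambda>n. (n - j) div 2"])
        fix n assume "n \<in> {n. n < M \<and> j \<le> n \<and> even (n + j)}"
        then have n: "n < M" "j \<le> n" "even (n + j)" by auto
        then have "even (n - j)" by simp
        then show 1: "j + 2 * ((n - j) div 2) = n" using n by simp
        then show "(n - j) div 2 \<in> {l. l < M \<and> j + 2 * l < M}" using n by auto
        show "g (j + 2 * ((n - j) div 2)) j = g n j" unfolding 1 ..
      qed auto
      also have "\<dots> = (\<Sum>l<M. g (j + 2 * l) j)"
        by (rule sum.mono_neutral_left) (auto intro!: g_big simp: M_def)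
      finally show ?thesis .
    qed
  qed
  also have "\<dots> = (\<Sum>l<M. \<Sum>j<M. g (j + 2 * l) j)" by (rule sum.swap)
  also have "\<dots> = (\<Sum>l<M. X ^ l * column_sum M (2 * l)) $ k"
    unfolding g_even fps_sum_nth column_sum_def sum_distrib_left ..
  also have "\<dots> = (\<Sum>l<M. X ^ l * (psi * inv_qfac l)) $ k"
  proof -
    have "agree M (\<Sum>l<M. X ^ l * column_sum M (2 * l)) (\<Sum>l<M. X ^ l * (psi * inv_qfac l))"
    proof (intro agree_sum agree_mult agree_refl)
      fix l
      have "agree M ((column_sum M (2 * l) * qfac (X ^ 2) l) * inv_qfac l) (psi * inv_qfac l)"
        by (intro agree_mult agree_refl column_sum_agree)
      moreover have "(column_sum M (2 * l) * qfac (X ^ 2) l) * inv_qfac l = column_sum M (2 * l) * (inv_qfac l * qfac (X ^ 2) l)"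
        by (simp only: mult_ac)
      ultimately show "agree M (column_sum M (2 * l)) (psi * inv_qfac l)" unfolding inv_qfac_mult by simp
    qed
    then show ?thesis by (simp add: agree_def M_def)
  qed
  also have "(\<Sum>l<M. X ^ l * (psi * inv_qfac l)) = psi * (\<Sum>l<M. X ^ l * inv_qfac l)"
    by (simp add: sum_distrib_left mult.left_commute)
  also have "(psi * (\<Sum>l<M. X ^ l * inv_qfac l)) $ k = (psi * (E 2 * I 1)) $ k"
    using agree_mult[OF agree_refl[of M psi] euler_sum[of M]] by (simp add: agree_def M_def)
  also have "psi * (E 2 * I 1) = E 2 ^ 3 * I 1 ^ 2" unfolding psi_def by algebra
  finally show ?thesis .
qed

section \<open>One-shell partitions and self-conjugate diagrams\<close>

text \<open>Self-conjugate Ferrers diagrams that fit into an n by n square.\<close>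

definition diagrams :: "nat \<Rightarrow> (nat \<times> nat) set set" where
  "diagrams n = {S. S \<subseteq> {1..n} \<times> {1..n} \<and> (\<forall>x y. (x, y) \<in> S \<longrightarrow> (y, x) \<in> S) \<and>
     (\<forall>x y x' y'. (x, y) \<in> S \<and> 1 \<le> x' \<and> x' \<le> x \<and> 1 \<le> y' \<and> y' \<le> y \<longrightarrow> (x', y') \<in> S)}"

lemma diagramsD:
  assumes "S \<in> diagrams n"
  shows "(x, y) \<in> S \<Longrightarrow> 1 \<le> x \<and> x \<le> n \<and> 1 \<le> y \<and> y \<le> n"
    and "(x, y) \<in> S \<Longrightarrow> (y, x) \<in> S"
    and "(x, y) \<in> S \<Longrightarrow> 1 \<le> x' \<Longrightarrow> x' \<le> x \<Longrightarrow> 1 \<le> y' \<Longrightarrow> y' \<le> y \<Longrightarrow> (x', y') \<in> S"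
proof -
  have h: "S \<subseteq> {1..n} \<times> {1..n} \<and> (\<forall>x y. (x, y) \<in> S \<longrightarrow> (y, x) \<in> S) \<and>
    (\<forall>x y x' y'. (x, y) \<in> S \<and> 1 \<le> x' \<and> x' \<le> x \<and> 1 \<le> y' \<and> y' \<le> y \<longrightarrow> (x', y') \<in> S)"
    using assms unfolding diagrams_def by (rule CollectD)
  note c = h[THEN conjunct2, THEN conjunct2, rule_format, of x y x' y']
  show "(x, y) \<in> S \<Longrightarrow> 1 \<le> x \<and> x \<le> n \<and> 1 \<le> y \<and> y \<le> n" using h[THEN conjunct1] by auto
  show "(x, y) \<in> S \<Longrightarrow> (y, x) \<in> S" by (rule h[THEN conjunct2, THEN conjunct1, rule_format])
  show "(x, y) \<in> S \<Longrightarrow> 1 \<le> x' \<Longrightarrow> x' \<le> x \<Longrightarrow> 1 \<le> y' \<Longrightarrow> y' \<le> y \<Longrightarrow> (x', y') \<in> S"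
    by (rule c) (intro conjI)
qed

lemma diagramsI:
  assumes "\<And>x y. (x, y) \<in> S \<Longrightarrow> 1 \<le> x \<and> x \<le> n \<and> 1 \<le> y \<and> y \<le> n"
    and "\<And>x y. (x, y) \<in> S \<Longrightarrow> (y, x) \<in> S"
    and "\<And>x y x' y'. (x, y) \<in> S \<Longrightarrow> 1 \<le> x' \<Longrightarrow> x' \<le> x \<Longrightarrow> 1 \<le> y' \<Longrightarrow> y' \<le> y \<Longrightarrow> (x', y') \<in> S"
  shows "S \<in> diagrams n"
  unfolding diagrams_def
proof (intro CollectI conjI allI impI)
  show "S \<subseteq> {1..n} \<times> {1..n}" by (rule subrelI) (use assms(1) in simp)
qed (use assms(2) in simp, elim conjE, rule assms(3))

lemma diagrams_sym: "S \<in> diagrams n \<Longrightarrow> (x, y) \<in> S \<longleftrightarrow> (y, x) \<in> S"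
  using diagramsD(2) by blast

lemma diagrams_finite: "finite (diagrams n)" "S \<in> diagrams n \<Longrightarrow> finite S"
proof -
  have "diagrams n \<subseteq> Pow ({1..n} \<times> {1..n})" by (auto simp: diagrams_def)
  then show "finite (diagrams n)" by (rule finite_subset) simp
  show "S \<in> diagrams n \<Longrightarrow> finite S"
    by (rule finite_subset[of _ "{1..n} \<times> {1..n}"]) (auto simp: diagrams_def)
qed

text \<open>The diagram with first row and first column of length m whose remainder, moved to the origin, is the given one.\<close>

definition hook :: "nat \<Rightarrow> (nat \<times> nat) set \<Rightarrow> (nat \<times> nat) set" where
  "hook m S = {(x, y). (x = 1 \<and> 1 \<le> y \<and> y \<le> m) \<or> (y = 1 \<and> 1 \<le> x \<and> x \<le> m) \<or> (2 \<le> x \<and> 2 \<le> y \<and> (x - 1, y - 1) \<in> S)}"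

lemma hook_in_diagrams:
  assumes S: "S \<in> diagrams n"
  shows "hook (Suc n) S \<in> diagrams (Suc n)"
  unfolding diagrams_def
proof (intro CollectI conjI allI impI)
  show "hook (Suc n) S \<subseteq> {1..Suc n} \<times> {1..Suc n}"
  proof (rule subrelI)
    fix x y assume "(x, y) \<in> hook (Suc n) S"
    then show "(x, y) \<in> {1..Suc n} \<times> {1..Suc n}"
      using diagramsD(1)[OF S, of "x - 1" "y - 1"] by (auto simp: hook_def)
  qed
  fix x y assume "(x, y) \<in> hook (Suc n) S"
  then show "(y, x) \<in> hook (Suc n) S" using diagramsD(2)[OF S, of "x - 1" "y - 1"] by (auto simp: hook_def)
next
  fix x y x' y'
  assume h: "(x, y) \<in> hook (Suc n) S \<and> 1 \<le> x' \<and> x' \<le> x \<and> 1 \<le> y' \<and> y' \<le> y"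
  have bound: "x \<le> Suc n \<and> y \<le> Suc n" using h diagramsD(1)[OF S, of "x - 1" "y - 1"] by (auto simp: hook_def)
  show "(x', y') \<in> hook (Suc n) S"
  proof (cases "x' = 1 \<or> y' = 1")
    case True
    with h bound show ?thesis by (auto simp: hook_def)
  next
    case False
    with h have g: "2 \<le> x'" "2 \<le> y'" "2 \<le> x" "2 \<le> y" by auto
    with h have "(x - 1, y - 1) \<in> S" by (auto simp: hook_def)
    then have "(x' - 1, y' - 1) \<in> S" by (rule diagramsD(3)[OF S]) (use g h in auto)
    with g show ?thesis by (auto simp: hook_def)
  qed
qed

lemma diagrams_0: "diagrams 0 = {{}}" by (auto simp: diagrams_def)

lemma diagrams_mono: "diagrams n \<subseteq> diagrams (Suc n)"
proof
  fix S assume S: "S \<in> diagrams n"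
  show "S \<in> diagrams (Suc n)"
  proof (rule diagramsI)
    fix x y assume "(x, y) \<in> S"
    from diagramsD(1)[OF S this] show "1 \<le> x \<and> x \<le> Suc n \<and> 1 \<le> y \<and> y \<le> Suc n" by simp
  qed (rule diagramsD(2)[OF S], assumption, rule diagramsD(3)[OF S])
qed

text \<open>Either a diagram already fits into the smaller square, or its first row has full length and the principal
hook can be removed.\<close>

lemma diagrams_Suc: "diagrams (Suc n) = diagrams n \<union> hook (Suc n) ` diagrams n"
proof
  show "diagrams (Suc n) \<subseteq> diagrams n \<union> hook (Suc n) ` diagrams n"
  proof
    fix S assume S: "S \<in> diagrams (Suc n)"
    show "S \<in> diagrams n \<union> hook (Suc n) ` diagrams n"
    proof (cases "(1, Suc n) \<in> S")
      case False
      have "S \<in> diagrams n"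
      proof (rule diagramsI)
        fix x y assume xy: "(x, y) \<in> S"
        note b = diagramsD(1)[OF S xy]
        have "y \<noteq> Suc n" using False diagramsD(3)[OF S xy, of 1 y] b by auto
        moreover have "x \<noteq> Suc n" using False diagramsD(3)[OF S diagramsD(2)[OF S xy], of 1 x] b by auto
        ultimately show "1 \<le> x \<and> x \<le> n \<and> 1 \<le> y \<and> y \<le> n" using b by auto
      qed (rule diagramsD(2)[OF S], assumption, rule diagramsD(3)[OF S])
      then show ?thesis by simp
    next
      case True
      define S' where "S' = {(x, y). 1 \<le> x \<and> 1 \<le> y \<and> (Suc x, Suc y) \<in> S}"
      have "S' \<in> diagrams n"
        unfolding diagrams_def
      proof (intro CollectI conjI allI impI)
        show "S' \<subseteq> {1..n} \<times> {1..n}" 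
        proof (rule subrelI)
          fix x y assume "(x, y) \<in> S'"
          then show "(x, y) \<in> {1..n} \<times> {1..n}"
            using diagramsD(1)[OF S, of "Suc x" "Suc y"] by (auto simp: S'_def)
        qed
        fix x y assume "(x, y) \<in> S'"
        then show "(y, x) \<in> S'" using diagramsD(2)[OF S, of "Suc x" "Suc y"] by (auto simp: S'_def)
      next
        fix x y x' y' assume "(x, y) \<in> S' \<and> 1 \<le> x' \<and> x' \<le> x \<and> 1 \<le> y' \<and> y' \<le> y"
        then show "(x', y') \<in> S'" using diagramsD(3)[OF S, of "Suc x" "Suc y" "Suc x'" "Suc y'"] by (auto simp: S'_def)
      qed
      moreover have "S = hook (Suc n) S'"
      proof (rule set_eqI)
        fix p :: "nat \<times> nat"
        obtain x y where p: "p = (x, y)" by (cases p)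
        have row: "(1, y) \<in> S \<longleftrightarrow> 1 \<le> y \<and> y \<le> Suc n" for y
          using diagramsD(1)[OF S, of 1 y] diagramsD(3)[OF S True, of 1 y] by auto
        have column: "(x, 1) \<in> S \<longleftrightarrow> 1 \<le> x \<and> x \<le> Suc n" for x
          using row[of x] diagrams_sym[OF S, of 1 x] by simp
        have zero: "(0, y) \<notin> S" "(x, 0) \<notin> S" for x y using diagramsD(1)[OF S, of 0 y] diagramsD(1)[OF S, of x 0] by auto
        show "p \<in> S \<longleftrightarrow> p \<in> hook (Suc n) S'"
        proof (cases "x \<le> 1 \<or> y \<le> 1")
          case True
          then have "x = 0 \<or> y = 0 \<or> x = 1 \<or> y = 1" by auto
          then show ?thesis unfolding p using row column zero by (auto simp: hook_def)
        next
          case False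
          then show ?thesis unfolding p by (auto simp: hook_def S'_def)
        qed
      qed
      ultimately show ?thesis by blast
    qed
  qed
  show "diagrams n \<union> hook (Suc n) ` diagrams n \<subseteq> diagrams (Suc n)"
    using diagrams_mono hook_in_diagrams by auto
qed

lemma hook_inj: "S \<in> diagrams n \<Longrightarrow> S' \<in> diagrams n' \<Longrightarrow> hook (Suc n) S = hook (Suc n') S' \<Longrightarrow> n = n' \<and> S = S'"
proof
  assume S: "S \<in> diagrams n" and S': "S' \<in> diagrams n'" and eq: "hook (Suc n) S = hook (Suc n') S'"
  have "(1, j) \<in> hook (Suc m) B \<longleftrightarrow> 1 \<le> j \<and> j \<le> Suc m" for j m B by (auto simp: hook_def)
  from this[of "Suc n" n S] this[of "Suc n" n' S'] this[of "Suc n'" n S] this[of "Suc n'" n' S']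
  have "Suc n \<le> Suc n' \<and> Suc n' \<le> Suc n" unfolding eq by simp
  then show "n = n'" by simp
  show "S = S'"
  proof (rule set_eqI)
    fix p :: "nat \<times> nat"
    obtain x y where p: "p = (x, y)" by (cases p)
    have *: "B \<in> diagrams m \<Longrightarrow> (x, y) \<in> B \<longleftrightarrow> 1 \<le> x \<and> 1 \<le> y \<and> (Suc x, Suc y) \<in> hook (Suc m) B" for B m
      using diagramsD(1)[of B m x y] by (auto simp: hook_def)
    then show "p \<in> S \<longleftrightarrow> p \<in> S'" 
      using *[OF S] *[OF S'] unfolding p eq by simp
  qed
qed

lemma hook_not_in_diagrams: "hook (Suc n) S \<notin> diagrams n"
proof
  assume "hook (Suc n) S \<in> diagrams n"
  moreover have "(1, Suc n) \<in> hook (Suc n) S" by (simp add: hook_def)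
  ultimately have "Suc n \<le> n" using diagramsD(1) by blast
  then show False by simp
qed

lemma card_hook:
  assumes "S \<in> diagrams n"
  shows "card (hook (Suc n) S) = 2 * n + 1 + card S"
proof -
  let ?A = "(\<lambda>y. (1 :: nat, y)) ` {1..Suc n}" and ?B = "(\<lambda>x. (x, 1 :: nat)) ` {2..Suc n}" and ?C = "map_prod Suc Suc ` S"
  have "hook (Suc n) S = ?A \<union> ?B \<union> ?C"
  proof (rule set_eqI)
    fix p :: "nat \<times> nat"
    obtain x y where p: "p = (x, y)" by (cases p)
    have "(x, y) \<in> ?C \<longleftrightarrow> 2 \<le> x \<and> 2 \<le> y \<and> (x - 1, y - 1) \<in> S"
    proof
      assume "(x, y) \<in> ?C"
      then show "2 \<le> x \<and> 2 \<le> y \<and> (x - 1, y - 1) \<in> S" using diagramsD(1)[OF assms] by fastforce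
    next
      assume "2 \<le> x \<and> 2 \<le> y \<and> (x - 1, y - 1) \<in> S"
      then show "(x, y) \<in> ?C" by (intro image_eqI[of _ _ "(x - 1, y - 1)"]) auto
    qed
    moreover have "(x, y) \<in> ?A \<longleftrightarrow> x = 1 \<and> 1 \<le> y \<and> y \<le> Suc n" "(x, y) \<in> ?B \<longleftrightarrow> y = 1 \<and> 2 \<le> x \<and> x \<le> Suc n"
      by auto
    ultimately show "p \<in> hook (Suc n) S \<longleftrightarrow> p \<in> ?A \<union> ?B \<union> ?C"
      unfolding p Un_iff hook_def mem_Collect_eq prod.case by (cases "x \<le> 1") auto
  qed
  moreover have "card (?A \<union> ?B \<union> ?C) = card (?A \<union> ?B) + card ?C"
    using diagrams_finite(2)[OF assms] diagramsD(1)[OF assms] by (intro card_Un_disjoint) fastforce+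
  moreover have "card (?A \<union> ?B) = card ?A + card ?B" by (intro card_Un_disjoint) auto
  moreover have "card ?A = Suc n" "card ?B = n" by (simp_all add: card_image inj_on_def)
  moreover have "card ?C = card S" by (intro card_image) (auto simp: inj_on_def)
  ultimately show ?thesis by simp
qed

text \<open>Diagrams correspond to sets of distinct odd hook lengths below 2 n.\<close>

lemma diagrams_gf: "(\<Sum>S\<in>diagrams n. X ^ card S) = (\<Prod>i<n. 1 + X ^ (2 * i + 1))"
proof (induction n)
  case 0
  then show ?case by (simp add: diagrams_0)
next
  case (Suc n)
  have "(\<Sum>S\<in>diagrams (Suc n). X ^ card S) = (\<Sum>S\<in>diagrams n. X ^ card S) + (\<Sum>S\<in>hook (Suc n) ` diagrams n. X ^ card S)"
    unfolding diagrams_Suc by (intro sum.union_disjoint) (auto simp: diagrams_finite hook_not_in_diagrams)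
  also have "(\<Sum>S\<in>hook (Suc n) ` diagrams n. X ^ card S) = (\<Sum>S\<in>diagrams n. X ^ card (hook (Suc n) S))"
    by (intro sum.reindex[unfolded comp_def]) (auto simp: inj_on_def dest: hook_inj)
  also have "\<dots> = X ^ (2 * n + 1) * (\<Sum>S\<in>diagrams n. X ^ card S)"
    unfolding sum_distrib_left power_add[symmetric] by (intro sum.cong refl) (simp add: card_hook)
  finally show ?case unfolding Suc.IH prod.lessThan_Suc by (simp add: algebra_simps)
qed

text \<open>The 1-shell partition with bottom layer S: since every point has a coordinate 1, symmetry determines all points
from those with last coordinate 1.\<close>

definition shell :: "(nat \<times> nat) set \<Rightarrow> (nat \<times> nat \<times> nat) set" where
  "shell S = {(x, y, z). (x = 1 \<and> (y, z) \<in> S) \<or> (y = 1 \<and> (x, z) \<in> S) \<or> (z = 1 \<and> (x, y) \<in> S)}"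

lemma shell_layer:
  assumes "S \<in> diagrams n"
  shows "(x, y, 1) \<in> shell S \<longleftrightarrow> (x, y) \<in> S"
  using diagramsD(2)[OF assms, of x y] diagramsD(2)[OF assms, of y x] by (auto simp: shell_def)

text \<open>Besides (1, 1, 1) the shell has three edges of n points and, for each cell of the inner diagram, one point on each of
its three faces.\<close>

lemma card_shell_hook:
  assumes "S \<in> diagrams n"
  shows "finite (shell (hook (Suc n) S))" "card (shell (hook (Suc n) S)) = 3 * (n + card S) + 1"
proof -
  let ?J = "{2..Suc n}"
  let ?A1 = "(\<lambda>j. (1 :: nat, 1 :: nat, j)) ` ?J" and ?A2 = "(\<lambda>j. (1 :: nat, j, 1 :: nat)) ` ?J"
    and ?A3 = "(\<lambda>j. (j, 1 :: nat, 1 :: nat)) ` ?J"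
  let ?B1 = "(\<lambda>(x, y). (1 :: nat, Suc x, Suc y)) ` S" and ?B2 = "(\<lambda>(x, y). (Suc x, 1 :: nat, Suc y)) ` S"
    and ?B3 = "(\<lambda>(x, y). (Suc x, Suc y, 1 :: nat)) ` S"
  let ?O = "{(1, 1, 1)} :: (nat \<times> nat \<times> nat) set"
  have pos: "1 \<le> x \<and> 1 \<le> y" if "(x, y) \<in> S" for x y using diagramsD(1)[OF assms that] by simp
  have fin: "finite S" by (rule diagrams_finite(2)[OF assms])
  have im: "(x, y, z) \<in> ?B1 \<longleftrightarrow> x = 1 \<and> 2 \<le> y \<and> 2 \<le> z \<and> (y - 1, z - 1) \<in> S"
     "(x, y, z) \<in> ?B2 \<longleftrightarrow> y = 1 \<and> 2 \<le> x \<and> 2 \<le> z \<and> (x - 1, z - 1) \<in> S"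
     "(x, y, z) \<in> ?B3 \<longleftrightarrow> z = 1 \<and> 2 \<le> x \<and> 2 \<le> y \<and> (x - 1, y - 1) \<in> S" for x y z
    using pos by (force intro: image_eqI[of _ _ "(y - 1, z - 1)"] image_eqI[of _ _ "(x - 1, z - 1)"] image_eqI[of _ _ "(x - 1, y - 1)"])+
  have im': "(x, y, z) \<in> ?A1 \<longleftrightarrow> x = 1 \<and> y = 1 \<and> 2 \<le> z \<and> z \<le> Suc n"
     "(x, y, z) \<in> ?A2 \<longleftrightarrow> x = 1 \<and> z = 1 \<and> 2 \<le> y \<and> y \<le> Suc n"
     "(x, y, z) \<in> ?A3 \<longleftrightarrow> y = 1 \<and> z = 1 \<and> 2 \<le> x \<and> x \<le> Suc n" for x y z by auto
  have eq: "shell (hook (Suc n) S) = ?O \<union> (?A1 \<union> (?A2 \<union> (?A3 \<union> (?B1 \<union> (?B2 \<union> ?B3)))))"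
  proof (rule set_eqI)
    fix p :: "nat \<times> nat \<times> nat"
    obtain x y z where p: "p = (x, y, z)" by (cases p)
    show "p \<in> shell (hook (Suc n) S) \<longleftrightarrow> p \<in> ?O \<union> (?A1 \<union> (?A2 \<union> (?A3 \<union> (?B1 \<union> (?B2 \<union> ?B3)))))"
      unfolding p Un_iff im im' shell_def hook_def mem_Collect_eq prod.case
      by (cases "x \<le> 1"; cases "y \<le> 1"; cases "z \<le> 1") auto
  qed
  show "finite (shell (hook (Suc n) S))" unfolding eq using fin by simp
  have "card (shell (hook (Suc n) S)) = card ?O + (card ?A1 + (card ?A2 + (card ?A3 + (card ?B1 + (card ?B2 + card ?B3)))))"
    unfolding eq
    by (subst card_Un_disjoint; (force simp: fin dest: pos)?)+
  moreover have "card ?A1 = n" "card ?A2 = n" "card ?A3 = n"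
    by (simp_all add: card_image inj_on_def)
  moreover have "card ?B1 = card S" "card ?B2 = card S" "card ?B3 = card S"
    by (intro card_image; force simp: inj_on_def)+
  ultimately show "card (shell (hook (Suc n) S)) = 3 * (n + card S) + 1" by simp
qed

lemma diagrams_nonempty:
  "S \<in> diagrams M \<Longrightarrow> S \<noteq> {} \<Longrightarrow> \<exists>n. \<exists>S'\<in>diagrams n. S = hook (Suc n) S'"
  by (induction M) (auto simp: diagrams_0 diagrams_Suc)

lemma shell_of_diagram:
  assumes S: "S \<in> diagrams n" and fin: "finite (shell S)" and card: "card (shell S) = N"
  shows "plane_partition N (shell S)" "totally_symmetric (shell S)" "one_shell (shell S)"
proof -
  have "1 \<le> x \<and> 1 \<le> y \<and> 1 \<le> z" if "(x, y, z) \<in> shell S" for x y z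
    using that diagramsD(1)[OF S, of x y] diagramsD(1)[OF S, of x z] diagramsD(1)[OF S, of y z] by (auto simp: shell_def)
  moreover have "(x', y', z') \<in> shell S"
    if "(x, y, z) \<in> shell S \<and> 1 \<le> x' \<and> x' \<le> x \<and> 1 \<le> y' \<and> y' \<le> y \<and> 1 \<le> z' \<and> z' \<le> z" for x y z x' y' z'
    using that diagramsD(3)[OF S, of x y x' y'] diagramsD(3)[OF S, of x z x' z'] diagramsD(3)[OF S, of y z y' z'] 
    by (auto simp: shell_def)
  ultimately show "plane_partition N (shell S)" using fin card unfolding plane_partition_def by blast
  show "totally_symmetric (shell S)"
    unfolding totally_symmetric_def
  proof (intro allI impI)
    fix x y z assume "(x, y, z) \<in> shell S"
    then show "{(x, y, z), (x, z, y), (y, x, z), (y, z, x), (z, x, y), (z, y, x)} \<subseteq> shell S"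
      using diagrams_sym[OF S, of x y] diagrams_sym[OF S, of x z] diagrams_sym[OF S, of y z] by (auto simp: shell_def)
  qed
  show "one_shell (shell S)" by (auto simp: one_shell_def shell_def)
qed

lemma one_shell_is_shell:
  assumes P: "plane_partition N P" "totally_symmetric P" "one_shell P"
  obtains M S where "S \<in> diagrams M" "P = shell S" "P \<noteq> {} \<Longrightarrow> S \<noteq> {}"
proof -
  define S where "S = {(x, y). (x, y, 1) \<in> P}"
  have fin: "finite P" and pos: "\<And>x y z. (x, y, z) \<in> P \<Longrightarrow> 1 \<le> x \<and> 1 \<le> y \<and> 1 \<le> z"
    and closed: "\<And>x y z x' y' z'. (x, y, z) \<in> P \<Longrightarrow> 1 \<le> x' \<Longrightarrow> x' \<le> x \<Longrightarrow> 1 \<le> y' \<Longrightarrow> y' \<le> y \<Longrightarrow> 1 \<le> z' \<Longrightarrow> z' \<le> z \<Longrightarrow> (x', y', z') \<in> P"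
    using P(1) unfolding plane_partition_def by blast+
  have perm: "(x, z, y) \<in> P" "(y, x, z) \<in> P" "(y, z, x) \<in> P" "(z, x, y) \<in> P" "(z, y, x) \<in> P" if "(x, y, z) \<in> P" for x y z
    using P(2) that unfolding totally_symmetric_def by blast+
  define M where "M = Max (fst ` P)"
  have bound: "x \<le> M" if "(x, y, z) \<in> P" for x y z
    unfolding M_def using fin that by (intro Max_ge) force+
  have S: "S \<in> diagrams M"
  proof (rule diagramsI)
    fix x y assume "(x, y) \<in> S"
    then have xy: "(x, y, 1) \<in> P" by (simp add: S_def)
    show "1 \<le> x \<and> x \<le> M \<and> 1 \<le> y \<and> y \<le> M" using pos[OF xy] bound[OF xy] bound[OF perm(2)[OF xy]] by simp
    show "(y, x) \<in> S" using perm(2)[OF xy] by (simp add: S_def)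
  next
    fix x y x' y' assume "(x, y) \<in> S" and h: "1 \<le> x'" "x' \<le> x" "1 \<le> y'" "y' \<le> y"
    then have xy: "(x, y, 1) \<in> P" by (simp add: S_def)
    show "(x', y') \<in> S" using closed[OF xy h] by (simp add: S_def)
  qed
  have "P = shell S"
  proof (rule set_eqI)
    fix p :: "nat \<times> nat \<times> nat"
    obtain x y z where p: "p = (x, y, z)" by (cases p)
    show "p \<in> P \<longleftrightarrow> p \<in> shell S"
    proof
      assume "p \<in> P"
      then have xyz: "(x, y, z) \<in> P" by (simp add: p)
      then have "\<not> (2 \<le> x \<and> 2 \<le> y \<and> 2 \<le> z)" using P(3) unfolding one_shell_def by blast
      then have "x = 1 \<or> y = 1 \<or> z = 1" using pos[OF xyz] by auto
      then show "p \<in> shell S" using xyz perm(1)[OF xyz] perm(3)[OF xyz] by (auto simp: p shell_def S_def)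
    next
      assume "p \<in> shell S"
      then show "p \<in> P" using perm(1)[of x z 1] perm(4)[of y z 1] by (auto simp: p shell_def S_def)
    qed
  qed
  moreover have "S \<noteq> {}" if "P \<noteq> {}"
  proof -
    from that obtain x y z where xyz: "(x, y, z) \<in> P" by (metis all_not_in_conv prod_cases3)
    have "(1, 1, 1) \<in> P" by (rule closed[OF xyz]) (use pos[OF xyz] in auto)
    then show ?thesis by (auto simp: S_def)
  qed
  ultimately show ?thesis using that S by blast
qed

text \<open>The index n + 1 is the length of the first row, and 3 (n + |S|) + 1 = 3 m + 1 fixes the size of the inner diagram.\<close>

lemma one_shell_sets:
  "{P. plane_partition (3 * m + 1) P \<and> totally_symmetric P \<and> one_shell P} =
    (\<Union>n\<in>{..m}. (\<lambda>S. shell (hook (Suc n) S)) ` {S \<in> diagrams n. card S = m - n})" (is "?L = ?R")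
proof
  show "?L \<subseteq> ?R"
  proof
    fix P assume "P \<in> ?L"
    then have P: "plane_partition (3 * m + 1) P" "totally_symmetric P" "one_shell P" by auto
    then have card: "card P = 3 * m + 1" by (simp add: plane_partition_def)
    obtain M S where S: "S \<in> diagrams M" "P = shell S" "P \<noteq> {} \<Longrightarrow> S \<noteq> {}" using one_shell_is_shell[OF P] by blast
    have "P \<noteq> {}" using card by auto
    then obtain n S' where S': "S' \<in> diagrams n" "S = hook (Suc n) S'" using diagrams_nonempty[OF S(1)] S(3) by blast
    have "m = n + card S'" using card_shell_hook(2)[OF S'(1)] card unfolding S(2) S'(2) by simp
    then show "P \<in> ?R" unfolding S(2) S'(2) using S'(1) by (intro UN_I[of n] image_eqI[of _ _ S']) auto
  qed
  show "?R \<subseteq> ?L"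
  proof
    fix P assume "P \<in> ?R"
    then obtain n S where n: "n \<le> m" and S: "S \<in> diagrams n" "card S = m - n" and P: "P = shell (hook (Suc n) S)" by auto
    have "card P = 3 * m + 1" using card_shell_hook(2)[OF S(1)] S(2) n unfolding P by simp
    then show "P \<in> ?L"
      using shell_of_diagram[OF hook_in_diagrams[OF S(1)] card_shell_hook(1)[OF S(1)]] unfolding P by simp
  qed
qed

lemma shell_hook_inj:
  assumes "S \<in> diagrams n" "S' \<in> diagrams n'" "shell (hook (Suc n) S) = shell (hook (Suc n') S')"
  shows "n = n' \<and> S = S'"
proof (rule hook_inj[OF assms(1,2)])
  show "hook (Suc n) S = hook (Suc n') S'"
  proof (rule set_eqI)
    fix p :: "nat \<times> nat"
    obtain x y where p: "p = (x, y)" by (cases p)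
    show "p \<in> hook (Suc n) S \<longleftrightarrow> p \<in> hook (Suc n') S'"
      using shell_layer[OF hook_in_diagrams[OF assms(1)], of x y] shell_layer[OF hook_in_diagrams[OF assms(2)], of x y]
      unfolding p assms(3) by simp
  qed
qed

theorem one_shell_count:
  "of_nat (one_shell_tspp_count (3 * m + 1)) = (\<Sum>n\<le>m. (\<Prod>i<n. 1 + X ^ (2 * i + 1)) $ (m - n))"
proof -
  let ?A = "\<lambda>n. {S \<in> diagrams n. card S = m - n}"
  have "one_shell_tspp_count (3 * m + 1) = card (\<Union>n\<in>{..m}. (\<lambda>S. shell (hook (Suc n) S)) ` ?A n)"
    unfolding one_shell_tspp_count_def one_shell_sets ..
  also have "\<dots> = (\<Sum>n\<le>m. card ((\<lambda>S. shell (hook (Suc n) S)) ` ?A n))"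
  proof (rule card_UN_disjoint)
    show "\<forall>i\<in>{..m}. \<forall>j\<in>{..m}. i \<noteq> j \<longrightarrow>
      (\<lambda>S. shell (hook (Suc i) S)) ` ?A i \<inter> (\<lambda>S. shell (hook (Suc j) S)) ` ?A j = {}"
      using shell_hook_inj by fastforce
  qed (simp_all add: diagrams_finite)
  also have "\<dots> = (\<Sum>n\<le>m. card (?A n))"
    by (intro sum.cong refl card_image) (auto simp: inj_on_def dest: shell_hook_inj)
  finally have "of_nat (one_shell_tspp_count (3 * m + 1)) = (\<Sum>n\<le>m. of_nat (card (?A n)) :: complex)" by simp
  also have "\<dots> = (\<Sum>n\<le>m. (\<Sum>S\<in>diagrams n. X ^ card S) $ (m - n))"
  proof (rule sum.cong[OF refl])
    fix n
    have "(\<Sum>S\<in>diagrams n. X ^ card S) $ (m - n) = (\<Sum>S\<in>diagrams n. if card S = m - n then 1 else 0)"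
      unfolding fps_sum_nth by (intro sum.cong) (auto simp: fps_X_power_nth)
    also have "\<dots> = of_nat (card (?A n))"
      by (subst sum.inter_filter[symmetric]) (simp_all add: diagrams_finite)
    finally show "of_nat (card (?A n)) = (\<Sum>S\<in>diagrams n. X ^ card S) $ (m - n)" ..
  qed
  finally show ?thesis unfolding diagrams_gf .
qed

section \<open>The generating function and the congruence\<close>

theorem one_shell_even: "of_nat (one_shell_tspp_count (6 * k + 1)) = (E 2 ^ 3 * I 1 ^ 2) $ k"
  using one_shell_count[of "2 * k"] unfolding even_part_of_one_shell_series by simp

lemma one_shell_section: "of_nat (one_shell_tspp_count (150 * n + 25)) = 5 * sect 5 0 M1 $ n"
proof -
  \<comment> \<open>The index 150 n + 25, written so that the sections in the classes 4 and 0 appear.\<close>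
  have "of_nat (one_shell_tspp_count (6 * (5 * (5 * n + 0) + 4) + 1)) = sect 5 0 (sect 5 4 (E 2 ^ 3 * I 1 ^ 2)) $ n"
    unfolding one_shell_even sect_nth ..
  then show ?thesis unfolding first_section sect_numeral_mult by (simp add: numeral_fps_const algebra_simps)
qed

theorem theorem1p3:
  shows "Abs_fps (\<lambda>n. of_nat (one_shell_tspp_count (150 * n + 25))) =
           5 * (euler_E 2 ^ 5 * euler_E 5 ^ 4 / (euler_E 1 ^ 6 * euler_E 10 ^ 2)
              + 160 * fps_X * (euler_E 2 ^ 11 * euler_E 5 ^ 4 / euler_E 1 ^ 14)
              + 2000 * fps_X ^ 2 * (euler_E 2 ^ 11 * euler_E 5 ^ 10 / euler_E 1 ^ 20))
         \<and> (\<forall>n. [one_shell_tspp_count (18750 * n + 15625) = 0] (mod 125))"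
proof (intro conjI allI)
  have nth_0: "(E j ^ k) $ 0 = 1" if "j > 0" for j k using euler_E_nth_0[OF that] by (simp add: fps_nth_power_0)
  have q1: "E 2 ^ 5 * E 5 ^ 4 / (E 1 ^ 6 * E 10 ^ 2) = E 2 ^ 5 * E 5 ^ 4 * I 1 ^ 6 * I 10 ^ 2"
    by (simp add: fps_divide_unit nth_0 fps_inverse_mult fps_inverse_power mult.assoc)
  have q2: "E 2 ^ 11 * E 5 ^ 4 / E 1 ^ 14 = E 2 ^ 11 * E 5 ^ 4 * I 1 ^ 14"
    by (simp add: fps_divide_unit nth_0 fps_inverse_power)
  have q3: "E 2 ^ 11 * E 5 ^ 10 / E 1 ^ 20 = E 2 ^ 11 * E 5 ^ 10 * I 1 ^ 20"
    by (simp add: fps_divide_unit nth_0 fps_inverse_power)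
  let ?\<Phi> = "E 2 ^ 5 * E 5 ^ 4 * I 1 ^ 6 * I 10 ^ 2"
  have "?\<Phi> * (x_ser * z_ser) = X * (E 2 ^ 11 * E 5 ^ 4 * I 1 ^ 14) * ((E 5 * I 5) * (E 10 * I 10) ^ 3)"
    unfolding x_ser_def z_ser_def by algebra
  then have t2: "?\<Phi> * (x_ser * z_ser) = X * (E 2 ^ 11 * E 5 ^ 4 * I 1 ^ 14)" unfolding EI by simp
  have "?\<Phi> * (x_ser * y_ser) ^ 2 = X ^ 2 * (E 2 ^ 11 * E 5 ^ 10 * I 1 ^ 20) * ((E 5 * I 5) ^ 2 * (E 10 * I 10) ^ 6)"
    unfolding x_ser_def y_ser_def by algebra
  then have t3: "?\<Phi> * (x_ser * y_ser) ^ 2 = X ^ 2 * (E 2 ^ 11 * E 5 ^ 10 * I 1 ^ 20)" unfolding EI by simp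
  have "sect 5 0 M1 = ?\<Phi> + 160 * (?\<Phi> * (x_ser * z_ser)) + 2000 * (?\<Phi> * (x_ser * y_ser) ^ 2)"
    unfolding second_section by algebra
  also have "\<dots> = ?\<Phi> + 160 * X * (E 2 ^ 11 * E 5 ^ 4 * I 1 ^ 14) + 2000 * X ^ 2 * (E 2 ^ 11 * E 5 ^ 10 * I 1 ^ 20)"
    unfolding t2 t3 by (simp only: mult.assoc)
  finally have s: "sect 5 0 M1 = \<dots>" .
  have "Abs_fps (\<lambda>n. of_nat (one_shell_tspp_count (150 * n + 25))) = 5 * sect 5 0 M1"
    by (rule fps_ext) (simp add: one_shell_section numeral_fps_const)
  then show "Abs_fps (\<lambda>n. of_nat (one_shell_tspp_count (150 * n + 25))) =
           5 * (euler_E 2 ^ 5 * euler_E 5 ^ 4 / (euler_E 1 ^ 6 * euler_E 10 ^ 2)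
              + 160 * fps_X * (euler_E 2 ^ 11 * euler_E 5 ^ 4 / euler_E 1 ^ 14)
              + 2000 * fps_X ^ 2 * (euler_E 2 ^ 11 * euler_E 5 ^ 10 / euler_E 1 ^ 20))"
    unfolding q1 q2 q3 s .
next
  fix n
  obtain c where c: "sect 5 4 (sect 5 0 (sect 5 4 (sect 5 0 M1))) $ n = of_int (25 * c)"
    using fcong_nth[OF fifth_section] by blast
  \<comment> \<open>The index written so that the sections in the classes 4, 0 and 4 appear.\<close>
  have e: "18750 * n + 15625 = 150 * (5 * (5 * (5 * n + 4) + 0) + 4) + 25" by simp
  have "(of_nat (one_shell_tspp_count (18750 * n + 15625)) :: complex) = 5 * of_int (25 * c)"
    unfolding e one_shell_section c[symmetric] sect_nth ..
  then have "(of_int (int (one_shell_tspp_count (18750 * n + 15625))) :: complex) = of_int (125 * c)" by simp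
  then have "int (one_shell_tspp_count (18750 * n + 15625)) = 125 * c" by (simp only: of_int_eq_iff)
  then have "int 125 dvd int (one_shell_tspp_count (18750 * n + 15625))" by simp
  then show "[one_shell_tspp_count (18750 * n + 15625) = 0] (mod 125)"
    unfolding int_dvd_int_iff cong_0_iff .
qed

end
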